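(* Let $\alpha_M\in[0,1)$ and $L>0$. With $H^{\alpha_M}_{x_0}(\omega_0,x,L)$ the transverse profile of the refocused wave (with radiation losses) defined in the context, in the continuum limit of a large number of propagating modes ($\omega_0\to+\infty$, so $N(\omega_0)\to+\infty$) one has, for every $\tilde x\in\mathbb{R}$, \[ \lim_{\omega_0 \to +\infty}\frac{\lambda_{oc}^{1-\alpha_M}}{\theta}\,H^{\alpha_M}_{x_0}\Big(\omega_0,\,x_0+\frac{\lambda_{oc}}{\theta}\tilde{x},\,L\Big)=\frac{\tilde{d}_2+\tilde{d}_1}{d}\,H(\tilde{x},L), \qquad H(\tilde{x},L)=\int_0^1 \mathcal{T}_1 (L,u)\cos(2\pi u\tilde{x})\,du, \] where $\mathcal{T}_1(z,u)$, $z>0$, $u\in[0,1]$, is the solution of \[\frac{\partial}{\partial z} \mathcal{T}_1 (z,u)= \frac{\partial}{\partial u}\Big(a_{\infty}(u)\frac{\partial}{\partial u} \mathcal{T}_1(z,u)\Big), \] with boundary and initial conditions \[ \frac{\partial}{\partial u} \mathcal{T}_1 (z,0)=0,\quad \mathcal{T}_1 (z,1)=0 \quad (\forall z>0),\qquad \mathcal{T}_1 (0,u)=1,\] and \[a_{\infty}(u)=\frac{a_0 }{1-\left(1-\frac{\pi^2 }{a^2 d^2} \right)(\theta u)^2},\qquad a_0 = \frac{ \pi^2 S_{0} }{ 2 a n_1 ^4 d^4 \theta ^2},\] \[S_0 =\int_0^d\int_0^d \gamma_0(x_1,x_2)\cos\Big(\frac{\pi}{d}x_1\Big)\cos\Big(\frac{\pi}{d}x_2\Big)dx_1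 dx_2 .\]
   Context: Fixed parameters: ocean depth $d>0$, index of refraction $n_1>1$ in the ocean section $[0,d]$ (and $1$ for $x>d$), $\theta=\sqrt{1-1/n_1^2}$, sound speed $c>0$, source depth $x_0\in(0,d)$. For a carrier frequency $\omega_0>0$: $k(\omega_0)=\omega_0/c$ and $\lambda_{oc}=2\pi c/(n_1\omega_0)$ (carrier wavelength in the ocean). Propagating modes. $N=N(\omega_0)$ is the number of solutions $0<\sigma_1(\omega_0)<\dots<\sigma_{N}(\omega_0)<n_1k(\omega_0)d\theta$ of $\tan y=-y/\sqrt{(n_1k(\omega_0)d\theta)^2-y^2}$ on $(0,n_1k(\omega_0)d\theta)$. Put $\zeta_j=\sqrt{(n_1k(\omega_0)d\theta)^2-\sigma_j^2}$, $\beta_j(\omega_0)=\sqrt{n_1^2k^2(\omega_0)-\sigma_j^2/d^2}$ (so $k<\beta_N<\dots<\beta_1<n_1k$), \[A_j(\omega_0)=\sqrt{\frac{2/d}{1+\frac{\sin^2 \sigma_j}{\zeta_j}-\frac{\sin(2 \sigma_j)}{2\sigma_j}}},\] and $\phi_j(\omega_0,x)=A_j\sin(\sigma_jx/d)$ for $0\le x\le d$, $\phi_j(\omega_0,x)=A_j\sin(\sigma_j)e^{-\zeta_j(x-d)/d}$ for $x\ge d$. Radiating modes. For $\gamma\in(0,k^2(\omega_0))$, with $\eta=d\sqrt{n_1^2k^2(\omega_0)-\gamma}$, $\xi=d\sqrt{k^2(\omega_0)-\gamma}$: $\phi_\gamma(\omega_0,x)=A_\gamma\sin(\eta x/d)$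 for $x\in[0,d]$, $A_\gamma=\sqrt{\dfrac{d\,\xi}{\pi(\xi^2\sin^2\eta+\eta^2\cos^2\eta)}}$. Random medium. The perturbation $V(x,z)$, $x\in[0,d]$, $z\ge0$, is a continuous real zero-mean stationary process with $\mathbb{E}[V(x_1,z_1)V(x_2,z_2)]=\gamma_0(x_1,x_2)e^{-a|z_1-z_2|}$, $a>0$ ($1/a$ is the longitudinal correlation length, $\gamma_0$ the transverse covariance function). Coupling coefficients. For mode indices $j,l$ (discrete), $j\ne l$, \[\Gamma^c_{jl}(\omega_0)=\frac{k^4(\omega_0)}{2\beta_j\beta_l}\int_0^{\infty}\mathbb{E}[C_{jl}(0)C_{jl}(z)]\cos((\beta_l-\beta_j)z)\,dz,\quad C_{jl}(z)=\int_0^d\phi_j(\omega_0,x)\phi_l(\omega_0,x)V(x,z)dx,\] \[\Lambda^c_{j}(\omega_0)=\int_0^{k^2(\omega_0)}\frac{k^4(\omega_0)}{4\sqrt{\gamma'}\beta_j}\int_0^\infty\mathbb{E}[C_{j\gamma'}(0)C_{j\gamma'}(z)]\cos((\sqrt{\gamma'}-\beta_j)z)\,dz\,d\gamma',\quad C_{j\gamma'}(z)=\int_0^d\phi_j\phi_{\gamma'}V(x,z)dx.\] Coupled power equations with nearest-neighbour coupling. Under the band-limiting idealization (the transverse power spectral density of $V$ has compact support) only neighbouring propagating modes are coupled, and only the highest propagating mode is coupled to the radiating modes. For each $l\in\{1,\dots,N\}$, $(\mathcal{T}^l_j(\omega_0,z))_{1\le j\le N}$ is the solution of \[\tfrac{d}{dz}\mathcal{T}^l_N=-\Lambda^c_N\mathcal{T}^l_N+\Gamma^c_{N-1\,N}(\mathcal{T}^l_{N-1}-\mathcal{T}^l_N),\]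 \[\tfrac{d}{dz}\mathcal{T}^l_j=\Gamma^c_{j-1\,j}(\mathcal{T}^l_{j-1}-\mathcal{T}^l_j)+\Gamma^c_{j+1\,j}(\mathcal{T}^l_{j+1}-\mathcal{T}^l_j),\quad 2\le j\le N-1,\] \[\tfrac{d}{dz}\mathcal{T}^l_1=\Gamma^c_{2\,1}(\mathcal{T}^l_2-\mathcal{T}^l_1),\qquad \mathcal{T}^l_j(\omega_0,0)=\delta_{jl}.\] Mirror. The time-reversal mirror occupies $[d_1,d_2]\subset[0,d]$ with $d_2=d_M+\lambda_{oc}^{\alpha_M}\tilde d_2$, $d_1=d_M-\lambda_{oc}^{\alpha_M}\tilde d_1$, $d_M\in(0,d)$, $\tilde d_1,\tilde d_2>0$ fixed. With $\mathrm{sinc}(s)=\sin(s)/s$, \[M_{jj}(\omega_0)=(d_2-d_1)A_j^2(\omega_0)\Big[1-\cos\Big(\sigma_j\frac{d_2+d_1}{d}\Big)\mathrm{sinc}\Big(\sigma_j\frac{d_2-d_1}{d}\Big)\Big].\] Transverse profile of the refocused wave: \[H^{\alpha_M}_{x_0}(\omega_0,x,L)=\frac14\sum_{j,l=1}^{N(\omega_0)}M_{jj}(\omega_0)\,\mathcal{T}^l_j(\omega_0,L)\,\phi_l(\omega_0,x_0)\,\phi_l(\omega_0,x).\]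
   Formalization: The limit ω₀→+∞ is taken along frequencies with N(ω₀)ζ_N(ω₀)→+∞; the unrestricted limit is false, since just above each cutoff A_N, hence Γ^c_{N-1 N} and Λ^c_N, tends to 0 and the profile tends to the loss-free one. *)

theory Defs
  imports "HOL-Probability.Probability"
begin

text \<open>
  Throughout, \<open>d\<close> is the ocean depth, \<open>n1\<close> the index of refraction of the ocean, \<open>c\<close> the sound
  speed and \<open>w\<close> the carrier frequency.
\<close>

definition index_theta :: "real \<Rightarrow> real" where
  "index_theta n1 = sqrt (1 - 1 / n1\<^sup>2)"

definition wavenumber :: "real \<Rightarrow> real \<Rightarrow> real" where
  "wavenumber c w = w / c"

definition ocean_wavelength :: "real \<Rightarrow> real \<Rightarrow> real \<Rightarrow> real" where
  "ocean_wavelength n1 c w = 2 * pi * c / (n1 * w)"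

section \<open>Propagating modes\<close>

definition mode_bound :: "real \<Rightarrow> real \<Rightarrow> real \<Rightarrow> real \<Rightarrow> real" where
  "mode_bound d n1 c w = n1 * wavenumber c w * d * index_theta n1"

text \<open>
  The library's \<open>tan\<close> is \<open>0\<close> at its poles, where the right-hand side below is negative; so the
  poles are not spurious solutions.
\<close>

definition mode_roots :: "real \<Rightarrow> real \<Rightarrow> real \<Rightarrow> real \<Rightarrow> real set" where
  "mode_roots d n1 c w =
     {y. 0 < y \<and> y < mode_bound d n1 c w \<and> tan y = - y / sqrt ((mode_bound d n1 c w)\<^sup>2 - y\<^sup>2)}"

definition num_modes :: "real \<Rightarrow> real \<Rightarrow> real \<Rightarrow> real \<Rightarrow> nat" where
  "num_modes d n1 c w = card (mode_roots d n1 c w)"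

text \<open>Modes are numbered from \<open>1\<close> to \<open>num_modes d n1 c w\<close>, list positions from \<open>0\<close>.\<close>

definition mode_sigma :: "real \<Rightarrow> real \<Rightarrow> real \<Rightarrow> real \<Rightarrow> nat \<Rightarrow> real" where
  "mode_sigma d n1 c w j = sorted_list_of_set (mode_roots d n1 c w) ! (j - 1)"

definition mode_zeta :: "real \<Rightarrow> real \<Rightarrow> real \<Rightarrow> real \<Rightarrow> nat \<Rightarrow> real" where
  "mode_zeta d n1 c w j = sqrt ((mode_bound d n1 c w)\<^sup>2 - (mode_sigma d n1 c w j)\<^sup>2)"

definition mode_beta :: "real \<Rightarrow> real \<Rightarrow> real \<Rightarrow> real \<Rightarrow> nat \<Rightarrow> real" where
  "mode_beta d n1 c w j = sqrt (n1\<^sup>2 * (wavenumber c w)\<^sup>2 - (mode_sigma d n1 c w j)\<^sup>2 / d\<^sup>2)"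

definition mode_amp :: "real \<Rightarrow> real \<Rightarrow> real \<Rightarrow> real \<Rightarrow> nat \<Rightarrow> real" where
  "mode_amp d n1 c w j =
     sqrt ((2 / d) /
       (1 + (sin (mode_sigma d n1 c w j))\<^sup>2 / mode_zeta d n1 c w j
          - sin (2 * mode_sigma d n1 c w j) / (2 * mode_sigma d n1 c w j)))"

definition mode_phi :: "real \<Rightarrow> real \<Rightarrow> real \<Rightarrow> real \<Rightarrow> nat \<Rightarrow> real \<Rightarrow> real" where
  "mode_phi d n1 c w j x =
     (if x \<le> d then mode_amp d n1 c w j * sin (mode_sigma d n1 c w j * x / d)
      else mode_amp d n1 c w j * sin (mode_sigma d n1 c w j)
             * exp (- mode_zeta d n1 c w j * (x - d) / d))"

section \<open>Radiating modes, restricted to the ocean section\<close>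

definition rad_eta :: "real \<Rightarrow> real \<Rightarrow> real \<Rightarrow> real \<Rightarrow> real \<Rightarrow> real" where
  "rad_eta d n1 c w g = d * sqrt (n1\<^sup>2 * (wavenumber c w)\<^sup>2 - g)"

definition rad_xi :: "real \<Rightarrow> real \<Rightarrow> real \<Rightarrow> real \<Rightarrow> real" where
  "rad_xi d c w g = d * sqrt ((wavenumber c w)\<^sup>2 - g)"

definition rad_amp :: "real \<Rightarrow> real \<Rightarrow> real \<Rightarrow> real \<Rightarrow> real \<Rightarrow> real" where
  "rad_amp d n1 c w g =
     sqrt (d * rad_xi d c w g /
       (pi * ((rad_xi d c w g)\<^sup>2 * (sin (rad_eta d n1 c w g))\<^sup>2
            + (rad_eta d n1 c w g)\<^sup>2 * (cos (rad_eta d n1 c w g))\<^sup>2)))"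

definition rad_phi :: "real \<Rightarrow> real \<Rightarrow> real \<Rightarrow> real \<Rightarrow> real \<Rightarrow> real \<Rightarrow> real" where
  "rad_phi d n1 c w g x = rad_amp d n1 c w g * sin (rad_eta d n1 c w g * x / d)"

section \<open>Random medium\<close>

text \<open>
  Stationarity is in the longitudinal variable \<open>z\<close>: all finite-dimensional distributions are
  invariant under shifts.
\<close>

definition longitudinally_stationary ::
    "'a measure \<Rightarrow> (real \<Rightarrow> real \<Rightarrow> 'a \<Rightarrow> real) \<Rightarrow> real \<Rightarrow> bool" where
  "longitudinally_stationary M V d \<longleftrightarrow>
     (\<forall>(n::nat) (x::nat \<Rightarrow> real) (z::nat \<Rightarrow> real) h.
        0 \<le> h \<and> (\<forall>i<n. x i \<in> {0..d} \<and> 0 \<le> z i) \<longrightarrow>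
        distr M (PiM {..<n} (\<lambda>_. borel)) (\<lambda>\<omega>. \<lambda>i\<in>{..<n}. V (x i) (z i + h) \<omega>) =
        distr M (PiM {..<n} (\<lambda>_. borel)) (\<lambda>\<omega>. \<lambda>i\<in>{..<n}. V (x i) (z i) \<omega>))"

text \<open>
  Integrability of the variance \<open>g0 x x\<close> over the depth says that \<open>\<integral>\<^sub>0\<^sup>d V(x,z)\<^sup>2 dx\<close> has finite
  expectation. This is what makes the second moments of the coupling processes and the double
  integral \<open>S0\<close> below meaningful; it holds automatically when \<open>g0\<close> is continuous.
\<close>

definition random_medium ::
    "'a measure \<Rightarrow> (real \<Rightarrow> real \<Rightarrow> 'a \<Rightarrow> real) \<Rightarrow> real \<Rightarrow> real \<Rightarrow> (real \<Rightarrow> real \<Rightarrow> real) \<Rightarrow> bool" where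
  "random_medium M V d a g0 \<longleftrightarrow>
     prob_space M \<and>
     (\<forall>x\<in>{0..d}. \<forall>z\<ge>0. V x z \<in> borel_measurable M) \<and>
     (\<forall>\<omega>\<in>space M. continuous_on ({0..d} \<times> {0..}) (\<lambda>(x, z). V x z \<omega>)) \<and>
     longitudinally_stationary M V d \<and>
     (\<forall>x\<in>{0..d}. \<forall>z\<ge>0. integrable M (\<lambda>\<omega>. (V x z \<omega>)\<^sup>2)) \<and>
     (\<forall>x\<in>{0..d}. \<forall>z\<ge>0. (\<integral>\<omega>. V x z \<omega> \<partial>M) = 0) \<and>
     (\<forall>x1\<in>{0..d}. \<forall>x2\<in>{0..d}. \<forall>z1\<ge>0. \<forall>z2\<ge>0.
        (\<integral>\<omega>. V x1 z1 \<omega> * V x2 z2 \<omega> \<partial>M) = g0 x1 x2 * exp (- a * \<bar>z1 - z2\<bar>)) \<and>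
     set_integrable lborel {0..d} (\<lambda>x. g0 x x)"

section \<open>Coupling coefficients\<close>

definition coupling_process ::
    "(real \<Rightarrow> real \<Rightarrow> 'a \<Rightarrow> real) \<Rightarrow> real \<Rightarrow> (real \<Rightarrow> real) \<Rightarrow> (real \<Rightarrow> real) \<Rightarrow> real \<Rightarrow> 'a \<Rightarrow> real" where
  "coupling_process V d f g z \<omega> = (LINT x:{0..d}|lborel. f x * g x * V x z \<omega>)"

definition Gamma_c ::
    "'a measure \<Rightarrow> (real \<Rightarrow> real \<Rightarrow> 'a \<Rightarrow> real) \<Rightarrow> real \<Rightarrow> real \<Rightarrow> real \<Rightarrow> real \<Rightarrow> nat \<Rightarrow> nat \<Rightarrow> real" where
  "Gamma_c M V d n1 c w j l =
     (wavenumber c w) ^ 4 / (2 * mode_beta d n1 c w j * mode_beta d n1 c w l) *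
     (LINT z:{0..}|lborel.
        (\<integral>\<omega>. coupling_process V d (mode_phi d n1 c w j) (mode_phi d n1 c w l) 0 \<omega>
             * coupling_process V d (mode_phi d n1 c w j) (mode_phi d n1 c w l) z \<omega> \<partial>M)
        * cos ((mode_beta d n1 c w l - mode_beta d n1 c w j) * z))"

definition Lambda_c ::
    "'a measure \<Rightarrow> (real \<Rightarrow> real \<Rightarrow> 'a \<Rightarrow> real) \<Rightarrow> real \<Rightarrow> real \<Rightarrow> real \<Rightarrow> real \<Rightarrow> nat \<Rightarrow> real" where
  "Lambda_c M V d n1 c w j =
     (LINT g:{0<..<(wavenumber c w)\<^sup>2}|lborel.
        (wavenumber c w) ^ 4 / (4 * sqrt g * mode_beta d n1 c w j) *
        (LINT z:{0..}|lborel.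
           (\<integral>\<omega>. coupling_process V d (mode_phi d n1 c w j) (rad_phi d n1 c w g) 0 \<omega>
                * coupling_process V d (mode_phi d n1 c w j) (rad_phi d n1 c w g) z \<omega> \<partial>M)
           * cos ((sqrt g - mode_beta d n1 c w j) * z)))"

section \<open>Coupled power equations\<close>

text \<open>
  \<open>T l j z\<close> is the mean power at range \<open>z\<close> in mode \<open>j\<close> for unit input in mode \<open>l\<close>. The
  nearest-neighbour system needs at least two modes, which is the case for all large \<open>w\<close>.
\<close>

definition solves_coupled_power ::
    "'a measure \<Rightarrow> (real \<Rightarrow> real \<Rightarrow> 'a \<Rightarrow> real) \<Rightarrow> real \<Rightarrow> real \<Rightarrow> real \<Rightarrow> real \<Rightarrow>
     (nat \<Rightarrow> nat \<Rightarrow> real \<Rightarrow> real) \<Rightarrow> bool" where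
  "solves_coupled_power M V d n1 c w T \<longleftrightarrow>
     (let N = num_modes d n1 c w; Gam = Gamma_c M V d n1 c w; Lam = Lambda_c M V d n1 c w in
      \<forall>l\<in>{1..N}.
        (\<forall>j\<in>{1..N}. T l j 0 = (if j = l then 1 else 0)) \<and>
        (\<forall>z\<ge>0.
           (T l N has_real_derivative
              (- Lam N * T l N z + Gam (N - 1) N * (T l (N - 1) z - T l N z))) (at z within {0..}) \<and>
           (\<forall>j\<in>{2..N - 1}.
              (T l j has_real_derivative
                 (Gam (j - 1) j * (T l (j - 1) z - T l j z)
                  + Gam (j + 1) j * (T l (j + 1) z - T l j z))) (at z within {0..})) \<and>
           (T l 1 has_real_derivative
              (Gam 2 1 * (T l 2 z - T l 1 z))) (at z within {0..})))"

section \<open>Mirror and refocused wave\<close>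

definition mirror_top :: "real \<Rightarrow> real \<Rightarrow> real \<Rightarrow> real \<Rightarrow> real \<Rightarrow> real \<Rightarrow> real" where
  "mirror_top n1 c \<alpha>M dM d1' w = dM - (ocean_wavelength n1 c w) powr \<alpha>M * d1'"

definition mirror_bottom :: "real \<Rightarrow> real \<Rightarrow> real \<Rightarrow> real \<Rightarrow> real \<Rightarrow> real \<Rightarrow> real" where
  "mirror_bottom n1 c \<alpha>M dM d2' w = dM + (ocean_wavelength n1 c w) powr \<alpha>M * d2'"

definition mirror_coeff ::
    "real \<Rightarrow> real \<Rightarrow> real \<Rightarrow> real \<Rightarrow> real \<Rightarrow> real \<Rightarrow> nat \<Rightarrow> real" where
  "mirror_coeff d n1 c d1 d2 w j =
     (d2 - d1) * (mode_amp d n1 c w j)\<^sup>2 *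
     (1 - cos (mode_sigma d n1 c w j * ((d2 + d1) / d))
          * sinc (mode_sigma d n1 c w j * ((d2 - d1) / d)))"

definition refocused_profile ::
    "real \<Rightarrow> real \<Rightarrow> real \<Rightarrow> (real \<Rightarrow> nat \<Rightarrow> nat \<Rightarrow> real \<Rightarrow> real) \<Rightarrow>
     real \<Rightarrow> real \<Rightarrow> real \<Rightarrow> real \<Rightarrow> real \<Rightarrow> real \<Rightarrow> real \<Rightarrow> real \<Rightarrow> real" where
  "refocused_profile d n1 c T \<alpha>M dM d1' d2' x0 w x L =
     1 / 4 * (\<Sum>j = 1..num_modes d n1 c w. \<Sum>l = 1..num_modes d n1 c w.
        mirror_coeff d n1 c (mirror_top n1 c \<alpha>M dM d1' w) (mirror_bottom n1 c \<alpha>M dM d2' w) w j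
        * T w l j L * mode_phi d n1 c w l x0 * mode_phi d n1 c w l x)"

section \<open>Continuum limit\<close>

text \<open>
  Convergence \<open>w \<rightarrow> \<infinity>\<close> outside shrinking windows just above the cutoff frequencies. Let \<open>N = num_modes d n1 c w\<close>. Just above the
  frequency at which mode \<open>N\<close> appears, \<open>\<zeta>\<^sub>N\<close> is close to \<open>0\<close>, hence so are its normalization \<open>A\<^sub>N\<close>
  and the coefficients \<open>\<Gamma>\<^sup>c\<^sub>N\<^sub>-\<^sub>1\<^sub>N\<close> and \<open>\<Lambda>\<^sup>c\<^sub>N\<close>, both proportional to \<open>A\<^sub>N\<^sup>2\<close>. Since in the model only mode
  \<open>N\<close> radiates, the losses of the other modes disappear at such frequencies, and along a
  sequence of them the refocused profile tends to that of the loss-free waveguide. The absorbing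
  condition at \<open>u = 1\<close> is the limit exactly when \<open>N * \<zeta>\<^sub>N \<rightarrow> \<infinity>\<close>. For instance, this filter admits
  all sequences \<open>w \<rightarrow> \<infinity>\<close> staying a fixed distance (in \<open>mode_bound d n1 c w\<close>) away from the cutoffs
  \<open>(m - 1/2) \<pi>\<close>.
\<close>

definition continuum_limit :: "real \<Rightarrow> real \<Rightarrow> real \<Rightarrow> real filter" where
  "continuum_limit d n1 c =
     inf at_top
       (filtercomap (\<lambda>w. real (num_modes d n1 c w) * mode_zeta d n1 c w (num_modes d n1 c w)) at_top)"

section \<open>Limiting diffusion\<close>

definition S0 :: "real \<Rightarrow> (real \<Rightarrow> real \<Rightarrow> real) \<Rightarrow> real" where
  "S0 d g0 = (LINT x1:{0..d}|lborel. LINT x2:{0..d}|lborel.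
                g0 x1 x2 * cos (pi / d * x1) * cos (pi / d * x2))"

definition a_zero :: "real \<Rightarrow> real \<Rightarrow> real \<Rightarrow> (real \<Rightarrow> real \<Rightarrow> real) \<Rightarrow> real" where
  "a_zero d n1 a g0 = pi\<^sup>2 * S0 d g0 / (2 * a * n1 ^ 4 * d ^ 4 * (index_theta n1)\<^sup>2)"

definition a_infty :: "real \<Rightarrow> real \<Rightarrow> real \<Rightarrow> (real \<Rightarrow> real \<Rightarrow> real) \<Rightarrow> real \<Rightarrow> real" where
  "a_infty d n1 a g0 u =
     a_zero d n1 a g0 / (1 - (1 - pi\<^sup>2 / (a\<^sup>2 * d\<^sup>2)) * (index_theta n1 * u)\<^sup>2)"

text \<open>
  Classical solutions for \<open>z > 0\<close>, up to the lateral boundary: \<open>Tu\<close> is the \<open>u\<close>-derivative of \<open>T\<close> and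
  \<open>G\<close> the common value of both sides of the equation. The initial value \<open>1\<close> is incompatible with
  the condition \<open>T z 1 = 0\<close>, so \<open>T\<close> cannot be continuous at the corner \<open>(0, 1)\<close>; the initial data
  are attained in the mean-square sense. (Pointwise convergence on \<open>[0, 1)\<close> alone would not
  determine the solution; for bounded \<open>T\<close> it implies mean-square convergence.)
\<close>

definition solves_diffusion :: "(real \<Rightarrow> real) \<Rightarrow> (real \<Rightarrow> real \<Rightarrow> real) \<Rightarrow> bool" where
  "solves_diffusion A T \<longleftrightarrow>
     (\<exists>Tu G.
        continuous_on ({0<..} \<times> {0..1}) (\<lambda>(z, u). Tu z u) \<and>
        continuous_on ({0<..} \<times> {0..1}) (\<lambda>(z, u). G z u) \<and>
        (\<forall>z>0. \<forall>u\<in>{0..1}.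
           (T z has_real_derivative Tu z u) (at u within {0..1}) \<and>
           ((\<lambda>v. A v * Tu z v) has_real_derivative G z u) (at u within {0..1}) \<and>
           ((\<lambda>s. T s u) has_real_derivative G z u) (at z)) \<and>
        (\<forall>z>0. Tu z 0 = 0 \<and> T z 1 = 0)) \<and>
     (\<forall>u\<in>{0..1}. T 0 u = 1) \<and>
     ((\<lambda>z. LINT u:{0..1}|lborel. (T z u - T 0 u)\<^sup>2) \<longlongrightarrow> 0) (at_right 0)"

definition limit_profile :: "(real \<Rightarrow> real \<Rightarrow> real) \<Rightarrow> real \<Rightarrow> real \<Rightarrow> real" where
  "limit_profile T1 x L = (LINT u:{0..1}|lborel. T1 L u * cos (2 * pi * u * x))"

end

theory Submission
  imports Defs
begin

text \<open>
  The mean powers of the \<open>N\<close> propagating modes perform a nearest-neighbour exchange along the chain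
  \<open>1, \<dots>, N\<close>, and mode \<open>N\<close> loses power to the radiating modes. Rescaled by \<open>u = j / N\<close> this exchange
  is a discrete diffusion. Its coefficient is the limit \<open>a\<^sub>\<infinity>\<close> of \<open>\<Gamma> / N\<^sup>2\<close>, mode \<open>1\<close> reflects because
  nothing leaves the chain there, and mode \<open>N\<close> absorbs because the loss is fast. The refocused
  profile is then a Riemann sum of the limiting powers against \<open>cos (2 \<pi> u x)\<close>.

  The modes. Let \<open>B\<close> be the mode bound. The dispersion relation says \<open>\<sigma>\<^sub>j + arcsin (\<sigma>\<^sub>j / B) = j \<pi>\<close>
  (\<open>mode_structure\<close>). Therefore \<open>B / N\<close> tends to \<open>\<pi>\<close>, \<open>\<sigma>\<^sub>j / B\<close> is uniformly close to \<open>j / N\<close>, and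
  the gaps \<open>\<sigma>\<^sub>j\<^sub>+\<^sub>1 - \<sigma>\<^sub>j\<close> tend to \<open>\<pi>\<close>. It also gives \<open>A\<^sub>j\<^sup>2 = (2 / d) \<zeta>\<^sub>j / (\<zeta>\<^sub>j + 1)\<close>, which tends to
  \<open>2 / d\<close> uniformly in \<open>j < N\<close>. Only \<open>A\<^sub>N\<close> can degenerate, just above a cutoff frequency.

  The rates. As the covariance is exponential in \<open>z\<close>, a coupling coefficient is the covariance form
  \<open>Q\<close> of the medium at the product of the two modes, times a Lorentzian in the difference of the
  wavenumbers. For neighbours the product is a difference of two cosines, of frequencies tending
  to \<open>\<pi> / d\<close> and to infinity; the second one drops out by the Riemann-Lebesgue lemma and \<open>S\<^sub>0\<close>
  remains. This gives \<open>\<Gamma> / N\<^sup>2 \<rightarrow> a\<^sub>\<infinity> (j / N)\<close> except at the first few modes and at the last edge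
  (\<open>coupling_bulk\<close>). Moreover \<open>S\<^sub>0 > 0\<close>, because for \<open>S\<^sub>0 = 0\<close> the limiting equation would preserve the
  initial value \<open>1\<close>, against the condition at \<open>u = 1\<close>.

  The absorbing end. Both \<open>\<Gamma>\<^sub>N\<^sub>-\<^sub>1\<^sub>N\<close> and \<open>\<Lambda>\<^sub>N\<close> are at least of order \<open>N\<^sup>2 A\<^sub>N\<^sup>2\<close>; for \<open>\<Lambda>\<^sub>N\<close> it is enough to
  integrate over the radiating modes near the first resonance above the cutoff
  (\<open>Lambda_lower_bound\<close>). In the continuum limit \<open>N \<zeta>\<^sub>N \<rightarrow> \<infinity>\<close>, that is \<open>N A\<^sub>N\<^sup>2 \<rightarrow> \<infinity>\<close>, so that both rates
  exceed every multiple of \<open>N\<close> (\<open>coupling_last\<close>). That much suffices: in the energy estimate an edge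
  of rate \<open>G\<close> crossed by a flux of order \<open>N\<close> costs \<open>N\<^sup>2 / G = o(N)\<close>, which disappears in the average over
  the \<open>N\<close> modes.

  The limit of the chain. \<open>chain_energy\<close> compares a solution of the chain with a function \<open>v\<close> that
  solves it approximately: in the bulk \<open>v\<^sub>j (z) = T\<^sub>1 (z, j / N)\<close>. Since \<open>T\<^sub>1\<close> is regular for \<open>z > 0\<close> only,
  a short initial layer is bridged by comparing with \<open>1 - (j / N)\<^sup>m\<close>. The result,
  \<open>chain_diffusion_limit\<close>, is convergence in mean square over the modes.

  The profile. The chain is symmetric, so \<open>T\<^sup>l\<^sub>j = T\<^sup>j\<^sub>l\<close> and \<open>\<Sum>\<^sub>j M\<^sub>j\<^sub>j T\<^sup>l\<^sub>j\<close> is the power in mode \<open>l\<close> for the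
  initial powers \<open>M\<^sub>j\<^sub>j\<close>. A mirror much wider than the wavelength makes these nearly constant in mean
  square, \<open>M\<^sub>j\<^sub>j \<approx> (2 / d) (d\<^sub>2 - d\<^sub>1)\<close>, and the chain increases mean-square errors at most by a constant
  factor. Finally, at the point \<open>x' = x\<^sub>0 + (\<lambda> / \<theta>) x\<close>, the product \<open>\<phi>\<^sub>l (x\<^sub>0) \<phi>\<^sub>l (x')\<close> is \<open>A\<^sub>l\<^sup>2 / 2\<close> times
  \<open>cos (2 \<pi> (\<sigma>\<^sub>l / B) x) - cos (\<sigma>\<^sub>l (x' + x\<^sub>0) / d)\<close>; the first term yields the integral and the second
  averages to zero (\<open>source_sum_tendsto\<close>).
\<close>

section \<open>Limits of sums, averages and integrals\<close>

lemma mvt_within: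
  fixes f :: "real \<Rightarrow> real"
  assumes "a \<le> b" "{a..b} \<subseteq> S"
    and D: "\<And>x. x \<in> {a..b} \<Longrightarrow> (f has_real_derivative f' x) (at x within S)"
  obtains x where "x \<in> {a..b}" "f b - f a = (b - a) * f' x"
proof -
  have "\<exists>x\<in>{a..b}. f b - f a = (\<lambda>h. h * f' x) (b - a)"
    using assms(1) DERIV_subset[OF D assms(2)]
    by (intro mvt_very_simple) (auto simp: has_field_derivative_def mult.commute[of _ "f' _"])
  then show ?thesis using that by auto
qed

text \<open>
  By compactness of \<open>{0..1}\<close> it is enough to treat finer filters along which \<open>x\<close> converges. This
  turns a limit that is uniform in the position \<open>x\<close> into limits at fixed positions.
\<close>

lemma tendsto_zero_by_clusters:
  fixes x Z :: "'i \<Rightarrow> real"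
  assumes x: "\<forall>\<^sub>F i in F. x i \<in> {0..1}"
    and lim: "\<And>G v. G \<le> F \<Longrightarrow> v \<in> {0..1} \<Longrightarrow> (x \<longlongrightarrow> v) G \<Longrightarrow> (Z \<longlongrightarrow> 0) G"
  shows "(Z \<longlongrightarrow> 0) F"
proof (rule tendstoI)
  fix e :: real assume e: "0 < e"
  define F' where "F' = inf F (principal {i. e \<le> dist (Z i) 0})"
  have "F' = bot"
  proof (rule ccontr)
    assume nb: "F' \<noteq> bot"
    have x': "eventually (\<lambda>i. x i \<in> {0..1}) F'"
      using x by (rule filter_leD[rotated]) (simp add: F'_def)
    have "filtermap x F' \<noteq> bot" using nb by (simp add: filtermap_bot_iff)
    moreover have "eventually (\<lambda>y. y \<in> {0..1}) (filtermap x F')" using x' by (simp add: eventually_filtermap)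
    ultimately obtain v where v: "v \<in> {0..1}" "inf (nhds v) (filtermap x F') \<noteq> bot"
      using compact_Icc[of 0 "1::real"] unfolding compact_filter by blast
    define G where "G = inf F' (filtercomap x (nhds v))"
    have GF': "G \<le> F'" by (simp add: G_def)
    have "G \<noteq> bot"
    proof
      assume "G = bot"
      then have "eventually (\<lambda>_. False) G" by simp
      then obtain P Q where PQ: "eventually P F'" "eventually Q (filtercomap x (nhds v))" "\<And>i. P i \<and> Q i \<longrightarrow> False"
        unfolding G_def eventually_inf by auto
      then obtain R where R: "eventually R (nhds v)" "\<And>i. R (x i) \<Longrightarrow> Q i" by (auto simp: eventually_filtercomap)
      have "eventually (\<lambda>y. \<not> R y) (filtermap x F')"
        unfolding eventually_filtermap using PQ(1) by eventually_elim (use PQ(3) R(2) in blast)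
      then have "eventually (\<lambda>_. False) (inf (nhds v) (filtermap x F'))"
        unfolding eventually_inf using R(1) by blast
      then show False using v(2) by simp
    qed
    moreover have "(x \<longlongrightarrow> v) G"
      by (rule filterlim_mono[OF filterlim_filtercomap order_refl]) (simp add: G_def)
    moreover have "G \<le> F" using GF' by (simp add: F'_def)
    ultimately have "eventually (\<lambda>i. dist (Z i) 0 < e) G" using lim[of G v] v(1) e by (auto dest: tendstoD)
    moreover have "eventually (\<lambda>i. e \<le> dist (Z i) 0) G"
      by (rule filter_leD[OF GF']) (simp add: F'_def eventually_inf_principal)
    ultimately have "eventually (\<lambda>_. False) G" by eventually_elim simp
    then show False using \<open>G \<noteq> bot\<close> by simp
  qed
  then have "eventually (\<lambda>_. False) F'" by simp
  then show "\<forall>\<^sub>F i in F. dist (Z i) 0 < e" by (simp add: F'_def eventually_inf_principal not_le)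
qed

lemma Riemann_sum_tendsto:
  fixes f :: "real \<Rightarrow> real"
  assumes f: "continuous_on {0..1} f"
  shows "(\<lambda>n. (\<Sum>j=1..n. f (real j / real n)) / real n) \<longlonglongrightarrow> (LINT u:{0..1}|lborel. f u)"
proof (rule LIMSEQ_I)
  fix e :: real assume e: "0 < e"
  have int: "f integrable_on {a..b}" if "0 \<le> a" "b \<le> 1" for a b
    using that by (intro integrable_continuous_interval continuous_on_subset[OF f]) auto
  have L: "(LINT u:{0..1}|lborel. f u) = integral {0..1} f"
    using f by (intro set_borel_integral_eq_integral(2) borel_integrable_atLeastAtMost')
  have "uniformly_continuous_on {0..1} f"
    using f by (intro compact_uniformly_continuous) auto
  then obtain \<delta> where \<delta>: "\<delta> > 0"
    "\<And>x y. x \<in> {0..1} \<Longrightarrow> y \<in> {0..1} \<Longrightarrow> dist y x < \<delta> \<Longrightarrow> dist (f y) (f x) < e / 2"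
    unfolding uniformly_continuous_on_def using e by (meson half_gt_zero)
  obtain n0 :: nat where n0: "1 / \<delta> < real n0" using reals_Archimedean2 by blast
  show "\<exists>n0. \<forall>n\<ge>n0. norm ((\<Sum>j=1..n. f (real j / real n)) / real n - (LINT u:{0..1}|lborel. f u)) < e"
  proof (intro exI[of _ "max 1 n0"] allI impI)
    fix n assume n: "max 1 n0 \<le> n"
    then have n1: "0 < n" by auto
    have "1 / \<delta> < real n" using n n0 by linarith
    then have nd: "1 / real n < \<delta>" using \<delta> n1 by (simp add: field_simps)
    have "\<bar>(\<Sum>j=1..m. f (real j / real n)) / real n - integral {0..real m / real n} f\<bar> \<le> real m / real n * (e / 2)"
      if "m \<le> n" for m
      using that
    proof (induction m)
      case (Suc m)
      let ?a = "real m / real n" and ?b = "real (Suc m) / real n"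
      have ab: "0 \<le> ?a" "?a \<le> ?b" "?b \<le> 1" "?b - ?a = 1 / real n"
        using Suc n1 by (auto simp: field_simps)
      have "integral {0..?a} f + integral {?a..?b} f = integral {0..?b} f"
        using ab by (intro Henstock_Kurzweil_Integration.integral_combine int) auto
      moreover have "f ?b / real n = integral {?a..?b} (\<lambda>_. f ?b)"
        using ab by simp
      moreover have "\<bar>integral {?a..?b} (\<lambda>_. f ?b) - integral {?a..?b} f\<bar> \<le> 1 / real n * (e / 2)"
      proof -
        have "integral {?a..?b} (\<lambda>_. f ?b) - integral {?a..?b} f = integral {?a..?b} (\<lambda>x. f ?b - f x)"
          using ab by (intro Henstock_Kurzweil_Integration.integral_diff[symmetric] int) auto
        moreover have "norm (integral {?a..?b} (\<lambda>x. f ?b - f x)) \<le> (e / 2) * (?b - ?a)"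
        proof (rule integral_bound)
          show "continuous_on {?a..?b} (\<lambda>x. f ?b - f x)"
            using ab by (intro continuous_intros continuous_on_subset[OF f]) auto
          fix x assume x: "x \<in> {?a..?b}"
          have "0 \<le> x" "\<bar>?b - x\<bar> < \<delta>" using x ab nd by (auto simp only: atLeastAtMost_iff abs_less_iff)
          then have "dist (f ?b) (f x) < e / 2"
            by (intro \<delta>(2)) (use x ab in \<open>auto simp only: dist_real_def atLeastAtMost_iff\<close>)
          then show "norm (f ?b - f x) \<le> e / 2" by (simp add: dist_norm)
        qed (use ab in auto)
        ultimately show ?thesis using ab by (simp add: mult.commute)
      qed
      moreover have "\<bar>(\<Sum>j=1..m. f (real j / real n)) / real n - integral {0..?a} f\<bar> \<le> ?a * (e / 2)"
        using Suc by simp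
      moreover have "(\<Sum>j=1..Suc m. f (real j / real n)) / real n
        = (\<Sum>j=1..m. f (real j / real n)) / real n + f ?b / real n"
        by (simp add: add_divide_distrib)
      moreover have "?b * (e / 2) = ?a * (e / 2) + 1 / real n * (e / 2)"
        by (simp add: add_divide_distrib algebra_simps)
      ultimately show ?case by linarith
    qed simp
    from this[of n] n1 e
    have "\<bar>(\<Sum>j=1..n. f (real j / real n)) / real n - integral {0..1} f\<bar> < e" by simp
    then show "norm ((\<Sum>j=1..n. f (real j / real n)) / real n - (LINT u:{0..1}|lborel. f u)) < e"
      unfolding L by simp
  qed
qed

text \<open>
  The exceptional indices, \<open>j < \<eta> N\<close> and \<open>j = N\<close>, contribute at most \<open>C (\<eta> + 1 / N)\<close> to the average.
  In the applications \<open>j = N\<close> is the mode whose normalization may degenerate.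
\<close>

lemma average_tendsto_zero:
  fixes N :: "'w \<Rightarrow> nat" and h :: "'w \<Rightarrow> nat \<Rightarrow> real"
  assumes N: "filterlim N at_top F"
    and C: "\<forall>\<^sub>F w in F. \<forall>j\<in>{1..N w}. \<bar>h w j\<bar> \<le> C"
    and bulk: "\<And>\<eta> \<epsilon>. 0 < \<eta> \<Longrightarrow> 0 < \<epsilon> \<Longrightarrow> \<forall>\<^sub>F w in F. \<forall>j. 1 \<le> j \<longrightarrow> j < N w \<longrightarrow> \<eta> * real (N w) \<le> real j \<longrightarrow> \<bar>h w j\<bar> \<le> \<epsilon>"
  shows "((\<lambda>w. (\<Sum>j=1..N w. \<bar>h w j\<bar>) / real (N w)) \<longlongrightarrow> 0) F"
proof (rule tendstoI)
  fix e :: real assume e: "0 < e"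
  define C' where "C' = max C 1"
  have C': "0 < C'" by (simp add: C'_def)
  define \<eta> where "\<eta> = e / (4 * C')"
  have \<eta>: "0 < \<eta>" using e C' by (simp add: \<eta>_def)
  have big: "\<forall>\<^sub>F w in F. nat \<lceil>4 * C' / e\<rceil> + 1 \<le> N w" using N by (simp add: filterlim_at_top)
  have e4: "0 < e / 4" using e by simp
  show "\<forall>\<^sub>F w in F. dist ((\<Sum>j=1..N w. \<bar>h w j\<bar>) / real (N w)) 0 < e"
    using big C bulk[OF \<eta> e4]
  proof eventually_elim
    case (elim w)
    define n where "n = N w"
    have n: "4 * C' / e < real n" "0 < real n" using elim(1) by (simp_all add: n_def, linarith)
    have hC: "\<bar>h w j\<bar> \<le> C'" if "j \<in> {1..n}" for j using elim(2) that by (force simp: C'_def n_def le_max_iff_disj)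
    have bound: "\<bar>h w j\<bar> \<le> e / 4 + (if j \<le> nat \<lfloor>\<eta> * real n\<rfloor> then C' else 0) + (if j = n then C' else 0)" if j: "j \<in> {1..n}" for j
    proof -
      consider "j = n" | "j \<le> nat \<lfloor>\<eta> * real n\<rfloor>" | "j < n" "\<eta> * real n \<le> real j"
        using j by (cases "j = n"; cases "\<eta> * real n \<le> real j") (auto simp: le_nat_floor)
      then show ?thesis
      proof cases
        case 3
        then have "\<bar>h w j\<bar> \<le> e / 4" using elim(3) j e by (auto simp: n_def)
        then show ?thesis using C' by auto
      qed (use hC[OF j] C' e in auto)
    qed
    have "(\<Sum>j=1..n. \<bar>h w j\<bar>) \<le> (\<Sum>j=1..n. e / 4 + (if j \<le> nat \<lfloor>\<eta> * real n\<rfloor> then C' else 0) + (if j = n then C' else 0))"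
      by (rule sum_mono) (rule bound)
    also have "\<dots> = real n * (e / 4) + real (card ({1..n} \<inter> {j. j \<le> nat \<lfloor>\<eta> * real n\<rfloor>})) * C' + C'"
      using n by (simp add: sum.distrib sum.If_cases)
    also have "\<dots> \<le> real n * (e / 4) + (\<eta> * real n) * C' + C'"
    proof -
      have "card ({1..n} \<inter> {j. j \<le> nat \<lfloor>\<eta> * real n\<rfloor>}) \<le> card {1..nat \<lfloor>\<eta> * real n\<rfloor>}" by (rule card_mono) auto
      then have "real (card ({1..n} \<inter> {j. j \<le> nat \<lfloor>\<eta> * real n\<rfloor>})) \<le> real (nat \<lfloor>\<eta> * real n\<rfloor>)" by simp
      also have "\<dots> \<le> \<eta> * real n" using \<eta> n by simp
      finally show ?thesis using C' by (intro add_mono mult_right_mono order_refl) auto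
    qed
    also have "\<dots> = real n * (e / 2) + C'" using C' by (simp add: \<eta>_def field_simps)
    also have "real n * (e / 2) + C' < e * real n"
    proof -
      have "4 * C' < real n * e" using n(1) e by (simp add: divide_less_eq)
      then show ?thesis using C' by (simp add: mult.commute)
    qed
    finally have "(\<Sum>j=1..n. \<bar>h w j\<bar>) < e * real n" .
    then have "(\<Sum>j=1..n. \<bar>h w j\<bar>) / real n < e" using n by (simp add: divide_less_eq mult.commute)
    moreover have "0 \<le> (\<Sum>j=1..n. \<bar>h w j\<bar>) / real n" by (intro divide_nonneg_nonneg sum_nonneg) auto
    ultimately show ?case by (simp add: n_def dist_real_def)
  qed
qed

text \<open>
  Summation by parts. The factor \<open>2 sin (\<pi> y / 2)\<close> turns \<open>cos (s\<^sub>l y)\<close> into the difference of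
  \<open>R\<^sub>l = sin (s\<^sub>l y + \<pi> y / 2)\<close> and \<open>P\<^sub>l = sin (s\<^sub>l y - \<pi> y / 2)\<close>; these would telescope for frequencies
  equally spaced by \<open>\<pi>\<close>. The price is the total deviation of the spacing from \<open>\<pi>\<close> and the
  variation of \<open>f\<close>.
\<close>

lemma oscillating_sum_bound:
  fixes f s :: "nat \<Rightarrow> real"
  assumes C: "\<And>l. l \<in> {1..n} \<Longrightarrow> \<bar>f l\<bar> \<le> C" and n: "1 \<le> n"
  shows "\<bar>2 * sin (pi * y / 2)\<bar> * \<bar>\<Sum>l=1..n. f l * cos (s l * y)\<bar>
    \<le> 2 * C + C * \<bar>y\<bar> * (\<Sum>l=1..<n. \<bar>pi - (s (Suc l) - s l)\<bar>) + (\<Sum>l=1..<n. \<bar>f (Suc l) - f l\<bar>)"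
proof -
  define R where "R l = sin (s l * y + pi * y / 2)" for l
  define P where "P l = sin (s l * y - pi * y / 2)" for l
  have C0: "0 \<le> C" using C[of 1] n by auto
  have "2 * sin (pi * y / 2) * (\<Sum>l=1..n. f l * cos (s l * y)) = (\<Sum>l=1..n. f l * (R l - P l))"
    by (simp add: sum_distrib_left R_def P_def sin_add sin_diff algebra_simps)
  also have "\<dots> = f n * R n - f 1 * P 1 + (\<Sum>l=1..<n. f l * R l - f (Suc l) * P (Suc l))"
    using n by (induction n rule: dec_induct) (simp_all add: algebra_simps)
  finally have eq: "2 * sin (pi * y / 2) * (\<Sum>l=1..n. f l * cos (s l * y))
      = f n * R n - f 1 * P 1 + (\<Sum>l=1..<n. f l * R l - f (Suc l) * P (Suc l))" .
  have RP: "\<bar>R l\<bar> \<le> 1" "\<bar>P l\<bar> \<le> 1" for l by (simp_all add: R_def P_def)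
  have step: "\<bar>f l * R l - f (Suc l) * P (Suc l)\<bar> \<le> C * \<bar>y\<bar> * \<bar>pi - (s (Suc l) - s l)\<bar> + \<bar>f (Suc l) - f l\<bar>"
    if l: "l \<in> {1..<n}" for l
  proof -
    have lip: "\<bar>sin p - sin q\<bar> \<le> \<bar>p - q\<bar>" for p q :: real
    proof -
      have "\<bar>sin p - sin q\<bar> = 2 * \<bar>sin ((p - q) / 2)\<bar> * \<bar>cos ((p + q) / 2)\<bar>" by (simp add: sin_diff_sin abs_mult)
      also have "\<dots> \<le> 2 * \<bar>(p - q) / 2\<bar> * 1" by (intro mult_mono abs_sin_x_le_abs_x mult_left_mono) auto
      finally show ?thesis by simp
    qed
    have "\<bar>R l - P (Suc l)\<bar> \<le> \<bar>(s l * y + pi * y / 2) - (s (Suc l) * y - pi * y / 2)\<bar>"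
      unfolding R_def P_def by (rule lip)
    also have "(s l * y + pi * y / 2) - (s (Suc l) * y - pi * y / 2) = y * (pi - (s (Suc l) - s l))" by (simp add: algebra_simps)
    finally have 1: "\<bar>R l - P (Suc l)\<bar> \<le> \<bar>y\<bar> * \<bar>pi - (s (Suc l) - s l)\<bar>" by (simp only: abs_mult)
    have "f l * R l - f (Suc l) * P (Suc l) = f l * (R l - P (Suc l)) + - ((f (Suc l) - f l) * P (Suc l))" by (simp add: algebra_simps)
    also have "\<bar>\<dots>\<bar> \<le> \<bar>f l\<bar> * \<bar>R l - P (Suc l)\<bar> + \<bar>f (Suc l) - f l\<bar> * \<bar>P (Suc l)\<bar>"
      by (rule order_trans[OF abs_triangle_ineq]) (simp add: abs_mult)
    also have "\<dots> \<le> C * (\<bar>y\<bar> * \<bar>pi - (s (Suc l) - s l)\<bar>) + \<bar>f (Suc l) - f l\<bar> * 1"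
      using C[of l] l C0 1 RP by (intro add_mono mult_mono) auto
    finally show ?thesis by (simp add: mult.assoc)
  qed
  have "\<bar>f n * R n - f 1 * P 1 + (\<Sum>l=1..<n. f l * R l - f (Suc l) * P (Suc l))\<bar>
      \<le> \<bar>f n * R n\<bar> + \<bar>f 1 * P 1\<bar> + \<bar>\<Sum>l=1..<n. f l * R l - f (Suc l) * P (Suc l)\<bar>" by linarith
  also have "\<dots> \<le> C * 1 + C * 1 + (\<Sum>l=1..<n. C * \<bar>y\<bar> * \<bar>pi - (s (Suc l) - s l)\<bar> + \<bar>f (Suc l) - f l\<bar>)"
    unfolding abs_mult using C[of n] C[of 1] n RP C0 step
    by (intro add_mono mult_mono order_trans[OF sum_abs sum_mono]) auto
  finally show ?thesis unfolding abs_mult[symmetric] eq by (simp add: sum.distrib sum_distrib_left)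
qed

text \<open>
  For a polynomial one integrates by parts; a continuous function is uniformly close to one by
  the Weierstrass theorem.
\<close>

lemma Riemann_Lebesgue_cos:
  fixes g :: "real \<Rightarrow> real"
  assumes g: "continuous_on {0..d} g" and d: "0 < d"
  shows "((\<lambda>q. LINT x:{0..d}|lborel. cos (q * x) * g x) \<longlongrightarrow> 0) at_top"
proof (rule tendstoI)
  fix e :: real assume e: "0 < e"
  obtain p where p: "real_polynomial_function p" "\<And>x. x \<in> {0..d} \<Longrightarrow> \<bar>g x - p x\<bar> < e / (2 * d)"
    using Stone_Weierstrass_real_polynomial_function[OF compact_Icc g, of "e / (2 * d)"] e d by auto
  obtain p' where p': "real_polynomial_function p'" "\<And>x. (p has_real_derivative p' x) (at x)"
    using has_real_derivative_polynomial_function[OF p(1)] by blast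
  have cp: "continuous_on S p" "continuous_on S p'" for S
    using p(1) p'(1) continuous_on_polymonial_function real_polynomial_function_eq by blast+
  obtain Bp where Bp: "\<And>x. x \<in> {0..d} \<Longrightarrow> \<bar>p' x\<bar> \<le> Bp"
    using compact_imp_bounded[OF compact_continuous_image[OF cp(2) compact_Icc[of 0 d]]]
    unfolding bounded_iff by (auto simp del: atLeastAtMost_iff)
  define I where "I f = (LINT x:{0..d}|lborel. f x)" for f :: "real \<Rightarrow> real"
  have I: "I f = integral {0..d} f" if "continuous_on {0..d} f" for f
    unfolding I_def using that by (intro set_borel_integral_eq_integral(2) borel_integrable_atLeastAtMost')
  have bnd: "\<bar>integral {0..d} (\<lambda>x. cos (q * x) * g x)\<bar> \<le> e / 2 + (\<bar>p d\<bar> + Bp * d) / q" if q: "0 < q" for q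
  proof -
    have 1: "((\<lambda>x. cos (q * x) * p x + sin (q * x) / q * p' x) has_integral
        (sin (q * d) / q * p d - sin (q * 0) / q * p 0)) {0..d}"
    proof (rule fundamental_theorem_of_calculus)
      fix x assume "x \<in> {0..d}"
      have "((\<lambda>x. sin (q * x) / q * p x) has_real_derivative (cos (q * x) * p x + sin (q * x) / q * p' x)) (at x within {0..d})"
        using q by (auto intro!: derivative_eq_intros has_field_derivative_at_within[OF p'(2)] simp: field_simps)
      then show "((\<lambda>x. sin (q * x) / q * p x) has_vector_derivative (cos (q * x) * p x + sin (q * x) / q * p' x)) (at x within {0..d})"
        by (simp add: has_real_derivative_iff_has_vector_derivative)
    qed (use d in auto)
    have 2: "((\<lambda>x. sin (q * x) / q * p' x) has_integral integral {0..d} (\<lambda>x. sin (q * x) / q * p' x)) {0..d}"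
      using q by (intro integrable_integral integrable_continuous_interval continuous_intros cp) auto
    from has_integral_diff[OF 1 2]
    have 3: "integral {0..d} (\<lambda>x. cos (q * x) * p x) = sin (q * d) / q * p d - integral {0..d} (\<lambda>x. sin (q * x) / q * p' x)"
      by (simp add: integral_unique)
    have "norm (integral {0..d} (\<lambda>x. sin (q * x) / q * p' x)) \<le> (Bp / q) * (d - 0)"
    proof (rule integral_bound)
      fix x assume x: "x \<in> {0..d}"
      have "\<bar>sin (q * x)\<bar> * \<bar>p' x\<bar> \<le> 1 * Bp" using Bp[OF x] by (intro mult_mono) auto
      then show "norm (sin (q * x) / q * p' x) \<le> Bp / q" using q by (simp add: abs_mult divide_right_mono)
    qed (use d q in \<open>auto intro!: continuous_intros cp\<close>)
    moreover have "\<bar>sin (q * d) / q * p d\<bar> \<le> \<bar>p d\<bar> / q"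
      using q by (simp add: abs_mult divide_right_mono mult_left_le_one_le)
    ultimately have "\<bar>sin (q * d) / q * p d - integral {0..d} (\<lambda>x. sin (q * x) / q * p' x)\<bar> \<le> \<bar>p d\<bar> / q + Bp / q * (d - 0)"
      unfolding real_norm_def by linarith
    then have 4: "\<bar>integral {0..d} (\<lambda>x. cos (q * x) * p x)\<bar> \<le> (\<bar>p d\<bar> + Bp * d) / q"
      unfolding 3 by (simp only: add_divide_distrib times_divide_eq_left diff_0_right)
    have 5: "norm (integral {0..d} (\<lambda>x. cos (q * x) * g x - cos (q * x) * p x)) \<le> (e / (2 * d)) * (d - 0)"
    proof (rule integral_bound)
      fix x assume x: "x \<in> {0..d}"
      have "\<bar>cos (q * x)\<bar> * \<bar>g x - p x\<bar> \<le> 1 * (e / (2 * d))" using p(2)[OF x] by (intro mult_mono) auto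
      then show "norm (cos (q * x) * g x - cos (q * x) * p x) \<le> e / (2 * d)"
        by (simp add: right_diff_distrib[symmetric] abs_mult)
    qed (use d in \<open>auto intro!: continuous_intros cp g\<close>)
    have 6: "integral {0..d} (\<lambda>x. cos (q * x) * g x - cos (q * x) * p x)
        = integral {0..d} (\<lambda>x. cos (q * x) * g x) - integral {0..d} (\<lambda>x. cos (q * x) * p x)"
      by (intro Henstock_Kurzweil_Integration.integral_diff integrable_continuous_interval continuous_intros cp g)
    have "e / (2 * d) * (d - 0) = e / 2" using d by simp
    then show ?thesis using 4 5 unfolding 6 real_norm_def by linarith
  qed
  have "((\<lambda>q. e / 2 + (\<bar>p d\<bar> + Bp * d) / q) \<longlongrightarrow> e / 2 + 0) at_top"
    by (intro tendsto_intros tendsto_divide_0[OF tendsto_const] filterlim_at_top_imp_at_infinity filterlim_ident)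
  then have "\<forall>\<^sub>F q in at_top. e / 2 + (\<bar>p d\<bar> + Bp * d) / q < e"
    by (rule order_tendstoD(2)) (use e in simp)
  then show "\<forall>\<^sub>F q in at_top. dist (LINT x:{0..d}|lborel. cos (q * x) * g x) 0 < e"
    using eventually_gt_at_top[of 0]
  proof eventually_elim
    case (elim q)
    have "(LINT x:{0..d}|lborel. cos (q * x) * g x) = integral {0..d} (\<lambda>x. cos (q * x) * g x)"
      unfolding I_def[symmetric] by (intro I continuous_intros g)
    then show ?case using bnd[of q] elim by (simp add: dist_real_def)
  qed
qed

lemma Laplace_transform_cos:
  fixes a b :: real
  assumes a: "0 < a"
  shows "(LINT z:{0..}|lborel. exp (- a * z) * cos (b * z)) = a / (a\<^sup>2 + b\<^sup>2)"
proof -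
  have "set_integrable lborel {0<..} (\<lambda>x. exp (-(x * a)))" by (rule integrable_I0i_exp_mscale[OF a])
  moreover have "set_integrable lborel {0} (\<lambda>x. exp (-(x * a)))"
    by (rule set_integrable_subset[OF borel_integrable_atLeastAtMost'[of 0 0]]) auto
  ultimately have "set_integrable lborel ({0} \<union> {0<..}) (\<lambda>x. exp (-(x * a)))"
    by (intro set_integrable_Un) auto
  moreover have "{0} \<union> {0<..} = {0::real..}" by auto
  ultimately have e: "set_integrable lborel {0..} (\<lambda>x. exp (- a * x))" by (simp add: mult.commute)
  have int: "set_integrable lborel {0..} (\<lambda>x. exp (- a * x) * cos (b * x))"
  proof (rule set_integrable_bound[OF e])
    show "set_borel_measurable lborel {0..} (\<lambda>x. exp (- a * x) * cos (b * x))"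
      unfolding set_borel_measurable_def by measurable
  qed (auto simp: abs_mult mult_left_le)
  have ab: "0 < a\<^sup>2 + b\<^sup>2" using a by (simp add: add_pos_nonneg)
  define F where "F x = exp (- a * x) * (b * sin (b * x) - a * cos (b * x)) / (a\<^sup>2 + b\<^sup>2)" for x
  have FTC: "(LINT z:{0..y}|lborel. exp (- a * z) * cos (b * z)) = F y - F 0" if "0 \<le> y" for y
  proof -
    have "(\<integral>x. (exp (- a * x) * cos (b * x)) * indicator {0..y} x \<partial>lborel) = F y - F 0"
    proof (rule integral_FTC_Icc_real[OF that])
      fix x
      have "((\<lambda>x. exp (- a * x) * (b * sin (b * x) - a * cos (b * x))) has_real_derivative
        ((- a) * exp (- a * x)) * (b * sin (b * x) - a * cos (b * x)) + (b * (cos (b * x) * b) + a * (sin (b * x) * b)) * exp (- a * x)) (at x)"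
        by (auto intro!: derivative_eq_intros simp: algebra_simps)
      moreover have "((- a) * exp (- a * x)) * (b * sin (b * x) - a * cos (b * x)) + (b * (cos (b * x) * b) + a * (sin (b * x) * b)) * exp (- a * x)
         = (exp (- a * x) * cos (b * x)) * (a\<^sup>2 + b\<^sup>2)"
        by (simp add: algebra_simps power2_eq_square)
      ultimately have "(F has_real_derivative (exp (- a * x) * cos (b * x)) * (a\<^sup>2 + b\<^sup>2) / (a\<^sup>2 + b\<^sup>2)) (at x)"
        unfolding F_def by (intro DERIV_cdivide) simp
      then show "(F has_real_derivative exp (- a * x) * cos (b * x)) (at x)"
        using ab by (simp only: nonzero_mult_div_cancel_right less_imp_neq[THEN not_sym] not_False_eq_True)
    qed auto
    then show ?thesis by (simp add: set_lebesgue_integral_def mult.commute)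
  qed
  have e0: "((\<lambda>y. exp (- a * y)) \<longlongrightarrow> 0) at_top"
    using a by (intro filterlim_compose[OF exp_at_bot] filterlim_tendsto_neg_mult_at_bot[OF tendsto_const] filterlim_ident) auto
  have "((\<lambda>y. F y - F 0) \<longlongrightarrow> 0 - F 0) at_top"
  proof (intro tendsto_diff tendsto_const)
    have "((\<lambda>y. exp (- a * y) * ((\<bar>b\<bar> + \<bar>a\<bar>) / (a\<^sup>2 + b\<^sup>2))) \<longlongrightarrow> 0) at_top"
      using tendsto_mult_left_zero[OF e0] .
    moreover have "norm (F y) \<le> norm (exp (- a * y)) * ((\<bar>b\<bar> + \<bar>a\<bar>) / (a\<^sup>2 + b\<^sup>2))" for y
    proof -
      have "\<bar>b * sin (b * y) - a * cos (b * y)\<bar> \<le> \<bar>b * sin (b * y)\<bar> + \<bar>a * cos (b * y)\<bar>" by simp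
      also have "\<dots> \<le> \<bar>b\<bar> + \<bar>a\<bar>" by (intro add_mono) (auto simp: abs_mult mult_left_le)
      finally show ?thesis using ab by (simp add: F_def abs_mult divide_right_mono)
    qed
    ultimately show "(F \<longlongrightarrow> 0) at_top" by (intro Lim_null_comparison[of F]) auto
  qed
  moreover have "((\<lambda>y. LINT z:{0..y}|lborel. exp (- a * z) * cos (b * z)) \<longlongrightarrow> (LINT z:{0..}|lborel. exp (- a * z) * cos (b * z))) at_top"
    by (intro tendsto_set_lebesgue_integral_at_top int) auto
  then have "((\<lambda>y. F y - F 0) \<longlongrightarrow> (LINT z:{0..}|lborel. exp (- a * z) * cos (b * z))) at_top"
    by (rule Lim_transform_eventually) (use FTC in \<open>auto intro: eventually_mono[OF eventually_ge_at_top[of 0]]\<close>)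
  ultimately have "(LINT z:{0..}|lborel. exp (- a * z) * cos (b * z)) = 0 - F 0"
    by (rule tendsto_unique[OF trivial_limit_at_top_linorder, rotated])
  then show ?thesis by (simp add: F_def)
qed

text \<open>
  An antiderivative is \<open>arcsin (2 g / K - 1)\<close>. The function serves as majorant for the integrand of
  the radiation losses.
\<close>

lemma integrable_inverse_sqrt_product:
  fixes K :: real
  assumes K: "0 < K"
  shows "set_integrable lborel {0<..<K} (\<lambda>g. 1 / (sqrt g * sqrt (K - g)))"
proof -
  have in01: "-1 < 2 * g / K - 1" "2 * g / K - 1 < 1" if "0 < g" "g < K" for g using that K by (auto simp: field_simps)
  have c: "continuous_on {0..K} (\<lambda>g. arcsin (2 * g / K - 1))"
    using K by (intro continuous_intros) (auto simp: field_simps)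
  have "set_integrable lborel (einterval (ereal 0) (ereal K)) (\<lambda>g. 1 / (sqrt g * sqrt (K - g)))"
  proof (rule interval_integral_FTC_nonneg(1))
    fix g assume "ereal 0 < ereal g" "ereal g < ereal K"
    then have g: "0 < g" "g < K" by auto
    have "1 - (2 * g / K - 1)\<^sup>2 = 4 * (g * (K - g)) / K\<^sup>2" using K by (simp add: power2_eq_square field_simps)
    then have "sqrt (1 - (2 * g / K - 1)\<^sup>2) = 2 * (sqrt g * sqrt (K - g)) / K"
      using K g by (simp add: real_sqrt_divide real_sqrt_mult)
    then have e: "inverse (sqrt (1 - (2 * g / K - 1)\<^sup>2)) * (2 / K) = 1 / (sqrt g * sqrt (K - g))"
      using K g by (simp add: field_simps)
    have "((\<lambda>g. arcsin (2 * g / K - 1)) has_real_derivative inverse (sqrt (1 - (2 * g / K - 1)\<^sup>2)) * (2 / K)) (at g)"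
      by (rule DERIV_chain2[OF DERIV_arcsin]) (use in01[OF g] in \<open>auto intro!: derivative_eq_intros\<close>)
    then show "((\<lambda>g. arcsin (2 * g / K - 1)) has_real_derivative 1 / (sqrt g * sqrt (K - g))) (at g)" unfolding e .
    show "isCont (\<lambda>g. 1 / (sqrt g * sqrt (K - g))) g" using g by (intro continuous_intros) auto
  next
    show "(((\<lambda>g. arcsin (2 * g / K - 1)) \<circ> real_of_ereal) \<longlongrightarrow> arcsin (2 * 0 / K - 1)) (at_right (ereal 0))"
      unfolding ereal_tendsto_simps using continuous_on_Icc_at_rightD[OF c K] .
    show "(((\<lambda>g. arcsin (2 * g / K - 1)) \<circ> real_of_ereal) \<longlongrightarrow> arcsin (2 * K / K - 1)) (at_left (ereal K))"
      unfolding ereal_tendsto_simps using continuous_on_Icc_at_leftD[OF c K] .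
  qed (use K in auto)
  then show ?thesis by simp
qed

section \<open>Nearest-neighbour chains with an absorbing end\<close>

text \<open>
  \<open>G j\<close> is the exchange rate across the edge between the sites \<open>j\<close> and \<open>j + 1\<close>. The loss of site \<open>N\<close> is
  written as exchange with an extra site \<open>N + 1\<close> kept empty, so that every site obeys the same
  equation and the loss is estimated like any other edge. The lemmas below close the edge below
  site \<open>1\<close> by \<open>G 0 = 0\<close>.
\<close>

definition chain_solution :: "nat \<Rightarrow> (nat \<Rightarrow> real) \<Rightarrow> (nat \<Rightarrow> real \<Rightarrow> real) \<Rightarrow> bool" where
  "chain_solution N G X \<longleftrightarrow>
     (\<forall>z\<ge>0. X (Suc N) z = 0) \<and>
     (\<forall>j\<in>{1..N}. \<forall>z\<ge>0.
        (X j has_real_derivative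
           (G j * (X (Suc j) z - X j z) - G (j - 1) * (X j z - X (j - 1) z))) (at z within {0..}))"

lemma square_sum_le: "(x + y)\<^sup>2 \<le> 2 * x\<^sup>2 + 2 * (y::real)\<^sup>2"
proof -
  have "0 \<le> (x - y)\<^sup>2" by simp
  then show ?thesis by (simp add: power2_eq_square algebra_simps)
qed

lemma flux_sum_by_parts:
  fixes Y f :: "nat \<Rightarrow> real"
  shows "(\<Sum>j=1..N. Y j * (f j - f (j - 1))) =
         Y (Suc N) * f N - Y 1 * f 0 - (\<Sum>j=1..N. (Y (Suc j) - Y j) * f j)"
  by (induction N) (auto simp: algebra_simps)

lemma nonincreasing_of_derivative_within:
  fixes f :: "real \<Rightarrow> real"
  assumes "a \<le> b"
    and D: "\<And>x. x \<in> {a..b} \<Longrightarrow> (f has_real_derivative f' x) (at x within {a..b})"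
    and neg: "\<And>x. x \<in> {a..b} \<Longrightarrow> f' x \<le> 0"
  shows "f b \<le> f a"
proof -
  obtain x where "x \<in> {a..b}" "f b - f a = (b - a) * f' x"
    by (rule mvt_within[OF assms(1) order_refl D])
  with neg[of x] assms(1) show ?thesis
    by (metis diff_ge_0_iff_ge diff_le_0_iff_le mult_nonneg_nonpos)
qed

text \<open>
  The error \<open>e = X - v\<close> is driven by the flux error \<open>y\<^sub>j = G\<^sub>j (v\<^sub>j\<^sub>+\<^sub>1 - v\<^sub>j) - f\<^sub>j\<close> and the residual \<open>r\<close>.
  Summation by parts produces the dissipation \<open>- 2 \<Sum> G\<^sub>j (e\<^sub>j\<^sub>+\<^sub>1 - e\<^sub>j)\<^sup>2\<close>, which absorbs the flux error at
  the price \<open>y\<^sub>j\<^sup>2 / (2 G\<^sub>j)\<close>, at most \<open>q\<^sub>j / 2\<close>; the residual is absorbed by \<open>2 e r \<le> e\<^sup>2 + r\<^sup>2\<close>, and Gronwall's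
  argument finishes. Fast edges thus tolerate large flux errors. Bounding \<open>y\<^sub>j\<^sup>2\<close> by \<open>G\<^sub>j q\<^sub>j\<close> rather than
  dividing by \<open>G\<^sub>j\<close> admits edges of rate \<open>0\<close>.
\<close>

lemma chain_energy:
  fixes X v f r q :: "nat \<Rightarrow> real \<Rightarrow> real"
  assumes X: "chain_solution N G X" and G0: "G 0 = 0"
    and Gpos: "\<And>j. j \<in> {1..N} \<Longrightarrow> 0 \<le> G j"
    and z: "0 \<le> z0" "z0 \<le> z1" and K: "0 \<le> K"
    and vend: "\<And>z. z \<in> {z0..z1} \<Longrightarrow> v (Suc N) z = 0"
    and f0: "\<And>z. z \<in> {z0..z1} \<Longrightarrow> f 0 z = 0"
    and dv: "\<And>j z. j \<in> {1..N} \<Longrightarrow> z \<in> {z0..z1} \<Longrightarrow>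
      (v j has_real_derivative (f j z - f (j - 1) z + r j z)) (at z within {z0..z1})"
    and q: "\<And>j z. j \<in> {1..N} \<Longrightarrow> z \<in> {z0..z1} \<Longrightarrow>
      (G j * (v (Suc j) z - v j z) - f j z)\<^sup>2 \<le> G j * q j z"
    and qpos: "\<And>j z. j \<in> {1..N} \<Longrightarrow> z \<in> {z0..z1} \<Longrightarrow> 0 \<le> q j z"
    and bound: "\<And>z. z \<in> {z0..z1} \<Longrightarrow> (\<Sum>j=1..N. q j z) / 2 + (\<Sum>j=1..N. (r j z)\<^sup>2) \<le> K"
  shows "(\<Sum>j=1..N. (X j z1 - v j z1)\<^sup>2)
         \<le> exp (z1 - z0) * ((\<Sum>j=1..N. (X j z0 - v j z0)\<^sup>2) + K * (z1 - z0))"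
proof -
  define e where "e j z = X j z - v j z" for j z
  define E where "E z = (\<Sum>j=1..N. (e j z)\<^sup>2)" for z
  define h where "h j z = G j * (X (Suc j) z - X j z) - f j z" for j z
  define E' where "E' z = (\<Sum>j=1..N. 2 * (e j z * (h j z - h (j - 1) z - r j z)))" for z
  have dX: "(X j has_real_derivative
           (G j * (X (Suc j) t - X j t) - G (j - 1) * (X j t - X (j - 1) t))) (at t within {z0..z1})"
    if "j \<in> {1..N}" "t \<in> {z0..z1}" for j t
  proof -
    have "(X j has_real_derivative
           (G j * (X (Suc j) t - X j t) - G (j - 1) * (X j t - X (j - 1) t))) (at t within {0..})"
      using X that z unfolding chain_solution_def by auto
    then show ?thesis using z by (rule_tac DERIV_subset) auto
  qed
  have de: "(e j has_real_derivative (h j t - h (j - 1) t - r j t)) (at t within {z0..z1})"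
    if "j \<in> {1..N}" "t \<in> {z0..z1}" for j t
  proof -
    have "Suc (j - 1) = j" using that by auto
    then show ?thesis
      unfolding e_def h_def
      by (auto intro!: DERIV_cong[OF DERIV_diff[OF dX[OF that] dv[OF that]]])
  qed
  have dE: "(E has_real_derivative E' t) (at t within {z0..z1})" if "t \<in> {z0..z1}" for t
    unfolding E_def E'_def
    by (intro DERIV_sum DERIV_cong[OF DERIV_power[OF de[OF _ that]]]) auto
  have E'le: "E' t \<le> K + E t" if t: "t \<in> {z0..z1}" for t
  proof -
    have h0: "h 0 t = 0" using f0[OF t] G0 by (simp add: h_def)
    have end0: "e (Suc N) t = 0"
      using X vend[OF t] t z unfolding e_def chain_solution_def by auto
    have parts: "(\<Sum>j=1..N. e j t * (h j t - h (j - 1) t)) = - (\<Sum>j=1..N. (e (Suc j) t - e j t) * h j t)"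
      using flux_sum_by_parts[of "\<lambda>j. e j t" "\<lambda>j. h j t" N] h0 end0 by simp
    have edge: "- 2 * ((e (Suc j) t - e j t) * h j t) \<le> q j t / 2" if j: "j \<in> {1..N}" for j
    proof -
      define x where "x = e (Suc j) t - e j t"
      define y where "y = G j * (v (Suc j) t - v j t) - f j t"
      have hxy: "h j t = G j * x + y"
        unfolding h_def x_def y_def e_def by (simp add: algebra_simps)
      have yq: "y\<^sup>2 \<le> G j * q j t" using q[OF j t] by (simp add: y_def)
      show ?thesis
      proof (cases "G j = 0")
        case True
        then have "y = 0" using yq by simp
        then show ?thesis
          using True hxy qpos[OF j t] by simp
      next
        case False
        then have gp: "G j > 0" using Gpos[OF j] by simp
        \<comment> \<open>Completes the square in \<open>4 G x (G x + y) = (2 G x + y)\<^sup>2 - y\<^sup>2\<close>.\<close>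
        have "0 \<le> (2 * G j * x + y)\<^sup>2" by simp
        then have "- 4 * G j * (x * (G j * x + y)) \<le> G j * q j t"
          using yq by (simp add: power2_eq_square algebra_simps)
        then have "G j * (- 4 * (x * (G j * x + y))) \<le> G j * q j t" by (simp add: algebra_simps)
        then have "- 4 * (x * (G j * x + y)) \<le> q j t" by (rule mult_left_le_imp_le[OF _ gp])
        then show ?thesis using hxy by (simp add: x_def)
      qed
    qed
    have "E' t = 2 * (\<Sum>j=1..N. e j t * (h j t - h (j - 1) t)) + (\<Sum>j=1..N. - 2 * (e j t * r j t))"
      unfolding E'_def by (simp add: sum_distrib_left sum_negf sum_subtractf sum.distrib algebra_simps)
    also have "\<dots> = (\<Sum>j=1..N. - 2 * ((e (Suc j) t - e j t) * h j t)) + (\<Sum>j=1..N. - 2 * (e j t * r j t))"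
      unfolding parts by (simp add: sum_distrib_left sum_negf)
    also have "\<dots> \<le> (\<Sum>j=1..N. q j t / 2) + (\<Sum>j=1..N. (e j t)\<^sup>2 + (r j t)\<^sup>2)"
    proof (intro add_mono sum_mono edge)
      fix j
      have "0 \<le> (e j t + r j t)\<^sup>2" by simp
      then show "- 2 * (e j t * r j t) \<le> (e j t)\<^sup>2 + (r j t)\<^sup>2" by (simp add: power2_sum)
    qed auto
    also have "\<dots> \<le> K + E t"
      using bound[OF t] by (simp add: E_def sum.distrib sum_divide_distrib)
    finally show ?thesis .
  qed
  define P where "P t = exp (- (t - z0)) * E t - K * (t - z0)" for t
  have "P z1 \<le> P z0"
  proof (rule nonincreasing_of_derivative_within[OF z(2)])
    fix t assume t: "t \<in> {z0..z1}"
    show "(P has_real_derivative (exp (- (t - z0)) * (E' t - E t) - K)) (at t within {z0..z1})"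
      unfolding P_def by (auto intro!: derivative_eq_intros dE[OF t] simp: algebra_simps)
    have "exp (- (t - z0)) * (E' t - E t) \<le> exp (- (t - z0)) * K"
      using E'le[OF t] by (intro mult_left_mono) auto
    also have "\<dots> \<le> 1 * K" using t K by (intro mult_right_mono) auto
    finally show "exp (- (t - z0)) * (E' t - E t) - K \<le> 0" by simp
  qed
  then have "exp (- (z1 - z0)) * E z1 \<le> E z0 + K * (z1 - z0)" by (simp add: P_def)
  then have "exp (z1 - z0) * (exp (- (z1 - z0)) * E z1) \<le> exp (z1 - z0) * (E z0 + K * (z1 - z0))"
    by (intro mult_left_mono) auto
  moreover have "exp (z1 - z0) * (exp (- (z1 - z0)) * E z1) = E z1"
    by (simp add: mult.assoc[symmetric] exp_add[symmetric])
  ultimately show ?thesis by (simp only: E_def e_def)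
qed

text \<open>
  The exchange operator is symmetric, hence \<open>\<Sum>\<^sub>j X\<^sub>j (t) Y\<^sub>j (L - t)\<close> does not depend on \<open>t\<close>.
\<close>

lemma chain_duality:
  assumes X: "chain_solution N G X" and Y: "chain_solution N G Y" and G0: "G 0 = 0" and L: "0 \<le> L"
  shows "(\<Sum>j=1..N. X j L * Y j 0) = (\<Sum>j=1..N. X j 0 * Y j L)"
proof (cases "L = 0")
  case False
  with L have L: "0 < L" by simp
  define D where "D X j t = G j * (X (Suc j) t - X j t) - G (j - 1) * (X j t - X (j - 1) t)"
    for X :: "nat \<Rightarrow> real \<Rightarrow> real" and j t
  define P where "P t = (\<Sum>j=1..N. X j t * Y j (L - t))" for t
  have d0: "(Z j has_real_derivative D Z j t) (at t within {0..})"
    if "chain_solution N G Z" "j \<in> {1..N}" "0 \<le> t" for Z j t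
    using that unfolding chain_solution_def D_def by auto
  have d: "(Z j has_real_derivative D Z j t) (at t)"
    if "chain_solution N G Z" "j \<in> {1..N}" "0 < t" for Z j t
  proof -
    have "at t within {0..} = at t" using that by (intro at_within_open_subset[of _ "{0<..}"]) auto
    then show ?thesis using d0[OF that(1,2), of t] that by auto
  qed
  have cont: "continuous_on {0..} (Z j)" if "chain_solution N G Z" "j \<in> {1..N}" for Z j
    using d0[OF that] by (meson DERIV_continuous atLeast_iff continuous_on_eq_continuous_within)
  have "continuous_on {0..L} P"
    unfolding P_def
    by (intro continuous_intros continuous_on_compose2[OF cont[OF Y]] continuous_on_subset[OF cont[OF X]]) auto
  moreover have "(P has_real_derivative 0) (at t)" if t: "0 < t" "t < L" for t
  proof -
    have "(P has_real_derivative (\<Sum>j=1..N. D X j t * Y j (L - t) + (D Y j (L - t) * (0 - 1)) * X j t)) (at t)"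
      unfolding P_def
      using t by (intro DERIV_sum DERIV_mult d[OF X] DERIV_chain2[OF d[OF Y]] DERIV_diff) auto
    moreover have "(\<Sum>j=1..N. D X j t * Y j (L - t)) = (\<Sum>j=1..N. D Y j (L - t) * X j t)"
    proof -
      have XN: "X (Suc N) t = 0" and YN: "Y (Suc N) (L - t) = 0"
        using X Y t unfolding chain_solution_def by auto
      have S: "Suc (j - 1) = j" if "j \<in> {1..N}" for j using that by auto
      have "(\<Sum>j=1..N. D X j t * Y j (L - t))
        = (\<Sum>j=1..N. Y j (L - t) * (G j * (X (Suc j) t - X j t) - G (j - 1) * (X (Suc (j - 1)) t - X (j - 1) t)))"
        by (intro sum.cong refl) (simp add: D_def S mult.commute)
      also have "\<dots> = - (\<Sum>j=1..N. (Y (Suc j) (L - t) - Y j (L - t)) * (G j * (X (Suc j) t - X j t)))"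
        using flux_sum_by_parts[of "\<lambda>j. Y j (L - t)" "\<lambda>j. G j * (X (Suc j) t - X j t)" N] YN G0 by simp
      also have "\<dots> = - (\<Sum>j=1..N. (X (Suc j) t - X j t) * (G j * (Y (Suc j) (L - t) - Y j (L - t))))"
        by (simp add: mult_ac)
      also have "\<dots> = (\<Sum>j=1..N. X j t * (G j * (Y (Suc j) (L - t) - Y j (L - t)) - G (j - 1) * (Y (Suc (j - 1)) (L - t) - Y (j - 1) (L - t))))"
        using flux_sum_by_parts[of "\<lambda>j. X j t" "\<lambda>j. G j * (Y (Suc j) (L - t) - Y j (L - t))" N] XN G0 by simp
      also have "\<dots> = (\<Sum>j=1..N. D Y j (L - t) * X j t)"
        by (intro sum.cong refl) (simp add: D_def S mult.commute)
      finally show ?thesis .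
    qed
    ultimately show ?thesis by (simp add: sum_subtractf)
  qed
  ultimately have "P L = P 0" using DERIV_isconst2[of 0 L P L] L by auto
  then show ?thesis by (simp add: P_def)
qed simp

lemma chain_solution_sum:
  assumes "\<And>l. l \<in> S \<Longrightarrow> chain_solution n G (X l)"
  shows "chain_solution n G (\<lambda>j z. \<Sum>l\<in>S. c l * X l j z)"
  unfolding chain_solution_def
proof (intro conjI allI ballI impI)
  fix z :: real assume "0 \<le> z"
  then show "(\<Sum>l\<in>S. c l * X l (Suc n) z) = 0"
    using assms by (intro sum.neutral) (auto simp: chain_solution_def)
next
  fix j z assume j: "j \<in> {1..n}" and z: "(0::real) \<le> z"
  have "((\<lambda>z. \<Sum>l\<in>S. c l * X l j z) has_real_derivative
      (\<Sum>l\<in>S. c l * (G j * (X l (Suc j) z - X l j z) - G (j - 1) * (X l j z - X l (j - 1) z)))) (at z within {0..})"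
    using assms j z by (intro DERIV_sum DERIV_cmult) (auto simp: chain_solution_def)
  then show "((\<lambda>z. \<Sum>l\<in>S. c l * X l j z) has_real_derivative
      G j * ((\<Sum>l\<in>S. c l * X l (Suc j) z) - (\<Sum>l\<in>S. c l * X l j z))
      - G (j - 1) * ((\<Sum>l\<in>S. c l * X l j z) - (\<Sum>l\<in>S. c l * X l (j - 1) z))) (at z within {0..})"
    by (simp add: sum_subtractf sum_distrib_left sum.distrib algebra_simps)
qed

lemma chain_stability:
  assumes X: "chain_solution n G X" and G0: "G 0 = 0" and Gpos: "\<And>j. j \<in> {1..n} \<Longrightarrow> 0 \<le> G j" and L: "0 \<le> L"
  shows "(\<Sum>j=1..n. (X j L)\<^sup>2) \<le> exp L * (\<Sum>j=1..n. (X j 0)\<^sup>2)"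
  using chain_energy[OF X G0 Gpos order_refl L, of 0 "\<lambda>_ _. 0" "\<lambda>_ _. 0" "\<lambda>_ _. 0" "\<lambda>_ _. 0"] by simp

text \<open>
  Duality for two fundamental solutions, that is the symmetry of the transition matrix.
\<close>

lemma chain_symmetry:
  assumes X: "\<And>l. l \<in> {1..n} \<Longrightarrow> chain_solution n G (X l)" and G0: "G 0 = 0"
    and init: "\<And>j l. j \<in> {1..n} \<Longrightarrow> l \<in> {1..n} \<Longrightarrow> X l j 0 = (if j = l then 1 else 0)"
    and L: "0 \<le> L" and jl: "j \<in> {1..n}" "l \<in> {1..n}"
  shows "X l j L = X j l L"
proof -
  have "(\<Sum>i=1..n. X l i L * X j i 0) = (\<Sum>i=1..n. if i = j then X l i L else 0)"
    using init jl by (intro sum.cong) auto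
  moreover have "(\<Sum>i=1..n. X l i 0 * X j i L) = (\<Sum>i=1..n. if i = l then X j i L else 0)"
    using init jl by (intro sum.cong) auto
  ultimately show ?thesis using chain_duality[OF X[OF jl(2)] X[OF jl(1)] G0 L] jl by simp
qed

section \<open>Diffusion limit of chains\<close>

text \<open>
  The rates of the first edges need not be close to their limit. The comparison function is
  therefore taken constant over the first \<open>J\<close> sites, where it has no flux. The site \<open>n + 1\<close> is sent to
  \<open>1\<close>, where the solution of the diffusion equation vanishes.
\<close>

definition clamped_node :: "nat \<Rightarrow> nat \<Rightarrow> nat \<Rightarrow> real" where
  "clamped_node n J j = min 1 (real (max J j) / real n)"

text \<open>
  \<open>chain_energy\<close> for \<open>v\<^sub>j = T (z, j / n)\<close> and the flux \<open>f\<^sub>j = n A(j / n) T\<^sub>u (j / n)\<close> of the limiting equation.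
  In the bulk the flux error is of order \<open>n \<epsilon>\<close> against rates of order \<open>n\<^sup>2\<close>, which gives \<open>n \<epsilon>\<^sup>2\<close>
  altogether; on the last two edges it is of order \<open>n\<close>, which gives \<open>n\<^sup>2 / G\<close>. The residual is the
  oscillation of the right-hand side \<open>Gd\<close> over one cell, except near the clamped sites. There the
  flux jumps from \<open>0\<close> to \<open>f\<^sub>J\<close>, and this jump is bounded: the flux vanishes at \<open>u = 0\<close>, so that
  \<open>f\<^sub>J = J Gd\<close> at an intermediate point.
\<close>

lemma chain_comparison_step:
  fixes T Tu Gd :: "real \<Rightarrow> real \<Rightarrow> real" and A :: "real \<Rightarrow> real"
  assumes J: "1 \<le> J" "J + 3 \<le> n" and S: "chain_solution n G S" and G0: "G 0 = 0"
    and Gpos: "\<And>j. j \<in> {1..n} \<Longrightarrow> 0 \<le> G j"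
    and bulk: "\<And>j. J \<le> j \<Longrightarrow> j + 2 \<le> n \<Longrightarrow> \<bar>G j / (real n)\<^sup>2 - A (real j / real n)\<bar> \<le> \<epsilon>"
    and \<epsilon>: "0 < \<epsilon>" "\<epsilon> \<le> am / 2" and am: "0 < am"
    and GC: "G (n - 1) \<le> C * (real n)\<^sup>2" and Glast: "0 < G (n - 1)" "0 < G n"
    and A: "\<And>u. u \<in> {0..1} \<Longrightarrow> am \<le> A u \<and> A u \<le> Am"
    and z: "0 < z0" "z0 < L"
    and dT: "\<And>z u. z \<in> {z0..L} \<Longrightarrow> u \<in> {0..1} \<Longrightarrow> (T z has_real_derivative Tu z u) (at u within {0..1})"
    and dF: "\<And>z u. z \<in> {z0..L} \<Longrightarrow> u \<in> {0..1} \<Longrightarrow>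
      ((\<lambda>v. A v * Tu z v) has_real_derivative Gd z u) (at u within {0..1})"
    and dz: "\<And>z u. z \<in> {z0..L} \<Longrightarrow> u \<in> {0..1} \<Longrightarrow> ((\<lambda>s. T s u) has_real_derivative Gd z u) (at z)"
    and bc: "\<And>z. z \<in> {z0..L} \<Longrightarrow> Tu z 0 = 0 \<and> T z 1 = 0"
    and Cb: "\<And>z u. z \<in> {z0..L} \<Longrightarrow> u \<in> {0..1} \<Longrightarrow> \<bar>Tu z u\<bar> \<le> Cb \<and> \<bar>Gd z u\<bar> \<le> Cb"
    and osc: "\<And>z x y. z \<in> {z0..L} \<Longrightarrow> x \<in> {0..1} \<Longrightarrow> y \<in> {0..1} \<Longrightarrow> \<bar>x - y\<bar> \<le> 1 / real n \<Longrightarrow>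
      \<bar>Tu z x - Tu z y\<bar> \<le> \<epsilon> \<and> \<bar>Gd z x - Gd z y\<bar> \<le> \<epsilon>"
  defines "v \<equiv> \<lambda>j z. T z (clamped_node n J j)"
  defines "K \<equiv> real n * (((Cb + Am)\<^sup>2 / am + 1) * \<epsilon>\<^sup>2) + (Cb\<^sup>2 * C + (real n * Am * Cb)\<^sup>2 / G (n - 1)
      + (real n * Am * Cb)\<^sup>2 / G n + real J * ((1 + real J) * Cb)\<^sup>2)"
  shows "(\<Sum>j=1..n. (S j L - v j L)\<^sup>2)
         \<le> exp (L - z0) * ((\<Sum>j=1..n. (S j z0 - v j z0)\<^sup>2) + K * (L - z0))"
proof -
  define f where "f j z = (if j < J then 0 else real n * (A (real j / real n) * Tu z (real j / real n)))" for j z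
  define r where "r j z = Gd z (clamped_node n J j) - (f j z - f (j - 1) z)" for j z
  define q where "q j z = (G j * (v (Suc j) z - v j z) - f j z)\<^sup>2 / G j" for j z
  have n: "0 < real n" using J by auto
  have Cb0: "0 \<le> Cb" using Cb[of L 0] z by auto
  have Am: "am \<le> Am" "0 < Am" using A[of 0] am by auto
  have Aabs: "\<bar>A u\<bar> \<le> Am" if "u \<in> {0..1}" for u using A[OF that] am by auto
  have node: "clamped_node n J j \<in> {0..1}" for j by (simp add: clamped_node_def)
  have nodeJ: "clamped_node n J j = real j / real n" if "J \<le> j" "j \<le> n" for j
    using that n by (simp add: clamped_node_def max_def min_def)
  have node1: "clamped_node n J j = 1" if "n \<le> j" for j
    using that n J by (simp add: clamped_node_def max_def min_def)
  have jn: "real j / real n \<in> {0..1}" if "j \<le> n" for j using that n by auto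
  have cell01: "x \<in> {0..1}" if "x \<in> {real j / real n..real (Suc j) / real n}" "Suc j \<le> n" for x j
  proof -
    have "0 \<le> real j / real n" "real (Suc j) / real n \<le> 1" using jn[OF that(2)] by auto
    then show ?thesis using that(1) by (meson atLeastAtMost_iff order_trans)
  qed
  have Gp: "0 < G j" if "J \<le> j" "j \<le> n" for j
  proof (cases "j + 2 \<le> n")
    case True
    have "am / 2 \<le> G j / (real n)\<^sup>2"
      using bulk[OF that(1) True] A[OF jn[OF that(2)]] \<epsilon> by linarith
    then have "0 < G j / (real n)\<^sup>2" using am by linarith
    then show ?thesis using n by (simp add: zero_less_divide_iff)
  next
    case False
    then have "j = n - 1 \<or> j = n" using that by auto
    then show ?thesis using Glast by auto
  qed
  have flux_bound: "\<bar>f j t\<bar> \<le> real n * Am * Cb" if "j \<le> n" "t \<in> {z0..L}" for j t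
  proof -
    have "\<bar>A (real j / real n)\<bar> * \<bar>Tu t (real j / real n)\<bar> \<le> Am * Cb"
      using Aabs[OF jn] Cb[OF that(2) jn] that Am by (intro mult_mono) auto
    then show ?thesis using n Am Cb0 unfolding f_def by (auto simp: abs_mult mult.assoc)
  qed
  have mvtT: "\<exists>x\<in>{real j / real n..real (Suc j) / real n}. v (Suc j) t - v j t = Tu t x / real n"
    if "J \<le> j" "j < n" and t: "t \<in> {z0..L}" for j t
  proof -
    have "real j / real n \<le> real (Suc j) / real n" using n by (simp add: divide_right_mono)
    moreover have sub: "{real j / real n..real (Suc j) / real n} \<subseteq> {0..1}"
      using jn[of j] jn[of "Suc j"] that by auto
    ultimately obtain x where "x \<in> {real j / real n..real (Suc j) / real n}"
      "T t (real (Suc j) / real n) - T t (real j / real n) = (real (Suc j) / real n - real j / real n) * Tu t x"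
      using mvt_within[of "real j / real n" "real (Suc j) / real n" "{0..1}" "T t" "Tu t"] dT[OF t] by blast
    moreover have "real (Suc j) / real n - real j / real n = 1 / real n" by (simp add: diff_divide_distrib[symmetric])
    ultimately show ?thesis using that unfolding v_def by (intro bexI[of _ x]) (auto simp: nodeJ)
  qed
  have yq: "(G j * (v (Suc j) t - v j t) - f j t)\<^sup>2 \<le> G j * q j t" if "j \<in> {1..n}" for j t
  proof (cases "j < J")
    case True
    then have "clamped_node n J (Suc j) = clamped_node n J j" by (simp add: clamped_node_def max_absorb1)
    then show ?thesis using True by (simp add: v_def f_def q_def)
  next
    case False
    then show ?thesis using Gp[of j] that by (simp add: q_def)
  qed
  have q0: "0 \<le> q j t" if "j \<in> {1..n}" for j t using Gpos[OF that] by (simp add: q_def)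
  define R1 where "R1 = 2 * (Cb\<^sup>2 * C + (real n * Am * Cb)\<^sup>2 / G (n - 1))"
  define R2 where "R2 = 2 * ((real n * Am * Cb)\<^sup>2 / G n)"
  define Q where "Q = 2 * ((Cb + Am)\<^sup>2 * \<epsilon>\<^sup>2 / am)"
  have C0: "0 \<le> C * (real n)\<^sup>2" using GC Glast by linarith
  then have C0: "0 \<le> C" using n by (simp add: zero_le_mult_iff)
  have R0: "0 \<le> R1" "0 \<le> R2" "0 \<le> Q" using Glast am C0 by (auto simp: R1_def R2_def Q_def)
  have qb: "q j t \<le> Q + (if j = n - 1 then R1 else 0) + (if j = n then R2 else 0)"
    if j: "j \<in> {1..n}" and t: "t \<in> {z0..L}" for j t
  proof -
    consider "j < J" | "J \<le> j" "j + 2 \<le> n" | "j = n - 1" "J \<le> j" | "j = n" using j J by force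
    then show ?thesis
    proof cases
      case 1
      then have "clamped_node n J (Suc j) = clamped_node n J j" by (simp add: clamped_node_def max_absorb1)
      then have "q j t = 0" using 1 by (simp add: v_def f_def q_def)
      then show ?thesis using R0 by auto
    next
      case 2
      then obtain x where x: "x \<in> {real j / real n..real (Suc j) / real n}"
        "v (Suc j) t - v j t = Tu t x / real n" using mvtT[of j t] t by auto
      have x01: "x \<in> {0..1}" using cell01[OF x(1)] 2 by auto
      have "\<bar>x - real j / real n\<bar> \<le> 1 / real n" using x by (auto simp: add_divide_distrib)
      then have o: "\<bar>Tu t x - Tu t (real j / real n)\<bar> \<le> \<epsilon>" using osc[OF t x01 jn[of j]] 2 by auto
      define g where "g = G j / (real n)\<^sup>2"
      have g: "\<bar>g - A (real j / real n)\<bar> \<le> \<epsilon>" using bulk 2 by (simp add: g_def)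
      have G: "G j = g * (real n)\<^sup>2" using n by (simp add: g_def)
      have gam: "am / 2 \<le> g" using g A[OF jn[of j]] \<epsilon> 2 by auto
      have "G j * (v (Suc j) t - v j t) - f j t
        = real n * ((g - A (real j / real n)) * Tu t x + A (real j / real n) * (Tu t x - Tu t (real j / real n)))"
        using 2 n by (simp add: x(2) f_def G power2_eq_square field_simps)
      moreover have "\<bar>(g - A (real j / real n)) * Tu t x + A (real j / real n) * (Tu t x - Tu t (real j / real n))\<bar> \<le> \<epsilon> * Cb + Am * \<epsilon>"
      proof (rule order_trans[OF abs_triangle_ineq add_mono])
        show "\<bar>(g - A (real j / real n)) * Tu t x\<bar> \<le> \<epsilon> * Cb"
          unfolding abs_mult using g Cb[OF t x01] \<epsilon> by (intro mult_mono) auto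
        show "\<bar>A (real j / real n) * (Tu t x - Tu t (real j / real n))\<bar> \<le> Am * \<epsilon>"
          unfolding abs_mult using Aabs[OF jn[of j]] o 2 Am by (intro mult_mono) auto
      qed
      ultimately have "\<bar>G j * (v (Suc j) t - v j t) - f j t\<bar> \<le> real n * (\<epsilon> * Cb + Am * \<epsilon>)"
        using n by (simp only: abs_mult abs_of_nat mult_left_mono)
      then have "\<bar>G j * (v (Suc j) t - v j t) - f j t\<bar> \<le> real n * ((Cb + Am) * \<epsilon>)"
        by (simp add: algebra_simps)
      then have "(G j * (v (Suc j) t - v j t) - f j t)\<^sup>2 \<le> (real n * ((Cb + Am) * \<epsilon>))\<^sup>2"
        by (rule abs_le_square_iff[THEN iffD1, OF order_trans[OF _ abs_ge_self]])
      then have "q j t \<le> (real n * ((Cb + Am) * \<epsilon>))\<^sup>2 / G j"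
        unfolding q_def using Gp[of j] 2 by (intro divide_right_mono) auto
      also have "\<dots> \<le> (real n * ((Cb + Am) * \<epsilon>))\<^sup>2 / (am / 2 * (real n)\<^sup>2)"
        using gam am n unfolding G by (intro divide_left_mono mult_right_mono mult_pos_pos) auto
      also have "\<dots> = Q" using n am by (simp add: Q_def power_mult_distrib)
      finally show ?thesis using R0 by auto
    next
      case 3
      then obtain x where x: "x \<in> {real j / real n..real (Suc j) / real n}"
        "v (Suc j) t - v j t = Tu t x / real n" using mvtT[of j t] t j J by auto
      have x01: "x \<in> {0..1}" using cell01[OF x(1)] 3 J by auto
      define y1 where "y1 = G j * (Tu t x / real n)"
      have "q j t = (y1 - f j t)\<^sup>2 / G j" by (simp add: q_def x y1_def)
      also have "\<dots> \<le> (2 * y1\<^sup>2 + 2 * (f j t)\<^sup>2) / G j"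
      proof (rule divide_right_mono)
        have "0 \<le> (y1 + f j t)\<^sup>2" by simp
        then show "(y1 - f j t)\<^sup>2 \<le> 2 * y1\<^sup>2 + 2 * (f j t)\<^sup>2" by (simp add: power2_eq_square algebra_simps)
      qed (use Glast 3 in auto)
      also have "\<dots> = 2 * (y1\<^sup>2 / G j) + 2 * ((f j t)\<^sup>2 / G j)" by (simp add: add_divide_distrib)
      also have "\<dots> \<le> R1"
      proof -
        have "(f j t)\<^sup>2 / G j \<le> (real n * Am * Cb)\<^sup>2 / G j"
          using flux_bound[of j t] t 3 Glast
          by (intro divide_right_mono abs_le_square_iff[THEN iffD1]) auto
        moreover have "y1\<^sup>2 / G j = G j / (real n)\<^sup>2 * (Tu t x)\<^sup>2"
          using Glast 3 by (simp add: y1_def power2_eq_square field_simps)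
        moreover have "G j / (real n)\<^sup>2 * (Tu t x)\<^sup>2 \<le> C * Cb\<^sup>2"
          using GC 3 n C0 Cb[OF t x01] Cb0
          by (intro mult_mono abs_le_square_iff[THEN iffD1]) (auto simp: divide_le_eq)
        ultimately show ?thesis using 3 by (simp add: R1_def mult.commute)
      qed
      finally show ?thesis using R0 3 by auto
    next
      case 4
      have "v (Suc j) t - v j t = 0" using 4 by (simp add: v_def node1)
      then have "q j t = (f j t)\<^sup>2 / G j" by (simp add: q_def)
      also have "\<dots> \<le> (real n * Am * Cb)\<^sup>2 / G j"
        using flux_bound[of j t] t 4 Glast
        by (intro divide_right_mono abs_le_square_iff[THEN iffD1]) auto
      also have "\<dots> \<le> R2"
      proof -
        have "0 \<le> (real n * Am * Cb)\<^sup>2 / G n" using Glast by simp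
        then have "(real n * Am * Cb)\<^sup>2 / G n \<le> R2" unfolding R2_def by linarith
        then show ?thesis using 4 by simp
      qed
      finally show ?thesis using R0 4 by auto
    qed
  qed
  have rb: "(r j t)\<^sup>2 \<le> \<epsilon>\<^sup>2 + (if j \<le> J then ((1 + real J) * Cb)\<^sup>2 else 0)"
    if j: "j \<in> {1..n}" and t: "t \<in> {z0..L}" for j t
  proof -
    have mvtF: "\<exists>x\<in>{a..b}. A b * Tu t b - A a * Tu t a = (b - a) * Gd t x" if "a \<le> b" "{a..b} \<subseteq> {0..1}" for a b
      using mvt_within[of a b "{0..1}" "\<lambda>v. A v * Tu t v" "Gd t"] dF[OF t] that by blast
    consider "j < J" | "j = J" | "J < j" by force
    then show ?thesis
    proof cases
      case 1
      then have "r j t = Gd t (clamped_node n J j)" by (simp add: r_def f_def)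
      then have "\<bar>r j t\<bar> \<le> Cb" using Cb[OF t node] by simp
      also have "Cb \<le> (1 + real J) * Cb" using Cb0 by (simp add: algebra_simps)
      finally have "(r j t)\<^sup>2 \<le> ((1 + real J) * Cb)\<^sup>2" using Cb0 by (intro abs_le_square_iff[THEN iffD1]) auto
      then show ?thesis using 1 by (simp add: add_increasing)
    next
      case 2
      have "{0..real J / real n} \<subseteq> {0..1}" using jn[of J] J by auto
      then obtain x where x: "x \<in> {0..real J / real n}"
        "A (real J / real n) * Tu t (real J / real n) = real J / real n * Gd t x"
        using mvtF[of 0 "real J / real n"] n bc[OF t] by auto
      have x01: "x \<in> {0..1}" using x jn[of J] J order_trans by (fastforce simp del: divide_le_eq_1)
      have "f J t = real J * Gd t x" using x n by (simp add: f_def)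
      then have "r j t = Gd t (clamped_node n J j) - real J * Gd t x" using 2 J by (simp add: r_def f_def)
      then have "\<bar>r j t\<bar> \<le> \<bar>Gd t (clamped_node n J j)\<bar> + real J * \<bar>Gd t x\<bar>"
        by (metis abs_mult abs_of_nat abs_triangle_ineq4)
      also have "\<dots> \<le> Cb + real J * Cb" using Cb[OF t node] Cb[OF t x01] by (intro add_mono mult_left_mono) auto
      finally have "\<bar>r j t\<bar> \<le> (1 + real J) * Cb" by (simp add: algebra_simps)
      then have "(r j t)\<^sup>2 \<le> ((1 + real J) * Cb)\<^sup>2" using Cb0 by (intro abs_le_square_iff[THEN iffD1]) auto
      then show ?thesis using 2 by (simp add: add_increasing)
    next
      case 3
      define a b where "a = real (j - 1) / real n" and "b = real j / real n"
      have ab: "a \<le> b" "b - a = 1 / real n" "{a..b} \<subseteq> {0..1}"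
        using n j jn[of "j - 1"] jn[of j] by (auto simp: a_def b_def field_simps of_nat_diff)
      then obtain x where x: "x \<in> {a..b}" "A b * Tu t b - A a * Tu t a = 1 / real n * Gd t x"
        using mvtF[of a b] by auto
      have "f j t - f (j - 1) t = real n * (A b * Tu t b - A a * Tu t a)"
        using 3 by (simp add: f_def a_def b_def algebra_simps)
      then have "f j t - f (j - 1) t = Gd t x" using x n by simp
      then have "r j t = Gd t b - Gd t x" using 3 j by (simp add: r_def nodeJ b_def)
      moreover have "\<bar>b - x\<bar> \<le> 1 / real n" using x ab by auto
      ultimately have "\<bar>r j t\<bar> \<le> \<epsilon>" using osc[OF t, of b x] x ab by auto
      then have "(r j t)\<^sup>2 \<le> \<epsilon>\<^sup>2" using \<epsilon> by (intro abs_le_square_iff[THEN iffD1]) auto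
      then show ?thesis using 3 by simp
    qed
  qed
  show ?thesis
  proof (rule chain_energy[OF S G0 Gpos, where f = f and r = r and q = q])
    show "0 \<le> K" unfolding K_def using C0 Glast n am by (intro add_nonneg_nonneg mult_nonneg_nonneg divide_nonneg_nonneg) auto
    fix t assume t: "t \<in> {z0..L}"
    show "v (Suc n) t = 0" using bc[OF t] by (simp add: v_def node1)
    show "f 0 t = 0" using J by (simp add: f_def)
    have "(\<Sum>j=1..n. q j t) \<le> (\<Sum>j=1..n. Q + (if j = n - 1 then R1 else 0) + (if j = n then R2 else 0))"
      using qb t by (intro sum_mono) auto
    also have "\<dots> = real n * Q + R1 + R2"
      using J by (simp add: sum.distrib)
    finally have 1: "(\<Sum>j=1..n. q j t) \<le> real n * Q + R1 + R2" .
    have "(\<Sum>j=1..n. (r j t)\<^sup>2) \<le> (\<Sum>j=1..n. \<epsilon>\<^sup>2 + (if j \<le> J then ((1 + real J) * Cb)\<^sup>2 else 0))"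
      using rb t by (intro sum_mono) auto
    also have "\<dots> = real n * \<epsilon>\<^sup>2 + (\<Sum>j\<in>{1..n} \<inter> {j. j \<le> J}. ((1 + real J) * Cb)\<^sup>2)"
      by (simp add: sum.distrib sum.If_cases)
    also have "{1..n} \<inter> {j. j \<le> J} = {1..J}" using J by auto
    finally have 2: "(\<Sum>j=1..n. (r j t)\<^sup>2) \<le> real n * \<epsilon>\<^sup>2 + real J * ((1 + real J) * Cb)\<^sup>2" by simp
    have 3: "(real n * Q + R1 + R2) / 2 = real n * ((Cb + Am)\<^sup>2 / am * \<epsilon>\<^sup>2) + (Cb\<^sup>2 * C + (real n * Am * Cb)\<^sup>2 / G (n - 1)
      + (real n * Am * Cb)\<^sup>2 / G n)"
      by (simp add: Q_def R1_def R2_def add_divide_distrib)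
    have "(\<Sum>j=1..n. q j t) / 2 + (\<Sum>j=1..n. (r j t)\<^sup>2)
        \<le> (real n * Q + R1 + R2) / 2 + (real n * \<epsilon>\<^sup>2 + real J * ((1 + real J) * Cb)\<^sup>2)"
      by (intro add_mono divide_right_mono 1 2) auto
    also have "\<dots> = K" unfolding K_def 3 by (simp only: distrib_left distrib_right mult_1_left add_ac)
    finally show "(\<Sum>j=1..n. q j t) / 2 + (\<Sum>j=1..n. (r j t)\<^sup>2) \<le> K" .
    fix j assume j: "j \<in> {1..n}"
    have "((\<lambda>s. T s (clamped_node n J j)) has_real_derivative Gd t (clamped_node n J j)) (at t within {z0..L})"
      using dz[OF t node] by (rule has_field_derivative_at_within)
    then show "(v j has_real_derivative f j t - f (j - 1) t + r j t) (at t within {z0..L})"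
      by (simp add: v_def r_def)
    show "(G j * (v (Suc j) t - v j t) - f j t)\<^sup>2 \<le> G j * q j t" "0 \<le> q j t"
      using yq[OF j] q0[OF j] by auto
  qed (use z in auto)
qed

text \<open>
  Near \<open>z = 0\<close> the limiting solution offers no control. The comparison function is the stationary
  profile \<open>1 - (j / n)\<^sup>m\<close>: it vanishes at the absorbing end, its distance from \<open>1\<close> has mean square about
  \<open>1 / (2 m + 1)\<close>, and as its increments are at most \<open>m / n\<close>, the energy estimate adds only
  \<open>C m\<^sup>2 z / 2\<close> per site, up to a constant factor, by time \<open>z\<close>.
\<close>

lemma chain_initial_layer:
  fixes N :: "'w \<Rightarrow> nat" and G :: "'w \<Rightarrow> nat \<Rightarrow> real" and S :: "'w \<Rightarrow> nat \<Rightarrow> real \<Rightarrow> real"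
  assumes NF: "filterlim N at_top F"
    and G: "\<forall>\<^sub>F w in F. G w 0 = 0 \<and> (\<forall>j\<in>{1..N w}. 0 \<le> G w j)"
    and GC: "\<forall>\<^sub>F w in F. \<forall>j\<in>{1..<N w}. G w j \<le> C * (real (N w))\<^sup>2"
    and S: "\<forall>\<^sub>F w in F. chain_solution (N w) (G w) (S w) \<and> (\<forall>j\<in>{1..N w}. S w j 0 = 1)"
    and C: "0 \<le> C" and e: "0 < e"
  shows "\<exists>\<delta>>0. \<forall>z. 0 \<le> z \<and> z \<le> \<delta> \<longrightarrow> (\<forall>\<^sub>F w in F. (\<Sum>j=1..N w. (S w j z - 1)\<^sup>2) / real (N w) \<le> e)"
proof -
  \<comment> \<open>First \<open>m\<close> makes the mean square of \<open>(j / n)\<^sup>m\<close> less than \<open>e / 16\<close>, then \<open>\<delta>\<close> makes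
    the term \<open>C m\<^sup>2 \<delta>\<close> small against \<open>e\<close>.\<close>
  obtain m :: nat where m: "16 / e < real m" using reals_Archimedean2 by blast
  then have m0: "0 < real m" using e by (meson divide_pos_pos less_trans zero_less_numeral)
  define \<delta> where "\<delta> = min 1 (e / (6 * (C * (real m)\<^sup>2 + 1)))"
  have pos: "0 < C * (real m)\<^sup>2 + 1" using C by (simp add: add_nonneg_pos)
  then have \<delta>: "0 < \<delta>" "\<delta> \<le> 1" using e by (auto simp: \<delta>_def)
  have \<delta>e: "3 * (C * (real m)\<^sup>2 * \<delta>) \<le> e / 2"
  proof -
    have "\<delta> * (6 * (C * (real m)\<^sup>2 + 1)) \<le> e"
      using pos by (subst pos_le_divide_eq[symmetric]) (auto simp: \<delta>_def)
    moreover have "0 \<le> \<delta> * 6" using \<delta> by simp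
    ultimately show ?thesis by (simp add: algebra_simps)
  qed
  define c where "c n j = (real j / real n) ^ m" for n j :: nat
  have int: "(LINT u:{0..1}|lborel. (u ^ m)\<^sup>2) = 1 / (2 * real m + 1)"
    using integral_power[of 0 1 "2 * m"]
    by (simp add: set_lebesgue_integral_def power_mult[symmetric] mult.commute)
  have "((\<lambda>n. (\<Sum>j=1..n. (c n j)\<^sup>2) / real n) \<longlongrightarrow> 1 / (2 * real m + 1)) at_top"
    unfolding c_def int[symmetric] by (intro Riemann_sum_tendsto continuous_intros)
  moreover have "1 / (2 * real m + 1) < e / 16"
    using m m0 e by (simp add: field_simps)
  ultimately have "\<forall>\<^sub>F n in at_top. (\<Sum>j=1..n. (c n j)\<^sup>2) / real n < e / 16"
    by (rule order_tendstoD(2))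
  then have cF: "\<forall>\<^sub>F w in F. (\<Sum>j=1..N w. (c (N w) j)\<^sup>2) / real (N w) < e / 16"
    using NF by (rule eventually_compose_filterlim)
  show ?thesis
  proof (intro exI[of _ \<delta>] conjI allI impI \<delta>)
    fix z assume z: "0 \<le> z \<and> z \<le> \<delta>"
    from filterlim_at_top[THEN iffD1, OF NF, rule_format, of 2] G GC S cF
    show "\<forall>\<^sub>F w in F. (\<Sum>j=1..N w. (S w j z - 1)\<^sup>2) / real (N w) \<le> e"
    proof eventually_elim
      case (elim w)
      define n where "n = N w"
      have n: "2 \<le> n" and c16: "(\<Sum>j=1..n. (c n j)\<^sup>2) \<le> e / 16 * real n"
        using elim by (auto simp: n_def field_simps)
      have n0: "0 < real n" using n by simp
      define h where "h j = 1 - min 1 (real j / real n) ^ m" for j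
      have h: "h j = 1 - c n j" if "j \<in> {1..n}" for j
        using that n0 by (cases "j = n") (simp_all add: h_def c_def min_def)
      have h0: "h j = 0" if "n \<le> j" for j using that n0 by (simp add: h_def min_def)
      have Dh: "\<bar>h (Suc j) - h j\<bar> \<le> real m / real n" if "j \<in> {1..<n}" for j
      proof -
        have "norm (min 1 (real j / real n) ^ m - min 1 (real (Suc j) / real n) ^ m)
          \<le> real m * norm (min 1 (real j / real n) - min 1 (real (Suc j) / real n))"
          using n0 by (intro norm_power_diff) auto
        moreover have "min 1 (real j / real n) = real j / real n" "min 1 (real (Suc j) / real n) = real (Suc j) / real n"
          using that by (auto simp: min_def)
        moreover have "norm (real j / real n - real (Suc j) / real n) = 1 / real n"
          by (simp add: diff_divide_distrib[symmetric])
        ultimately show ?thesis by (simp add: h_def)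
      qed
      have energy: "(\<Sum>j=1..n. (S w j z - h j)\<^sup>2)
        \<le> exp (z - 0) * ((\<Sum>j=1..n. (S w j 0 - h j)\<^sup>2) + (real n * (C * (real m)\<^sup>2) / 2) * (z - 0))"
      proof (rule chain_energy[where G = "G w" and v = "\<lambda>j _. h j" and f = "\<lambda>_ _. 0" and r = "\<lambda>_ _. 0"
            and q = "\<lambda>j _. G w j * (h (Suc j) - h j)\<^sup>2"])
        fix t
        have "(\<Sum>j=1..n. G w j * (h (Suc j) - h j)\<^sup>2) \<le> (\<Sum>j=1..n. C * (real m)\<^sup>2)"
        proof (rule sum_mono)
          fix j assume j: "j \<in> {1..n}"
          show "G w j * (h (Suc j) - h j)\<^sup>2 \<le> C * (real m)\<^sup>2"
          proof (cases "j = n")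
            case False
            then have jn: "j \<in> {1..<n}" using j by auto
            have "G w j * (h (Suc j) - h j)\<^sup>2 \<le> (C * (real n)\<^sup>2) * (real m / real n)\<^sup>2"
              using elim jn Dh[OF jn] C n0 unfolding n_def[symmetric]
              by (intro mult_mono abs_le_square_iff[THEN iffD1]) auto
            then show ?thesis using n0 by (simp add: power_divide)
          qed (use h0 C in simp)
        qed
        then show "(\<Sum>j=1..n. G w j * (h (Suc j) - h j)\<^sup>2) / 2 + (\<Sum>j=1..n. 0\<^sup>2) \<le> real n * (C * (real m)\<^sup>2) / 2"
          by simp
      qed (use elim z h0 C n_def in \<open>auto simp: power2_eq_square\<close>)
      have e3: "exp z \<le> 3"
        using exp_le z \<delta> by (meson exp_le_cancel_iff order_trans)
      have "(\<Sum>j=1..n. (S w j 0 - h j)\<^sup>2) = (\<Sum>j=1..n. (c n j)\<^sup>2)"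
        using elim n_def h by (intro sum.cong) auto
      then have "(\<Sum>j=1..n. (S w j z - h j)\<^sup>2) \<le> 3 * (e / 16 * real n + real n * (C * (real m)\<^sup>2) / 2 * \<delta>)"
        using c16 z C n0 e3 e \<delta>
        by (intro order_trans[OF energy] mult_mono add_mono) (auto intro!: sum_nonneg add_nonneg_nonneg)
      also have "\<dots> = real n * (3 * (e / 16) + 3 * (C * (real m)\<^sup>2 * \<delta>) / 2)" by (simp add: algebra_simps)
      also have "\<dots> \<le> real n * (3 * (e / 16) + e / 4)"
        by (intro mult_left_mono add_left_mono) (use \<delta>e in linarith, simp)
      finally have 1: "(\<Sum>j=1..n. (S w j z - h j)\<^sup>2) \<le> real n * (3 * (e / 16) + e / 4)" .
      have "(\<Sum>j=1..n. (S w j z - 1)\<^sup>2) \<le> (\<Sum>j=1..n. 2 * (S w j z - h j)\<^sup>2 + 2 * (c n j)\<^sup>2)"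
      proof (rule sum_mono)
        fix j assume j: "j \<in> {1..n}"
        show "(S w j z - 1)\<^sup>2 \<le> 2 * (S w j z - h j)\<^sup>2 + 2 * (c n j)\<^sup>2"
          using square_sum_le[of "S w j z - h j" "- c n j"] h[OF j] by simp
      qed
      also have "\<dots> \<le> 2 * (real n * (3 * (e / 16) + e / 4)) + 2 * (e / 16 * real n)"
        unfolding sum.distrib sum_distrib_left[symmetric] using 1 c16 by (intro add_mono mult_left_mono) auto
      also have "\<dots> = e * real n" by (simp add: algebra_simps)
      finally show ?case using n0 by (simp add: n_def[symmetric] divide_le_eq)
    qed
  qed
qed

text \<open>
  At a small \<open>z\<^sub>0 > 0\<close> the chain and \<open>T1\<close> are both close to \<open>1\<close> in mean square, the chain by
  \<open>chain_initial_layer\<close> and \<open>T1\<close> by its initial condition. On the compact set \<open>[z\<^sub>0, L] \<times> [0, 1]\<close> the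
  derivatives of \<open>T1\<close> are bounded and uniformly continuous, so \<open>chain_comparison_step\<close> carries the
  closeness up to \<open>L\<close>. The condition on the last two rates says exactly that their cost
  \<open>N\<^sup>2 / G\<close> is \<open>o(N)\<close>.
\<close>

theorem chain_diffusion_limit:
  fixes N :: "'w \<Rightarrow> nat" and G :: "'w \<Rightarrow> nat \<Rightarrow> real" and S :: "'w \<Rightarrow> nat \<Rightarrow> real \<Rightarrow> real"
  assumes NF: "filterlim N at_top F"
    and G: "\<forall>\<^sub>F w in F. G w 0 = 0 \<and> (\<forall>j\<in>{1..N w}. 0 \<le> G w j)"
    and bulk: "\<And>\<epsilon>. 0 < \<epsilon> \<Longrightarrow> \<exists>J. \<forall>\<^sub>F w in F. \<forall>j. J \<le> j \<longrightarrow> j + 2 \<le> N w \<longrightarrow>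
      \<bar>G w j / (real (N w))\<^sup>2 - A (real j / real (N w))\<bar> \<le> \<epsilon>"
    and GC: "\<forall>\<^sub>F w in F. \<forall>j\<in>{1..<N w}. G w j \<le> C * (real (N w))\<^sup>2"
    and last: "filterlim (\<lambda>w. G w (N w - 1) / real (N w)) at_top F" "filterlim (\<lambda>w. G w (N w) / real (N w)) at_top F"
    and S: "\<forall>\<^sub>F w in F. chain_solution (N w) (G w) (S w) \<and> (\<forall>j\<in>{1..N w}. S w j 0 = 1)"
    and A: "continuous_on {0..1} A" "\<And>u. u \<in> {0..1} \<Longrightarrow> 0 < A u"
    and C: "0 \<le> C" and L: "0 < L" and T1: "solves_diffusion A T1"
  shows "((\<lambda>w. (\<Sum>j=1..N w. (S w j L - T1 L (real j / real (N w)))\<^sup>2) / real (N w)) \<longlongrightarrow> 0) F"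
proof -
  obtain Tu Gd where
        cTu: "continuous_on ({0<..} \<times> {0..1}) (\<lambda>(z, u). Tu z u)" and
        cGd: "continuous_on ({0<..} \<times> {0..1}) (\<lambda>(z, u). Gd z u)" and
        pde: "\<And>z u. z > 0 \<Longrightarrow> u \<in> {0..1} \<Longrightarrow>
           (T1 z has_real_derivative Tu z u) (at u within {0..1}) \<and>
           ((\<lambda>v. A v * Tu z v) has_real_derivative Gd z u) (at u within {0..1}) \<and>
           ((\<lambda>s. T1 s u) has_real_derivative Gd z u) (at z)" and
        bc: "\<And>z. z > 0 \<Longrightarrow> Tu z 0 = 0 \<and> T1 z 1 = 0" and
        init: "\<And>u. u \<in> {0..1} \<Longrightarrow> T1 0 u = 1"
           "((\<lambda>z. LINT u:{0..1}|lborel. (T1 z u - T1 0 u)\<^sup>2) \<longlongrightarrow> 0) (at_right 0)"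
    using T1 unfolding solves_diffusion_def by auto
  have cT: "continuous_on {0..1} (T1 z)" if "0 < z" for z
    using pde[OF that] by (meson DERIV_continuous continuous_on_eq_continuous_within)
  obtain um where um: "um \<in> {0..1}" "\<And>u. u \<in> {0..1} \<Longrightarrow> A um \<le> A u"
    using continuous_attains_inf[OF compact_Icc _ A(1)] by auto
  obtain uM where uM: "uM \<in> {0..1}" "\<And>u. u \<in> {0..1} \<Longrightarrow> A u \<le> A uM"
    using continuous_attains_sup[OF compact_Icc _ A(1)] by auto
  define am Am where "am = A um" and "Am = A uM"
  have am: "0 < am" using A um by (simp add: am_def)
  have Aam: "\<And>u. u \<in> {0..1} \<Longrightarrow> am \<le> A u \<and> A u \<le> Am" using um uM by (auto simp: am_def Am_def)
  show ?thesis
  proof (rule tendstoI)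
    fix \<kappa> :: real assume \<kappa>: "0 < \<kappa>"
    \<comment> \<open>Of the final error \<open>\<kappa>\<close>, the initial layer takes a quarter through \<open>e1\<close>, and so does the
      bulk error of the comparison through \<open>\<epsilon>\<close> below; the remaining terms are \<open>O(1 / N)\<close> or
      come from the last two edges.\<close>
    define e1 where "e1 = \<kappa> / (64 * exp L)"
    have e1: "0 < e1" using \<kappa> by (simp add: e1_def)
    obtain \<delta>1 where \<delta>1: "\<delta>1 > 0" "\<And>z. 0 \<le> z \<Longrightarrow> z \<le> \<delta>1 \<Longrightarrow>
        \<forall>\<^sub>F w in F. (\<Sum>j=1..N w. (S w j z - 1)\<^sup>2) / real (N w) \<le> e1"
      using chain_initial_layer[OF NF G GC S C e1] by blast
    have "\<forall>\<^sub>F z in at_right 0. (LINT u:{0..1}|lborel. (T1 z u - T1 0 u)\<^sup>2) < e1"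
      using order_tendstoD(2)[OF init(2) e1] .
    then obtain \<delta>2 where \<delta>2: "\<delta>2 > 0" "\<And>z. 0 < z \<Longrightarrow> z < \<delta>2 \<Longrightarrow> (LINT u:{0..1}|lborel. (T1 z u - T1 0 u)\<^sup>2) < e1"
      unfolding eventually_at_right_field by blast
    define z0 where "z0 = min (min \<delta>1 \<delta>2) L / 2"
    have z0: "0 < z0" "z0 \<le> \<delta>1" "z0 < \<delta>2" "z0 < L" using \<delta>1 \<delta>2 L by (auto simp: z0_def)
    have "(LINT u:{0..1}|lborel. (T1 z0 u - 1)\<^sup>2) = (LINT u:{0..1}|lborel. (T1 z0 u - T1 0 u)\<^sup>2)"
      by (intro set_lebesgue_integral_cong) (auto simp: init(1))
    then have "(LINT u:{0..1}|lborel. (T1 z0 u - 1)\<^sup>2) < e1" using \<delta>2(2) z0 by simp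
    moreover have "(\<lambda>n. (\<Sum>j=1..n. (T1 z0 (real j / real n) - 1)\<^sup>2) / real n) \<longlonglongrightarrow> (LINT u:{0..1}|lborel. (T1 z0 u - 1)\<^sup>2)"
      by (intro Riemann_sum_tendsto continuous_intros cT z0)
    ultimately have "\<forall>\<^sub>F n in at_top. (\<Sum>j=1..n. (T1 z0 (real j / real n) - 1)\<^sup>2) / real n < e1"
      using order_tendstoD(2) by blast
    then have I2: "\<forall>\<^sub>F w in F. (\<Sum>j=1..N w. (T1 z0 (real j / real (N w)) - 1)\<^sup>2) / real (N w) < e1"
      using NF by (rule eventually_compose_filterlim)
    have I1: "\<forall>\<^sub>F w in F. (\<Sum>j=1..N w. (S w j z0 - 1)\<^sup>2) / real (N w) \<le> e1"
      using \<delta>1(2) z0 by simp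
    define R where "R = {z0..L} \<times> {0..1::real}"
    have R: "compact R" "R \<noteq> {}" "R \<subseteq> {0<..} \<times> {0..1}"
      using z0 unfolding R_def by (auto intro: compact_Times)
    have cR: "continuous_on R (\<lambda>(z, u). Tu z u)" "continuous_on R (\<lambda>(z, u). Gd z u)"
      using continuous_on_subset[OF cTu R(3)] continuous_on_subset[OF cGd R(3)] by auto
    have "bounded ((\<lambda>(z, u). Tu z u) ` R)" "bounded ((\<lambda>(z, u). Gd z u) ` R)"
      using cR R by (auto intro!: compact_imp_bounded compact_continuous_image)
    then obtain C1 C2 where C12: "\<forall>x\<in>R. \<bar>(\<lambda>(z, u). Tu z u) x\<bar> \<le> C1" "\<forall>x\<in>R. \<bar>(\<lambda>(z, u). Gd z u) x\<bar> \<le> C2"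
      unfolding bounded_iff by auto
    define Cb where "Cb = max C1 C2"
    have Cb: "\<bar>Tu z u\<bar> \<le> Cb \<and> \<bar>Gd z u\<bar> \<le> Cb" if "z \<in> {z0..L}" "u \<in> {0..1}" for z u
    proof -
      have "(z, u) \<in> R" using that by (simp add: R_def)
      then have "\<bar>Tu z u\<bar> \<le> C1" "\<bar>Gd z u\<bar> \<le> C2" using C12 by fastforce+
      then show ?thesis by (auto simp: Cb_def)
    qed
    have Tb: "\<bar>T1 z u\<bar> \<le> Cb" if "z \<in> {z0..L}" "u \<in> {0..1}" for z u
    proof -
      have zp: "0 < z" and u: "0 \<le> u" "u \<le> 1" using that z0 by auto
      obtain x where x: "x \<in> {u..1}" "T1 z 1 - T1 z u = (1 - u) * Tu z x"
        by (rule mvt_within[of u 1 "{0..1}" "T1 z" "Tu z"]) (use pde[OF zp] u in auto)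
      then have "\<bar>T1 z u\<bar> = (1 - u) * \<bar>Tu z x\<bar>"
        using bc[OF zp] that by (metis abs_minus_cancel abs_mult abs_of_nonneg atLeastAtMost_iff diff_0 diff_ge_0_iff_ge)
      also have "\<dots> \<le> 1 * Cb" using that x Cb[OF that(1), of x] by (intro mult_mono) auto
      finally show ?thesis by simp
    qed
    define D0 where "D0 = (Cb + Am)\<^sup>2 / am + 1"
    have D0: "0 < D0" using am by (simp add: D0_def add_nonneg_pos)
    define \<epsilon> where "\<epsilon> = min (am / 2) (min 1 (\<kappa> / (8 * exp L * D0 * L)))"
    have \<epsilon>: "0 < \<epsilon>" "\<epsilon> \<le> am / 2" "\<epsilon> \<le> 1" using am \<kappa> D0 L by (auto simp: \<epsilon>_def)
    have \<epsilon>2: "2 * exp L * (D0 * \<epsilon>\<^sup>2 * L) \<le> \<kappa> / 4"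
    proof -
      have "\<epsilon>\<^sup>2 \<le> \<epsilon>" using \<epsilon> by (simp add: power2_eq_square mult_left_le)
      also have "\<epsilon> \<le> \<kappa> / (8 * exp L * D0 * L)" by (simp add: \<epsilon>_def)
      finally have "\<epsilon>\<^sup>2 * (8 * exp L * D0 * L) \<le> \<kappa>" using D0 L by (simp add: pos_le_divide_eq)
      then show ?thesis by (simp add: mult_ac)
    qed
    have "uniformly_continuous_on R (\<lambda>(z, u). Tu z u)" "uniformly_continuous_on R (\<lambda>(z, u). Gd z u)"
      using cR R by (auto intro: compact_uniformly_continuous)
    then obtain d1 d2 where d1: "d1 > 0" "\<And>x y. x \<in> R \<Longrightarrow> y \<in> R \<Longrightarrow> dist y x < d1 \<Longrightarrow> dist ((\<lambda>(z, u). Tu z u) y) ((\<lambda>(z, u). Tu z u) x) < \<epsilon>"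
       and d2: "d2 > 0" "\<And>x y. x \<in> R \<Longrightarrow> y \<in> R \<Longrightarrow> dist y x < d2 \<Longrightarrow> dist ((\<lambda>(z, u). Gd z u) y) ((\<lambda>(z, u). Gd z u) x) < \<epsilon>"
      unfolding uniformly_continuous_on_def using \<epsilon>(1) by metis
    obtain J0 where J0: "\<forall>\<^sub>F w in F. \<forall>j. J0 \<le> j \<longrightarrow> j + 2 \<le> N w \<longrightarrow>
      \<bar>G w j / (real (N w))\<^sup>2 - A (real j / real (N w))\<bar> \<le> \<epsilon>"
      using bulk[OF \<epsilon>(1)] by blast
    define J where "J = max 1 J0"
    define rest where "rest w = (Cb\<^sup>2 * C + (real (N w) * Am * Cb)\<^sup>2 / G w (N w - 1)
      + (real (N w) * Am * Cb)\<^sup>2 / G w (N w) + real J * ((1 + real J) * Cb)\<^sup>2) / real (N w)" for w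
    define D where "D = real J * (2 * Cb)\<^sup>2"
    have invN: "((\<lambda>w. x / real (N w)) \<longlongrightarrow> 0) F" for x
      by (rule tendsto_divide_0[OF tendsto_const])
         (rule filterlim_compose[OF filterlim_at_top_imp_at_infinity[OF filterlim_real_sequentially] NF])
    have pos: "\<forall>\<^sub>F w in F. max (J + 3) (nat \<lceil>1 / min d1 d2\<rceil> + 1) \<le> N w"
      using filterlim_at_top[THEN iffD1, OF NF] by blast
    have invG: "((\<lambda>w. (real (N w) * Am * Cb)\<^sup>2 / G w (i (N w)) / real (N w)) \<longlongrightarrow> 0) F"
      if "filterlim (\<lambda>w. G w (i (N w)) / real (N w)) at_top F" for i
    proof -
      have "((\<lambda>w. (Am * Cb)\<^sup>2 / (G w (i (N w)) / real (N w))) \<longlongrightarrow> 0) F"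
        by (rule tendsto_divide_0[OF tendsto_const filterlim_at_top_imp_at_infinity[OF that]])
      then show ?thesis
      proof (rule Lim_transform_eventually)
        show "\<forall>\<^sub>F w in F. (Am * Cb)\<^sup>2 / (G w (i (N w)) / real (N w))
            = (real (N w) * Am * Cb)\<^sup>2 / G w (i (N w)) / real (N w)"
          using pos by eventually_elim (simp add: power2_eq_square)
      qed
    qed
    have rest0: "(rest \<longlongrightarrow> 0) F"
    proof -
      have "((\<lambda>w. Cb\<^sup>2 * C / real (N w) + (real (N w) * Am * Cb)\<^sup>2 / G w (N w - 1) / real (N w)
        + (real (N w) * Am * Cb)\<^sup>2 / G w (N w) / real (N w) + real J * ((1 + real J) * Cb)\<^sup>2 / real (N w)) \<longlongrightarrow> 0 + 0 + 0 + 0) F"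
        using invG[of "\<lambda>n. n - 1"] invG[of "\<lambda>n. n"] last by (intro tendsto_add invN) auto
      then show ?thesis unfolding rest_def add_divide_distrib by simp
    qed
    define U where "U w = 2 * exp L * (8 * e1 + 2 * (D / real (N w)) + (D0 * \<epsilon>\<^sup>2 + rest w) * L) + 2 * (D / real (N w))" for w
    have "(U \<longlongrightarrow> 2 * exp L * (8 * e1 + 2 * 0 + (D0 * \<epsilon>\<^sup>2 + 0) * L) + 2 * 0) F"
      unfolding U_def by (intro tendsto_intros invN rest0)
    moreover have "2 * exp L * (8 * e1 + 2 * 0 + (D0 * \<epsilon>\<^sup>2 + 0) * L) + 2 * 0 < \<kappa>"
    proof -
      have "2 * exp L * (8 * e1) = \<kappa> / 4" by (simp add: e1_def)
      then show ?thesis using \<epsilon>2 \<kappa> by (simp add: distrib_left)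
    qed
    ultimately have U: "\<forall>\<^sub>F w in F. U w < \<kappa>" by (rule order_tendstoD(2))
    have lastpos: "\<forall>\<^sub>F w in F. 0 < G w (N w - 1) / real (N w)" "\<forall>\<^sub>F w in F. 0 < G w (N w) / real (N w)"
      using last by (auto simp: filterlim_at_top_dense)
    from pos U lastpos G GC S J0 I1 I2
    show "\<forall>\<^sub>F w in F. dist ((\<Sum>j=1..N w. (S w j L - T1 L (real j / real (N w)))\<^sup>2) / real (N w)) 0 < \<kappa>"
    proof eventually_elim
      case (elim w)
      define n where "n = N w"
      have n: "J + 3 \<le> n" "nat \<lceil>1 / min d1 d2\<rceil> + 1 \<le> n" using elim by (auto simp: n_def)
      then have n0: "0 < real n" by simp
      have "1 / min d1 d2 < real n" using n by linarith
      then have nd: "1 / real n < min d1 d2" using d1 d2 n0 by (auto simp: field_simps min_def split: if_splits)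
      define v where "v j z = T1 z (clamped_node n J j)" for j z
      define t where "t j z = T1 z (real j / real n)" for j z
      define K where "K = real n * (D0 * \<epsilon>\<^sup>2) + real n * rest w"
      have nrest: "real n * rest w = (Cb\<^sup>2 * C + (real n * Am * Cb)\<^sup>2 / G w (n - 1)
          + (real n * Am * Cb)\<^sup>2 / G w n + real J * ((1 + real J) * Cb)\<^sup>2)"
        using n0 by (simp add: rest_def n_def)
      have step: "(\<Sum>j=1..n. (S w j L - v j L)\<^sup>2) \<le> exp (L - z0) * ((\<Sum>j=1..n. (S w j z0 - v j z0)\<^sup>2) + K * (L - z0))"
        unfolding v_def K_def nrest D0_def
      proof (rule chain_comparison_step[where Tu = Tu and Gd = Gd and A = A and G = "G w"])
        show "1 \<le> J" by (simp add: J_def)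
        show "\<bar>G w j / (real n)\<^sup>2 - A (real j / real n)\<bar> \<le> \<epsilon>" if "J \<le> j" "j + 2 \<le> n" for j
          using elim that by (auto simp: n_def J_def)
        show "G w (n - 1) \<le> C * (real n)\<^sup>2" using elim n by (auto simp: n_def)
        show "0 < G w (n - 1)" "0 < G w n" using elim n0 by (auto simp: n_def zero_less_divide_iff)
        show "\<bar>Tu z x - Tu z y\<bar> \<le> \<epsilon> \<and> \<bar>Gd z x - Gd z y\<bar> \<le> \<epsilon>"
          if "z \<in> {z0..L}" "x \<in> {0..1}" "y \<in> {0..1}" "\<bar>x - y\<bar> \<le> 1 / real n" for z x y
        proof -
          have "dist (z, x) (z, y) < min d1 d2" using that nd by (simp add: dist_Pair_Pair dist_real_def)
          then show ?thesis
            using d1(2)[of "(z, y)" "(z, x)"] d2(2)[of "(z, y)" "(z, x)"] that by (auto simp: R_def dist_real_def)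
        qed
      qed (use elim n z0 pde bc Cb \<epsilon> am Aam in \<open>auto simp: n_def\<close>)
      have node: "clamped_node n J j \<in> {0..1}" for j by (simp add: clamped_node_def)
      have vt: "(\<Sum>j=1..n. (v j z - t j z)\<^sup>2) \<le> D" if z: "z \<in> {z0..L}" for z
      proof -
        have "(\<Sum>j=1..n. (v j z - t j z)\<^sup>2) \<le> (\<Sum>j=1..n. if j \<le> J then (2 * Cb)\<^sup>2 else 0)"
        proof (rule sum_mono)
          fix j assume j: "j \<in> {1..n}"
          show "(v j z - t j z)\<^sup>2 \<le> (if j \<le> J then (2 * Cb)\<^sup>2 else 0)"
          proof (cases "j \<le> J")
            case True
            have "real j / real n \<in> {0..1}" using j n0 by auto
            then have "\<bar>v j z - t j z\<bar> \<le> 2 * Cb"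
              using Tb[OF z node] Tb[OF z, of "real j / real n"] unfolding v_def t_def by (smt (verit))
            then have "(v j z - t j z)\<^sup>2 \<le> (2 * Cb)\<^sup>2" by (intro abs_le_square_iff[THEN iffD1]) auto
            then show ?thesis using True by simp
          next
            case False
            then have "clamped_node n J j = real j / real n" using j n0 by (auto simp: clamped_node_def max_def min_def)
            then show ?thesis using False by (simp add: v_def t_def)
          qed
        qed
        also have "\<dots> = (\<Sum>j\<in>{1..n} \<inter> {j. j \<le> J}. (2 * Cb)\<^sup>2)" by (simp add: sum.If_cases)
        also have "{1..n} \<inter> {j. j \<le> J} = {1..J}" using n by auto
        finally show ?thesis by (simp add: D_def)
      qed
      have sq: "(\<Sum>j=1..n. (f j + g j)\<^sup>2) \<le> 2 * (\<Sum>j=1..n. (f j)\<^sup>2) + 2 * (\<Sum>j=1..n. (g j)\<^sup>2)" for f g :: "nat \<Rightarrow> real"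
        unfolding sum_distrib_left sum.distrib[symmetric] by (intro sum_mono square_sum_le)
      have a1: "(\<Sum>j=1..n. (S w j L - t j L)\<^sup>2) \<le> 2 * (\<Sum>j=1..n. (S w j L - v j L)\<^sup>2) + 2 * D"
        using sq[of "\<lambda>j. S w j L - v j L" "\<lambda>j. v j L - t j L"] vt[of L] z0 by simp
      have a2: "(\<Sum>j=1..n. (S w j z0 - v j z0)\<^sup>2) \<le> 2 * (\<Sum>j=1..n. (S w j z0 - t j z0)\<^sup>2) + 2 * D"
        using sq[of "\<lambda>j. S w j z0 - t j z0" "\<lambda>j. t j z0 - v j z0"] vt[of z0] z0 by (simp add: power2_commute[of "t _ _"])
      have a3: "(\<Sum>j=1..n. (S w j z0 - t j z0)\<^sup>2) \<le> 4 * e1 * real n"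
        using sq[of "\<lambda>j. S w j z0 - 1" "\<lambda>j. 1 - t j z0"] elim n0
        by (simp add: n_def[symmetric] t_def divide_le_eq divide_less_eq power2_commute[of 1])
      have rpos: "0 \<le> rest w"
      proof -
        have "0 < G w (n - 1)" "0 < G w n" using elim n0 by (auto simp: n_def zero_less_divide_iff)
        then have "0 \<le> real n * rest w" using C unfolding nrest by (intro add_nonneg_nonneg) auto
        then show ?thesis using n0 by (simp add: zero_le_mult_iff)
      qed
      have K0: "0 \<le> K" using D0 rpos by (simp add: K_def)
      have Dp: "0 \<le> D" by (simp add: D_def)
      have "(\<Sum>j=1..n. (S w j L - v j L)\<^sup>2) \<le> exp L * ((8 * e1 * real n + 2 * D) + K * L)"
        using a2 a3 z0 K0 Dp e1
        by (intro order_trans[OF step] mult_mono add_mono) (auto intro!: add_nonneg_nonneg sum_nonneg)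
      then have "(\<Sum>j=1..n. (S w j L - t j L)\<^sup>2) \<le> 2 * (exp L * ((8 * e1 * real n + 2 * D) + K * L)) + 2 * D"
        using a1 by linarith
      also have "\<dots> = U w * real n" using n0 by (simp add: U_def K_def n_def field_simps)
      finally have "(\<Sum>j=1..n. (S w j L - t j L)\<^sup>2) / real n \<le> U w" using n0 by (simp add: divide_le_eq)
      then have "(\<Sum>j=1..n. (S w j L - t j L)\<^sup>2) / real n < \<kappa>" using elim by simp
      moreover have "0 \<le> (\<Sum>j=1..n. (S w j L - t j L)\<^sup>2) / real n" by (intro divide_nonneg_nonneg sum_nonneg) auto
      ultimately show ?case by (simp add: n_def t_def dist_real_def)
    qed
  qed
qed

text \<open>
  With vanishing coefficient a solution is constant in \<open>z\<close>, hence equal to its initial value \<open>1\<close>: first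
  in mean square and then, by continuity in \<open>u\<close>, also at \<open>u = 1\<close>, where it should be \<open>0\<close>.
\<close>

lemma diffusion_coefficient_nonzero:
  assumes A: "\<And>u. A u = 0" and T1: "solves_diffusion A T1"
  shows False
proof -
  obtain Tu Gd where
        "continuous_on ({0<..} \<times> {0..1}) (\<lambda>(z, u). Tu z u)" and
        "continuous_on ({0<..} \<times> {0..1}) (\<lambda>(z, u). Gd z u)" and
        pde: "\<And>z u. z > 0 \<Longrightarrow> u \<in> {0..1} \<Longrightarrow>
           (T1 z has_real_derivative Tu z u) (at u within {0..1}) \<and>
           ((\<lambda>v. A v * Tu z v) has_real_derivative Gd z u) (at u within {0..1}) \<and>
           ((\<lambda>s. T1 s u) has_real_derivative Gd z u) (at z)" and
        bc: "\<And>z. z > 0 \<Longrightarrow> Tu z 0 = 0 \<and> T1 z 1 = 0" and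
        init: "\<And>u. u \<in> {0..1} \<Longrightarrow> T1 0 u = 1"
           "((\<lambda>z. LINT u:{0..1}|lborel. (T1 z u - T1 0 u)\<^sup>2) \<longlongrightarrow> 0) (at_right 0)"
    using T1 unfolding solves_diffusion_def by auto
  have G0: "Gd z u = 0" if "0 < z" "u \<in> {0..1}" for z u
  proof (rule vector_derivative_unique_within_closed_interval[of 0 1 u "\<lambda>_. 0"])
    have "((\<lambda>v. 0) has_real_derivative Gd z u) (at u within {0..1})" using pde[OF that] by (simp add: A)
    then show "((\<lambda>v. 0) has_vector_derivative Gd z u) (at u within cbox 0 1)"
      by (simp add: has_real_derivative_iff_has_vector_derivative)
  qed (use that in auto)
  have const: "T1 z u = T1 1 u" if "0 < z" "u \<in> {0..1}" for z u
  proof -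
    have "((\<lambda>s. T1 s u) has_real_derivative 0) (at s within {0<..})" if "s \<in> {0<..}" for s
      using pde[of s u] G0[of s u] that \<open>u \<in> {0..1}\<close> by (auto intro: has_field_derivative_at_within)
    then obtain k where "\<And>s. s \<in> {0<..} \<Longrightarrow> T1 s u = k"
      using has_field_derivative_zero_constant[of "{0<..}" "\<lambda>s. T1 s u"] by auto
    then show ?thesis using that by simp
  qed
  have c1: "continuous_on {0..1} (T1 1)"
    using pde[of 1] by (meson DERIV_continuous continuous_on_eq_continuous_within zero_less_one)
  define I where "I = (LINT u:{0..1}|lborel. (T1 1 u - 1)\<^sup>2)"
  have "(LINT u:{0..1}|lborel. (T1 z u - T1 0 u)\<^sup>2) = I" if "0 < z" for z
    unfolding I_def by (intro set_lebesgue_integral_cong) (auto simp: init(1) const[OF that])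
  then have "\<forall>\<^sub>F z in at_right 0. (LINT u:{0..1}|lborel. (T1 z u - T1 0 u)\<^sup>2) = I"
    by (auto simp: eventually_at_right_field intro: exI[of _ 1])
  then have "((\<lambda>z. I) \<longlongrightarrow> 0) (at_right (0::real))" by (rule Lim_transform_eventually[OF init(2)])
  then have "I = 0" by (simp add: tendsto_const_iff)
  moreover have cI: "continuous_on {0..1} (\<lambda>u. (T1 1 u - 1)\<^sup>2)" by (intro continuous_intros c1)
  moreover have "I = integral {0..1} (\<lambda>u. (T1 1 u - 1)\<^sup>2)"
    unfolding I_def by (intro set_borel_integral_eq_integral(2) borel_integrable_atLeastAtMost' cI)
  ultimately have "\<forall>u\<in>{0..1}. (T1 1 u - 1)\<^sup>2 = 0"
    using integral_eq_0_iff[OF cI] by auto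
  then have "T1 1 1 = 1" by simp
  then show False using bc[of 1] by simp
qed

section \<open>Second moments of linear functionals of the medium\<close>

locale medium =
  fixes M :: "'a measure" and V :: "real \<Rightarrow> real \<Rightarrow> 'a \<Rightarrow> real" and d a :: real and g0 :: "real \<Rightarrow> real \<Rightarrow> real"
  assumes medium: "random_medium M V d a g0" and d: "0 < d" and a: "0 < a"
begin

sublocale prob_space M using medium by (simp add: random_medium_def)

abbreviation depth :: "real measure" where "depth \<equiv> restrict_space lborel {0..d}"

lemma depth_finite: "finite_measure depth"
  by (rule finite_measureI) (use d in \<open>simp add: space_restrict_space emeasure_restrict_space\<close>)

sublocale depth: finite_measure depth by (rule depth_finite)
sublocale depth_M: pair_sigma_finite depth M ..
sublocale M_depth: pair_sigma_finite M depth ..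

lemma depth_measure: "measure depth {0..d} = d"
  using d by (simp add: measure_restrict_space)

definition functional :: "(real \<Rightarrow> real) \<Rightarrow> real \<Rightarrow> 'a \<Rightarrow> real" where
  "functional f z \<omega> = (\<integral>x. f x * V x z \<omega> \<partial>depth)"

text \<open>
  This is the covariance form \<open>\<integral>\<integral> f f \<gamma>\<^sub>0\<close> (see \<open>Q_eq_double_integral\<close>). As a second moment it is visibly
  nonnegative, and its continuity properties follow from pathwise limits.
\<close>

definition Q :: "(real \<Rightarrow> real) \<Rightarrow> real" where
  "Q f = (\<integral>\<omega>. (functional f 0 \<omega>)\<^sup>2 \<partial>M)"

lemma integral_depth: "(\<integral>x. f x \<partial>depth) = (LINT x:{0..d}|lborel. f x)" for f :: "real \<Rightarrow> real"
  by (simp add: integral_restrict_space set_lebesgue_integral_def)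

lemma continuous_on_measurable_depth: "continuous_on {0..d} f \<Longrightarrow> f \<in> borel_measurable depth" for f :: "real \<Rightarrow> real"
  using borel_measurable_continuous_on_restrict[of "{0..d}" f]
  by (simp cong: measurable_cong_sets add: sets_restrict_space)

lemma continuous_on_integrable_depth: "continuous_on {0..d} f \<Longrightarrow> integrable depth f" for f :: "real \<Rightarrow> real"
  using borel_integrable_atLeastAtMost'[of 0 d f] by (simp add: integrable_restrict_space set_integrable_def)

lemma V_continuous: "\<omega> \<in> space M \<Longrightarrow> 0 \<le> z \<Longrightarrow> continuous_on {0..d} (\<lambda>x. V x z \<omega>)"
proof -
  assume "\<omega> \<in> space M" "0 \<le> z"
  then have "continuous_on ({0..d} \<times> {0..}) (\<lambda>(x, z). V x z \<omega>)" using medium by (simp add: random_medium_def)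
  then have "continuous_on {0..d} (\<lambda>x. (\<lambda>(x, z). V x z \<omega>) (x, z))"
    by (rule continuous_on_compose2) (use \<open>0 \<le> z\<close> in \<open>auto intro!: continuous_intros\<close>)
  then show ?thesis by simp
qed

lemma V_measurable: "x \<in> {0..d} \<Longrightarrow> 0 \<le> z \<Longrightarrow> V x z \<in> borel_measurable M"
  using medium by (simp add: random_medium_def)

lemma V_square_integrable: "x \<in> {0..d} \<Longrightarrow> 0 \<le> z \<Longrightarrow> integrable M (\<lambda>\<omega>. (V x z \<omega>)\<^sup>2)"
  using medium by (simp add: random_medium_def)

lemma V_covariance: "x \<in> {0..d} \<Longrightarrow> y \<in> {0..d} \<Longrightarrow> 0 \<le> z \<Longrightarrow> 0 \<le> z' \<Longrightarrow>
    (\<integral>\<omega>. V x z \<omega> * V y z' \<omega> \<partial>M) = g0 x y * exp (- a * \<bar>z - z'\<bar>)"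
  using medium by (simp add: random_medium_def)

text \<open>
  \<open>V\<close> is measurable in \<open>\<omega>\<close> at fixed depth and continuous in the depth. It is therefore the pointwise
  limit of its values at grid points, which are jointly measurable.
\<close>

lemma V_jointly_measurable:
  assumes z: "0 \<le> z"
  shows "(\<lambda>(x, \<omega>). V x z \<omega>) \<in> borel_measurable (depth \<Otimes>\<^sub>M M)"
proof -
  \<comment> \<open>The grid point next to \<open>x\<close> may lie outside the ocean, where nothing is known about \<open>V\<close>.\<close>
  define clamp where "clamp x = max 0 (min d x)" for x
  have clamp: "clamp x \<in> {0..d}" for x using d by (simp add: clamp_def)
  define W where "W n p = V (clamp (real_of_int \<lfloor>real (Suc n) * fst p\<rfloor> / real (Suc n))) z (snd p)" for n and p :: "real \<times> 'a"
  have W: "W n \<in> borel_measurable (depth \<Otimes>\<^sub>M M)" for n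
  proof -
    have fst_m: "fst \<in> measurable (depth \<Otimes>\<^sub>M M) borel"
      by (rule measurable_compose[OF measurable_fst]) (simp add: measurable_restrict_space1)
    have "(\<lambda>p. \<lfloor>real (Suc n) * fst p\<rfloor>) \<in> measurable (depth \<Otimes>\<^sub>M M) (count_space UNIV)"
      by (rule measurable_compose[OF fst_m]) measurable
    moreover have "(\<lambda>p. V (clamp (real_of_int i / real (Suc n))) z (snd p)) \<in> borel_measurable (depth \<Otimes>\<^sub>M M)" for i
      by (rule measurable_compose[OF measurable_snd V_measurable[OF clamp z]])
    ultimately show ?thesis unfolding W_def by (rule measurable_compose_countable[rotated])
  qed
  show ?thesis
  proof (rule borel_measurable_LIMSEQ_real[OF _ W])
    fix p assume "p \<in> space (depth \<Otimes>\<^sub>M M)"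
    then obtain x \<omega> where p: "p = (x, \<omega>)" "x \<in> {0..d}" "\<omega> \<in> space M"
      by (auto simp: space_pair_measure space_restrict_space)
    have "(\<lambda>n. real_of_int \<lfloor>real (Suc n) * x\<rfloor> / real (Suc n)) \<longlonglongrightarrow> x"
    proof (rule real_tendsto_sandwich)
      show "(\<lambda>n. x - 1 / real (Suc n)) \<longlonglongrightarrow> x"
        using tendsto_diff[OF tendsto_const LIMSEQ_inverse_real_of_nat, of x] by (simp add: inverse_eq_divide)
      show "\<forall>\<^sub>F n in sequentially. x - 1 / real (Suc n) \<le> real_of_int \<lfloor>real (Suc n) * x\<rfloor> / real (Suc n)"
      proof (rule always_eventually, rule allI)
        fix n
        have "real (Suc n) * x - 1 \<le> real_of_int \<lfloor>real (Suc n) * x\<rfloor>" by linarith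
        then have "(real (Suc n) * x - 1) / real (Suc n) \<le> real_of_int \<lfloor>real (Suc n) * x\<rfloor> / real (Suc n)"
          by (rule divide_right_mono) simp
        then show "x - 1 / real (Suc n) \<le> real_of_int \<lfloor>real (Suc n) * x\<rfloor> / real (Suc n)"
          by (simp add: diff_divide_distrib del: of_nat_Suc)
      qed
      show "\<forall>\<^sub>F n in sequentially. real_of_int \<lfloor>real (Suc n) * x\<rfloor> / real (Suc n) \<le> x"
      proof (rule always_eventually, rule allI)
        fix n
        have "real_of_int \<lfloor>real (Suc n) * x\<rfloor> \<le> x * real (Suc n)" by (metis mult.commute of_int_floor_le)
        then show "real_of_int \<lfloor>real (Suc n) * x\<rfloor> / real (Suc n) \<le> x" by (simp only: pos_divide_le_eq of_nat_0_less_iff zero_less_Suc)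
      qed
    qed auto
    then have "(\<lambda>n. clamp (real_of_int \<lfloor>real (Suc n) * x\<rfloor> / real (Suc n))) \<longlonglongrightarrow> clamp x"
      unfolding clamp_def by (intro tendsto_intros)
    moreover have "clamp x = x" using p by (simp add: clamp_def)
    ultimately have "(\<lambda>n. clamp (real_of_int \<lfloor>real (Suc n) * x\<rfloor> / real (Suc n))) \<longlonglongrightarrow> x" by simp
    then have "(\<lambda>n. V (clamp (real_of_int \<lfloor>real (Suc n) * x\<rfloor> / real (Suc n))) z \<omega>) \<longlonglongrightarrow> V x z \<omega>"
      by (rule continuous_on_tendsto_compose[OF V_continuous[OF p(3) z]]) (use p clamp in auto)
    then show "(\<lambda>n. W n p) \<longlonglongrightarrow> (case p of (x, \<omega>) \<Rightarrow> V x z \<omega>)" by (simp add: p W_def)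
  qed
qed

lemma V_square_jointly_integrable:
  assumes z: "0 \<le> z"
  shows "integrable (depth \<Otimes>\<^sub>M M) (\<lambda>(x, \<omega>). (V x z \<omega>)\<^sup>2)"
proof (rule depth_M.Fubini_integrable)
  show "(\<lambda>(x, \<omega>). (V x z \<omega>)\<^sup>2) \<in> borel_measurable (depth \<Otimes>\<^sub>M M)"
    using borel_measurable_power[OF V_jointly_measurable[OF z], of 2] by (simp add: case_prod_beta')
  have "set_integrable lborel {0..d} (\<lambda>x. g0 x x)" using medium by (simp add: random_medium_def)
  then have "integrable depth (\<lambda>x. g0 x x)" by (simp add: integrable_restrict_space set_integrable_def)
  moreover have "(\<integral>\<omega>. norm (case (x, \<omega>) of (x, \<omega>) \<Rightarrow> (V x z \<omega>)\<^sup>2) \<partial>M) = g0 x x" if "x \<in> space depth" for x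
    using V_covariance[of x x z z] that z by (simp add: power2_eq_square space_restrict_space)
  ultimately show "integrable depth (\<lambda>x. \<integral>\<omega>. norm (case (x, \<omega>) of (x, \<omega>) \<Rightarrow> (V x z \<omega>)\<^sup>2) \<partial>M)"
    using Bochner_Integration.integrable_cong[OF refl, of depth "\<lambda>x. \<integral>\<omega>. norm (case (x, \<omega>) of (x, \<omega>) \<Rightarrow> (V x z \<omega>)\<^sup>2) \<partial>M" "\<lambda>x. g0 x x"]
    by blast
  show "AE x in depth. integrable M (\<lambda>\<omega>. case (x, \<omega>) of (x, \<omega>) \<Rightarrow> (V x z \<omega>)\<^sup>2)"
    using V_square_integrable z by (intro AE_I2) (auto simp: space_restrict_space)
qed

text \<open>
  A multiple of the energy dominates the square of every functional with bounded weight, which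
  serves dominated convergence below.
\<close>

definition energy :: "real \<Rightarrow> 'a \<Rightarrow> real" where
  "energy z \<omega> = (\<integral>x. (V x z \<omega>)\<^sup>2 \<partial>depth)"

lemma energy_integrable: "0 \<le> z \<Longrightarrow> integrable M (energy z)"
  using M_depth.integrable_fst'[OF depth_M.integrable_product_swap[OF V_square_jointly_integrable]]
  by (simp add: energy_def[abs_def] split_beta)

lemma square_integral_le:
  assumes g: "continuous_on {0..d} g"
  shows "(\<integral>x. g x \<partial>depth)\<^sup>2 \<le> d * (\<integral>x. (g x)\<^sup>2 \<partial>depth)"
proof -
  define m where "m = (\<integral>x. g x \<partial>depth)"
  have i: "integrable depth g" "integrable depth (\<lambda>x. (g x)\<^sup>2)"
    using g by (auto intro!: continuous_on_integrable_depth continuous_intros)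
  have "0 \<le> (\<integral>x. (g x - m / d)\<^sup>2 \<partial>depth)" by simp
  also have "\<dots> = (\<integral>x. (g x)\<^sup>2 - 2 * (m / d) * g x + (m / d)\<^sup>2 \<partial>depth)"
    by (intro Bochner_Integration.integral_cong refl) (simp add: power2_diff algebra_simps)
  also have "\<dots> = (\<integral>x. (g x)\<^sup>2 \<partial>depth) - 2 * (m / d) * m + (m / d)\<^sup>2 * d"
    using i by (simp add: m_def depth_measure space_restrict_space)
  also have "\<dots> = (\<integral>x. (g x)\<^sup>2 \<partial>depth) - m\<^sup>2 / d" using d by (simp add: power2_eq_square field_simps)
  finally show ?thesis using d by (simp add: m_def field_simps)
qed

lemma functional_square_le:
  assumes f: "continuous_on {0..d} f" and C: "\<And>x. x \<in> {0..d} \<Longrightarrow> \<bar>f x\<bar> \<le> C"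
    and "0 \<le> z" "\<omega> \<in> space M"
  shows "(functional f z \<omega>)\<^sup>2 \<le> C\<^sup>2 * d * energy z \<omega>"
proof -
  note V = V_continuous[OF assms(4,3)]
  have "(functional f z \<omega>)\<^sup>2 \<le> d * (\<integral>x. (f x * V x z \<omega>)\<^sup>2 \<partial>depth)"
    unfolding functional_def by (intro square_integral_le continuous_intros f V)
  also have "(\<integral>x. (f x * V x z \<omega>)\<^sup>2 \<partial>depth) \<le> (\<integral>x. C\<^sup>2 * (V x z \<omega>)\<^sup>2 \<partial>depth)"
  proof (rule integral_mono)
    fix x assume "x \<in> space depth"
    then have "(f x)\<^sup>2 \<le> C\<^sup>2" using C[of x] by (intro abs_le_square_iff[THEN iffD1]) (auto simp: space_restrict_space)
    then show "(f x * V x z \<omega>)\<^sup>2 \<le> C\<^sup>2 * (V x z \<omega>)\<^sup>2" by (simp add: power_mult_distrib mult_right_mono)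
  qed (auto intro!: continuous_on_integrable_depth continuous_intros f V)
  finally show ?thesis using d by (simp add: energy_def mult_left_mono mult_ac)
qed

lemma functional_measurable:
  assumes f: "continuous_on {0..d} f" and z: "0 \<le> z"
  shows "functional f z \<in> borel_measurable M"
proof -
  have [measurable]: "(\<lambda>(x, \<omega>). V x z \<omega>) \<in> borel_measurable (depth \<Otimes>\<^sub>M M)" by (rule V_jointly_measurable[OF z])
  have [measurable]: "f \<in> borel_measurable depth" by (rule continuous_on_measurable_depth[OF f])
  have "(\<lambda>p. f (fst p) * (case p of (x, \<omega>) \<Rightarrow> V x z \<omega>)) \<in> borel_measurable (depth \<Otimes>\<^sub>M M)" by measurable
  then have "(\<lambda>p. f (snd p) * V (snd p) z (fst p)) \<in> borel_measurable (M \<Otimes>\<^sub>M depth)"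
    using measurable_compose[OF measurable_pair_swap'] by (auto simp: split_beta)
  then have "(\<lambda>\<omega>. \<integral>x. (\<lambda>\<omega> x. f x * V x z \<omega>) \<omega> x \<partial>depth) \<in> borel_measurable M"
    by (intro depth.borel_measurable_lebesgue_integral) (simp add: split_beta')
  then show ?thesis by (simp add: functional_def[abs_def])
qed

lemma bounded_on_depth:
  fixes f :: "real \<Rightarrow> real"
  assumes "continuous_on {0..d} f"
  obtains C where "\<And>x. x \<in> {0..d} \<Longrightarrow> \<bar>f x\<bar> \<le> C"
  using compact_imp_bounded[OF compact_continuous_image[OF assms compact_Icc]] unfolding bounded_iff by (auto simp del: atLeastAtMost_iff)

lemma functional_square_integrable:
  assumes f: "continuous_on {0..d} f" and z: "0 \<le> z"
  shows "integrable M (\<lambda>\<omega>. (functional f z \<omega>)\<^sup>2)"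
proof -
  obtain C where C: "\<And>x. x \<in> {0..d} \<Longrightarrow> \<bar>f x\<bar> \<le> C" using bounded_on_depth[OF f] by blast
  have [measurable]: "functional f z \<in> borel_measurable M" by (rule functional_measurable[OF f z])
  show ?thesis
  proof (rule Bochner_Integration.integrable_bound)
    show "integrable M (\<lambda>\<omega>. C\<^sup>2 * d * energy z \<omega>)" using energy_integrable[OF z] by simp
    show "AE \<omega> in M. norm ((functional f z \<omega>)\<^sup>2) \<le> norm (C\<^sup>2 * d * energy z \<omega>)"
      using functional_square_le[OF f C z] by (intro AE_I2) (fastforce intro: order_trans[OF _ abs_ge_self])
  qed measurable
qed

text \<open>
  Fubini's theorem applies since \<open>2 \<bar>V Y\<bar> \<le> V\<^sup>2 + Y\<^sup>2\<close> and both squares are integrable on the product.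
\<close>

lemma functional_expectation_swap:
  assumes f: "continuous_on {0..d} f" and z: "0 \<le> z"
    and Ym: "Y \<in> borel_measurable M" and Y: "integrable M (\<lambda>\<omega>. (Y \<omega>)\<^sup>2)"
  shows "(\<integral>\<omega>. functional f z \<omega> * Y \<omega> \<partial>M) = (\<integral>x. f x * (\<integral>\<omega>. V x z \<omega> * Y \<omega> \<partial>M) \<partial>depth)"
proof -
  obtain C where C: "\<And>x. x \<in> {0..d} \<Longrightarrow> \<bar>f x\<bar> \<le> C" using bounded_on_depth[OF f] by blast
  have [measurable]: "(\<lambda>(x, \<omega>). V x z \<omega>) \<in> borel_measurable (depth \<Otimes>\<^sub>M M)" by (rule V_jointly_measurable[OF z])
  have [measurable]: "f \<in> borel_measurable depth" by (rule continuous_on_measurable_depth[OF f])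
  note Ym[measurable]
  have int: "integrable (depth \<Otimes>\<^sub>M M) (\<lambda>(x, \<omega>). f x * V x z \<omega> * Y \<omega>)"
  proof (rule Bochner_Integration.integrable_bound)
    have "integrable (depth \<Otimes>\<^sub>M M) (\<lambda>(x, \<omega>). (Y \<omega>)\<^sup>2)"
      by (rule depth_M.Fubini_integrable) (use Y in \<open>auto intro!: depth.integrable_const\<close>)
    then show "integrable (depth \<Otimes>\<^sub>M M) (\<lambda>p. \<bar>C\<bar> * ((\<lambda>(x, \<omega>). (V x z \<omega>)\<^sup>2) p + (\<lambda>(x, \<omega>). (Y \<omega>)\<^sup>2) p))"
      using V_square_jointly_integrable[OF z] by (intro integrable_mult_right Bochner_Integration.integrable_add) auto
    have "(\<lambda>p. f (fst p) * (case p of (x, \<omega>) \<Rightarrow> V x z \<omega>) * Y (snd p)) \<in> borel_measurable (depth \<Otimes>\<^sub>M M)" by measurable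
    then show "(\<lambda>(x, \<omega>). f x * V x z \<omega> * Y \<omega>) \<in> borel_measurable (depth \<Otimes>\<^sub>M M)" by (simp add: split_beta')
    show "AE p in depth \<Otimes>\<^sub>M M. norm (case p of (x, \<omega>) \<Rightarrow> f x * V x z \<omega> * Y \<omega>) \<le>
        norm (\<bar>C\<bar> * ((\<lambda>(x, \<omega>). (V x z \<omega>)\<^sup>2) p + (\<lambda>(x, \<omega>). (Y \<omega>)\<^sup>2) p))"
    proof (rule AE_I2)
      fix p assume "p \<in> space (depth \<Otimes>\<^sub>M M)"
      then obtain x \<omega> where p: "p = (x, \<omega>)" and x: "0 \<le> x" "x \<le> d"
        by (auto simp: space_pair_measure space_restrict_space)
      have "0 \<le> (\<bar>V x z \<omega>\<bar> - \<bar>Y \<omega>\<bar>)\<^sup>2" by simp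
      then have "2 * (\<bar>V x z \<omega>\<bar> * \<bar>Y \<omega>\<bar>) \<le> (V x z \<omega>)\<^sup>2 + (Y \<omega>)\<^sup>2" by (simp add: power2_diff)
      moreover have "0 \<le> \<bar>V x z \<omega>\<bar> * \<bar>Y \<omega>\<bar>" by simp
      ultimately have "\<bar>V x z \<omega>\<bar> * \<bar>Y \<omega>\<bar> \<le> \<bar>(V x z \<omega>)\<^sup>2 + (Y \<omega>)\<^sup>2\<bar>" by linarith
      moreover have "\<bar>f x\<bar> \<le> \<bar>C\<bar>" using C[of x] x by auto
      ultimately have "\<bar>f x\<bar> * (\<bar>V x z \<omega>\<bar> * \<bar>Y \<omega>\<bar>) \<le> \<bar>C\<bar> * \<bar>(V x z \<omega>)\<^sup>2 + (Y \<omega>)\<^sup>2\<bar>"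
        by (intro mult_mono) auto
      then show "norm (case p of (x, \<omega>) \<Rightarrow> f x * V x z \<omega> * Y \<omega>) \<le>
          norm (\<bar>C\<bar> * ((\<lambda>(x, \<omega>). (V x z \<omega>)\<^sup>2) p + (\<lambda>(x, \<omega>). (Y \<omega>)\<^sup>2) p))"
        by (simp add: p abs_mult mult.assoc)
    qed
  qed
  have "(\<integral>\<omega>. functional f z \<omega> * Y \<omega> \<partial>M) = (\<integral>\<omega>. (\<integral>x. f x * V x z \<omega> * Y \<omega> \<partial>depth) \<partial>M)"
    by (simp add: functional_def)
  also have "\<dots> = (\<integral>x. (\<integral>\<omega>. f x * V x z \<omega> * Y \<omega> \<partial>M) \<partial>depth)"
    by (rule depth_M.Fubini_integral[OF int])
  also have "\<dots> = (\<integral>x. f x * (\<integral>\<omega>. V x z \<omega> * Y \<omega> \<partial>M) \<partial>depth)" by (simp add: mult.assoc)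
  finally show ?thesis .
qed

lemma functional_covariance:
  assumes f: "continuous_on {0..d} f" and g: "continuous_on {0..d} g" and z: "0 \<le> z"
  shows "(\<integral>\<omega>. functional f 0 \<omega> * functional g z \<omega> \<partial>M)
    = exp (- a * z) * (\<integral>x. f x * (\<integral>y. g y * g0 x y \<partial>depth) \<partial>depth)"
proof -
  have "(\<integral>\<omega>. functional f 0 \<omega> * functional g z \<omega> \<partial>M) = (\<integral>x. f x * (\<integral>\<omega>. V x 0 \<omega> * functional g z \<omega> \<partial>M) \<partial>depth)"
    by (intro functional_expectation_swap f functional_measurable functional_square_integrable g z) auto
  also have "\<dots> = (\<integral>x. exp (- a * z) * (f x * (\<integral>y. g y * g0 x y \<partial>depth)) \<partial>depth)"
  proof (rule Bochner_Integration.integral_cong[OF refl])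
    fix x assume "x \<in> space depth"
    then have x: "x \<in> {0..d}" by (simp add: space_restrict_space)
    have "(\<integral>\<omega>. functional g z \<omega> * V x 0 \<omega> \<partial>M) = (\<integral>y. g y * (\<integral>\<omega>. V y z \<omega> * V x 0 \<omega> \<partial>M) \<partial>depth)"
      by (intro functional_expectation_swap g z V_measurable V_square_integrable x) auto
    also have "\<dots> = (\<integral>y. exp (- a * z) * (g y * g0 x y) \<partial>depth)"
    proof (rule Bochner_Integration.integral_cong[OF refl])
      fix y assume "y \<in> space depth"
      then have "(\<integral>\<omega>. V x 0 \<omega> * V y z \<omega> \<partial>M) = g0 x y * exp (- a * z)"
        using V_covariance[of x y 0 z] x z by (simp add: space_restrict_space)
      then show "g y * (\<integral>\<omega>. V y z \<omega> * V x 0 \<omega> \<partial>M) = exp (- a * z) * (g y * g0 x y)" by (simp add: mult_ac)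
    qed
    also have "\<dots> = exp (- a * z) * (\<integral>y. g y * g0 x y \<partial>depth)" by simp
    finally show "f x * (\<integral>\<omega>. V x 0 \<omega> * functional g z \<omega> \<partial>M) = exp (- a * z) * (f x * (\<integral>y. g y * g0 x y \<partial>depth))"
      by (simp add: mult_ac)
  qed
  also have "\<dots> = exp (- a * z) * (\<integral>x. f x * (\<integral>y. g y * g0 x y \<partial>depth) \<partial>depth)" by simp
  finally show ?thesis .
qed

lemma Q_eq_double_integral:
  assumes "continuous_on {0..d} f"
  shows "Q f = (\<integral>x. f x * (\<integral>y. f y * g0 x y \<partial>depth) \<partial>depth)"
  using functional_covariance[OF assms assms, of 0] by (simp add: Q_def power2_eq_square)

lemma S0_eq_Q: "S0 d g0 = Q (\<lambda>x. cos (pi / d * x))"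
proof -
  have "continuous_on {0..d} (\<lambda>x. cos (pi / d * x))" by (intro continuous_intros)
  from Q_eq_double_integral[OF this] show ?thesis
    unfolding S0_def integral_depth[symmetric] by (simp add: mult_ac flip: integral_mult_right_zero)
qed

lemma Q_nonneg: "0 \<le> Q f"
  by (simp add: Q_def)

lemma Q_scale: "Q (\<lambda>x. c * f x) = c\<^sup>2 * Q f"
  by (simp add: Q_def functional_def mult.assoc power_mult_distrib)

lemma Q_cong: "(\<And>x. x \<in> {0..d} \<Longrightarrow> f x = g x) \<Longrightarrow> Q f = Q g"
  unfolding Q_def functional_def
  by (intro Bochner_Integration.integral_cong arg_cong[where f = "\<lambda>x. x\<^sup>2"]) (auto simp: space_restrict_space)

definition Q_bound :: real where "Q_bound = d * (\<integral>\<omega>. energy 0 \<omega> \<partial>M)"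

lemma Q_bound_nonneg: "0 \<le> Q_bound"
  using d by (simp add: Q_bound_def energy_def)

lemma Q_le:
  assumes f: "continuous_on {0..d} f" and C: "\<And>x. x \<in> {0..d} \<Longrightarrow> \<bar>f x\<bar> \<le> C"
  shows "Q f \<le> C\<^sup>2 * Q_bound"
proof -
  have "Q f \<le> (\<integral>\<omega>. C\<^sup>2 * d * energy 0 \<omega> \<partial>M)"
    unfolding Q_def using functional_square_le[OF f C] functional_square_integrable[OF f] energy_integrable
    by (intro integral_mono) auto
  then show ?thesis by (simp add: Q_bound_def mult_ac)
qed

lemma Q_tendsto:
  assumes f: "\<And>n. continuous_on {0..d} (f n)" and g: "continuous_on {0..d} g"
    and C: "\<And>n x. x \<in> {0..d} \<Longrightarrow> \<bar>f n x\<bar> \<le> C"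
    and lim: "\<And>\<omega>. \<omega> \<in> space M \<Longrightarrow> (\<lambda>n. functional (f n) 0 \<omega>) \<longlonglongrightarrow> functional g 0 \<omega>"
  shows "(\<lambda>n. Q (f n)) \<longlonglongrightarrow> Q g"
  unfolding Q_def
proof (rule integral_dominated_convergence)
  show "integrable M (\<lambda>\<omega>. C\<^sup>2 * d * energy 0 \<omega>)" using energy_integrable by simp
  show "AE \<omega> in M. (\<lambda>n. (functional (f n) 0 \<omega>)\<^sup>2) \<longlonglongrightarrow> (functional g 0 \<omega>)\<^sup>2"
    using lim by (intro AE_I2 tendsto_intros) auto
  show "AE \<omega> in M. norm ((functional (f n) 0 \<omega>)\<^sup>2) \<le> C\<^sup>2 * d * energy 0 \<omega>" for n
    using functional_square_le[OF f C] by (intro AE_I2) auto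
qed (use functional_measurable[OF f] functional_measurable[OF g] in auto)

lemma functional_tendsto:
  assumes f: "\<And>n. continuous_on {0..d} (f n)"
    and C: "\<And>n x. x \<in> {0..d} \<Longrightarrow> \<bar>f n x\<bar> \<le> C"
    and lim: "\<And>x. x \<in> {0..d} \<Longrightarrow> (\<lambda>n. f n x) \<longlonglongrightarrow> g x" and g: "continuous_on {0..d} g"
    and \<omega>: "\<omega> \<in> space M"
  shows "(\<lambda>n. functional (f n) 0 \<omega>) \<longlonglongrightarrow> functional g 0 \<omega>"
  unfolding functional_def
proof (rule integral_dominated_convergence)
  note V = V_continuous[OF \<omega> order_refl]
  show "integrable depth (\<lambda>x. C * \<bar>V x 0 \<omega>\<bar>)"
    by (intro continuous_on_integrable_depth continuous_intros V)
  show "AE x in depth. (\<lambda>n. f n x * V x 0 \<omega>) \<longlonglongrightarrow> g x * V x 0 \<omega>"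
    using lim by (intro AE_I2 tendsto_intros) (auto simp: space_restrict_space)
  show "AE x in depth. norm (f n x * V x 0 \<omega>) \<le> C * \<bar>V x 0 \<omega>\<bar>" for n
    using C by (intro AE_I2) (auto simp: space_restrict_space abs_mult intro!: mult_right_mono)
qed (auto intro!: continuous_on_measurable_depth continuous_intros f g V_continuous \<omega>)

lemma functional_diff:
  assumes "continuous_on {0..d} f" "continuous_on {0..d} g" "\<omega> \<in> space M"
  shows "functional (\<lambda>x. f x - g x) 0 \<omega> = functional f 0 \<omega> - functional g 0 \<omega>"
  unfolding functional_def left_diff_distrib using assms
  by (intro Bochner_Integration.integral_diff continuous_on_integrable_depth continuous_intros V_continuous) auto

text \<open>
  For every realization the rapidly oscillating part disappears by the Riemann-Lebesgue lemma,
  as \<open>V\<close> is continuous in the depth.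
\<close>

lemma Q_cos_diff_tendsto_S0:
  assumes p: "p \<longlonglongrightarrow> pi / d" and q: "filterlim q at_top sequentially"
  shows "(\<lambda>n. Q (\<lambda>x. cos (p n * x) - cos (q n * x))) \<longlonglongrightarrow> S0 d g0"
  unfolding S0_eq_Q
proof (rule Q_tendsto)
  fix \<omega> assume \<omega>: "\<omega> \<in> space M"
  have "(\<lambda>n. functional (\<lambda>x. cos (p n * x)) 0 \<omega>) \<longlonglongrightarrow> functional (\<lambda>x. cos (pi / d * x)) 0 \<omega>"
    using p \<omega> by (intro functional_tendsto[where C = 1]) (use d in \<open>auto intro!: continuous_intros tendsto_cos tendsto_mult_right simp del: times_divide_eq_left\<close>)
  moreover have "(\<lambda>n. functional (\<lambda>x. cos (q n * x)) 0 \<omega>) \<longlonglongrightarrow> 0"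
    using filterlim_compose[OF Riemann_Lebesgue_cos[OF V_continuous[OF \<omega> order_refl] d] q]
    by (simp add: functional_def integral_depth)
  ultimately have "(\<lambda>n. functional (\<lambda>x. cos (p n * x)) 0 \<omega> - functional (\<lambda>x. cos (q n * x)) 0 \<omega>)
      \<longlonglongrightarrow> functional (\<lambda>x. cos (pi / d * x)) 0 \<omega> - 0" by (rule tendsto_diff)
  then show "(\<lambda>n. functional (\<lambda>x. cos (p n * x) - cos (q n * x)) 0 \<omega>) \<longlonglongrightarrow> functional (\<lambda>x. cos (pi / d * x)) 0 \<omega>"
    using \<omega> d by (subst functional_diff) (auto intro!: continuous_intros)
next
  fix n x
  show "\<bar>cos (p n * x) - cos (q n * x)\<bar> \<le> 2"
    using abs_cos_le_one[of "p n * x"] abs_cos_le_one[of "q n * x"] by linarith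
qed (use d in \<open>auto intro!: continuous_intros\<close>)

text \<open>
  The same limit as an estimate uniform in the two frequencies. It is needed for whole windows
  of radiating modes.
\<close>

lemma Q_cos_diff_near_S0:
  assumes e: "0 < e"
  shows "\<exists>\<delta>>0. \<exists>B. \<forall>p q. \<bar>p - pi / d\<bar> < \<delta> \<longrightarrow> B < q \<longrightarrow> \<bar>Q (\<lambda>x. cos (p * x) - cos (q * x)) - S0 d g0\<bar> < e"
proof (rule ccontr)
  assume neg: "\<not> ?thesis"
  have "\<exists>p q. \<bar>p - pi / d\<bar> < inverse (real (Suc n)) \<and> real n < q \<and> \<not> \<bar>Q (\<lambda>x. cos (p * x) - cos (q * x)) - S0 d g0\<bar> < e" for n
  proof -
    have "0 < inverse (real (Suc n))" by simp
    then show ?thesis using neg by blast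
  qed
  then obtain p q where pq: "\<And>n. \<bar>p n - pi / d\<bar> < inverse (real (Suc n))" "\<And>n. real n < q n"
      "\<And>n. \<not> \<bar>Q (\<lambda>x. cos (p n * x) - cos (q n * x)) - S0 d g0\<bar> < e" by metis
  have "(\<lambda>n. p n - pi / d) \<longlonglongrightarrow> 0"
    using pq(1) by (intro Lim_null_comparison[OF _ LIMSEQ_inverse_real_of_nat]) (auto intro!: always_eventually less_imp_le)
  then have "p \<longlonglongrightarrow> pi / d" by (simp add: LIM_zero_iff)
  moreover have "filterlim q at_top sequentially"
    using pq(2) by (intro filterlim_at_top_mono[OF filterlim_real_sequentially]) (auto intro!: always_eventually less_imp_le)
  ultimately have "(\<lambda>n. Q (\<lambda>x. cos (p n * x) - cos (q n * x))) \<longlonglongrightarrow> S0 d g0" by (rule Q_cos_diff_tendsto_S0)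
  then have "\<forall>\<^sub>F n in sequentially. \<bar>Q (\<lambda>x. cos (p n * x) - cos (q n * x)) - S0 d g0\<bar> < e"
    using tendstoD[OF _ e] by (force simp: dist_real_def)
  then show False using pq(3) by (auto simp: eventually_sequentially)
qed

lemma Q_cos_diff_filterlim:
  assumes p: "(p \<longlongrightarrow> pi / d) F" and q: "filterlim q at_top F"
  shows "((\<lambda>w. Q (\<lambda>x. cos (p w * x) - cos (q w * x))) \<longlongrightarrow> S0 d g0) F"
proof (rule tendstoI)
  fix e :: real assume "0 < e"
  then obtain \<delta> B where \<delta>: "0 < \<delta>" and near: "\<And>p q. \<bar>p - pi / d\<bar> < \<delta> \<Longrightarrow> B < q \<Longrightarrow> \<bar>Q (\<lambda>x. cos (p * x) - cos (q * x)) - S0 d g0\<bar> < e"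
    using Q_cos_diff_near_S0 by blast
  from tendstoD[OF p \<delta>] filterlim_at_top_dense[THEN iffD1, OF q, rule_format, of B]
  show "\<forall>\<^sub>F w in F. dist (Q (\<lambda>x. cos (p w * x) - cos (q w * x))) (S0 d g0) < e"
    by eventually_elim (auto simp: dist_real_def intro: near)
qed

lemma Q_cos_diff_continuous:
  "continuous_on UNIV (\<lambda>(p, q). Q (\<lambda>x. cos (p * x) - cos (q * x)))"
  unfolding continuous_on_sequentially
proof (intro allI ballI impI)
  fix X :: "nat \<Rightarrow> real \<times> real" and y :: "real \<times> real"
  assume "y \<in> UNIV" "(\<forall>n. X n \<in> UNIV) \<and> X \<longlonglongrightarrow> y"
  then have pq: "(\<lambda>n. fst (X n)) \<longlonglongrightarrow> fst y" "(\<lambda>n. snd (X n)) \<longlonglongrightarrow> snd y" by (auto intro: tendsto_fst tendsto_snd)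
  have b: "\<bar>cos (p * x) - cos (q * x)\<bar> \<le> 2" for p q x :: real
    using abs_cos_le_one[of "p * x"] abs_cos_le_one[of "q * x"] by linarith
  have "(\<lambda>n. Q (\<lambda>x. cos (fst (X n) * x) - cos (snd (X n) * x))) \<longlonglongrightarrow> Q (\<lambda>x. cos (fst y * x) - cos (snd y * x))"
  proof (rule Q_tendsto)
    fix \<omega> assume "\<omega> \<in> space M"
    then show "(\<lambda>n. functional (\<lambda>x. cos (fst (X n) * x) - cos (snd (X n) * x)) 0 \<omega>)
        \<longlonglongrightarrow> functional (\<lambda>x. cos (fst y * x) - cos (snd y * x)) 0 \<omega>"
      by (intro functional_tendsto[where C = 2] b tendsto_intros pq continuous_intros)
  qed (auto intro!: continuous_intros b)
  then show "((\<lambda>(p, q). Q (\<lambda>x. cos (p * x) - cos (q * x))) \<circ> X) \<longlonglongrightarrow> (case y of (p, q) \<Rightarrow> Q (\<lambda>x. cos (p * x) - cos (q * x)))"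
    by (simp add: comp_def case_prod_beta)
qed

lemma coupling_process_eq: "coupling_process V d f g z \<omega> = functional (\<lambda>x. f x * g x) z \<omega>"
  by (simp add: coupling_process_def functional_def integral_depth)

text \<open>
  The covariance of the coupling process is \<open>exp (- a z) Q\<close>, whose cosine transform is a Lorentzian.
\<close>

lemma coupling_spectrum:
  assumes fg: "continuous_on {0..d} (\<lambda>x. f x * g x)"
  shows "(LINT z:{0..}|lborel. (\<integral>\<omega>. coupling_process V d f g 0 \<omega> * coupling_process V d f g z \<omega> \<partial>M) * cos (b * z))
    = Q (\<lambda>x. f x * g x) * (a / (a\<^sup>2 + b\<^sup>2))"
proof -
  have "(LINT z:{0..}|lborel. (\<integral>\<omega>. coupling_process V d f g 0 \<omega> * coupling_process V d f g z \<omega> \<partial>M) * cos (b * z))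
    = (LINT z:{0..}|lborel. Q (\<lambda>x. f x * g x) * (exp (- a * z) * cos (b * z)))"
    using functional_covariance[OF fg fg] Q_eq_double_integral[OF fg]
    by (intro set_lebesgue_integral_cong) (auto simp: coupling_process_eq)
  then show ?thesis using Laplace_transform_cos[OF a, of b] by simp
qed

end

section \<open>The dispersion relation\<close>

text \<open>
  With \<open>\<alpha> = arcsin (y / B)\<close> one has \<open>sqrt (B\<^sup>2 - y\<^sup>2) = B cos \<alpha>\<close>, so the right-hand side is \<open>- tan \<alpha>\<close> and the
  equation becomes \<open>sin (y + \<alpha>) = 0\<close>.
\<close>

lemma tan_dispersion_iff:
  fixes y B :: real
  assumes y: "0 < y" "y < B"
  shows "tan y = - y / sqrt (B\<^sup>2 - y\<^sup>2) \<longleftrightarrow> (\<exists>i\<ge>1. y + arcsin (y / B) = real i * pi)"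
proof -
  define \<alpha> where "\<alpha> = arcsin (y / B)"
  have yB: "0 < y / B" "y / B < 1" using y by auto
  have s: "sin \<alpha> = y / B" using yB by (simp add: \<alpha>_def)
  have \<alpha>: "0 < \<alpha>" "\<alpha> < pi / 2" using yB arcsin_less_arcsin[of 0 "y / B"] arcsin_less_arcsin[of "y / B" 1]
    by (auto simp: \<alpha>_def)
  have c: "0 < cos \<alpha>" using \<alpha> by (intro cos_gt_zero) auto
  have "cos \<alpha> = sqrt (1 - (y / B)\<^sup>2)" using yB by (simp add: \<alpha>_def cos_arcsin)
  also have "1 - (y / B)\<^sup>2 = (B\<^sup>2 - y\<^sup>2) / B\<^sup>2" using y by (simp add: power_divide diff_divide_distrib)
  also have "sqrt ((B\<^sup>2 - y\<^sup>2) / B\<^sup>2) = sqrt (B\<^sup>2 - y\<^sup>2) / B" using y by (simp add: real_sqrt_divide)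
  finally have "sqrt (B\<^sup>2 - y\<^sup>2) = B * cos \<alpha>" using y by simp
  then have rhs: "- y / sqrt (B\<^sup>2 - y\<^sup>2) = - (sin \<alpha> / cos \<alpha>)" using y s by simp
  have "tan y = - (sin \<alpha> / cos \<alpha>) \<longleftrightarrow> sin (y + \<alpha>) = 0"
  proof
    assume L: "tan y = - (sin \<alpha> / cos \<alpha>)"
    moreover have "0 < sin \<alpha> / cos \<alpha>" using s yB c by (intro divide_pos_pos) auto
    ultimately have "tan y < 0" by linarith
    then have "cos y \<noteq> 0" by (auto simp: tan_def)
    then have "sin y * cos \<alpha> = - sin \<alpha> * cos y" using L c by (simp add: tan_def field_simps)
    then show "sin (y + \<alpha>) = 0" by (simp add: sin_add)
  next
    assume R: "sin (y + \<alpha>) = 0"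
    have "cos y \<noteq> 0"
    proof
      assume "cos y = 0"
      then have "sin y = 0" using R c by (simp add: sin_add)
      then show False using \<open>cos y = 0\<close> sin_cos_squared_add[of y] by simp
    qed
    then show "tan y = - (sin \<alpha> / cos \<alpha>)" using R c by (simp add: tan_def sin_add field_simps)
  qed
  also have "\<dots> \<longleftrightarrow> (\<exists>i::int. y + \<alpha> = of_int i * pi)" by (simp add: sin_zero_iff_int2)
  also have "\<dots> \<longleftrightarrow> (\<exists>i\<ge>1. y + \<alpha> = real i * pi)"
  proof
    assume "\<exists>i::int. y + \<alpha> = of_int i * pi"
    then obtain i :: int where i: "y + \<alpha> = of_int i * pi" by blast
    have "0 < of_int i * pi" using i y \<alpha> by linarith
    then have "0 < i" by (simp add: zero_less_mult_iff)
    then have "1 \<le> nat i" "real (nat i) = of_int i" by auto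
    then show "\<exists>i\<ge>1. y + \<alpha> = real i * pi" using i by metis
  next
    assume "\<exists>i\<ge>1. y + \<alpha> = real i * pi"
    then show "\<exists>i::int. y + \<alpha> = of_int i * pi" by (metis of_int_of_nat_eq)
  qed
  finally show ?thesis unfolding rhs \<alpha>_def .
qed

lemma dispersion_strict_mono:
  fixes x y B :: real
  assumes "0 \<le> x" "x < y" "y \<le> B"
  shows "x + arcsin (x / B) < y + arcsin (y / B)"
proof -
  have "arcsin (x / B) \<le> arcsin (y / B)"
    using assms by (intro arcsin_le_arcsin) (auto simp: divide_right_mono order_trans[of "-1" 0])
  then show ?thesis using assms by simp
qed

lemma dispersion_root_exists:
  fixes B t :: real
  assumes "0 < B" "0 < t" "t < B + pi / 2"
  obtains y where "0 < y" "y < B" "y + arcsin (y / B) = t"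
proof -
  have "\<exists>y\<ge>0. y \<le> B \<and> y + arcsin (y / B) = t"
  proof (rule IVT')
    show "continuous_on {0..B} (\<lambda>y. y + arcsin (y / B))"
      using assms by (intro continuous_intros) (auto intro: order_trans[of "-1" 0])
  qed (use assms in auto)
  then obtain y where y: "0 \<le> y" "y \<le> B" "y + arcsin (y / B) = t" by auto
  moreover have "y \<noteq> 0" "y \<noteq> B" using y assms by auto
  ultimately show ?thesis using that[of y] by simp
qed

lemma sorted_list_of_strict_image:
  fixes f :: "nat \<Rightarrow> real"
  assumes "strict_mono_on {1..n} f"
  shows "sorted_list_of_set (f ` {1..n}) = map f [1..<Suc n]"
proof (rule strict_sorted_equal)
  show "sorted_wrt (<) (map f [1..<Suc n])"
    unfolding sorted_wrt_map
    by (rule sorted_wrt_mono_rel[OF _ sorted_wrt_upt]) (use assms in \<open>auto simp: strict_mono_on_def\<close>)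
qed auto

section \<open>Asymptotics of the propagating modes\<close>

locale waveguide =
  fixes d n1 c :: real
  assumes depth_pos: "0 < d" and index_gt_1: "1 < n1" and speed_pos: "0 < c"
begin

abbreviation "\<theta> \<equiv> index_theta n1"
abbreviation "B \<equiv> mode_bound d n1 c"
abbreviation "N \<equiv> num_modes d n1 c"
abbreviation "\<sigma> \<equiv> mode_sigma d n1 c"
abbreviation "\<zeta> \<equiv> mode_zeta d n1 c"
abbreviation "\<beta> \<equiv> mode_beta d n1 c"
abbreviation "amp \<equiv> mode_amp d n1 c"

text \<open>
  The position of mode \<open>j\<close> in the continuum limit, uniformly close to \<open>j / N\<close>.
\<close>

definition u :: "real \<Rightarrow> nat \<Rightarrow> real" where "u w j = \<sigma> w j / B w"

lemma theta_square: "\<theta>\<^sup>2 = 1 - 1 / n1\<^sup>2"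
  using index_gt_1 by (simp add: index_theta_def)

lemma theta: "0 < \<theta>" "\<theta> < 1"
proof -
  have "0 < 1 - 1 / n1\<^sup>2" using index_gt_1 by simp
  then show "0 < \<theta>" by (simp add: index_theta_def)
  have "\<theta>\<^sup>2 < 1\<^sup>2" using index_gt_1 unfolding theta_square by simp
  then show "\<theta> < 1" by (rule power2_less_imp_less) simp
qed

lemma B_eq: "B w = n1 * d * \<theta> / c * w"
  by (simp add: mode_bound_def wavenumber_def)

lemma B_pos: "0 < w \<Longrightarrow> 0 < B w"
  using theta depth_pos index_gt_1 speed_pos by (simp add: B_eq)

lemma B_at_top: "filterlim B at_top at_top"
proof -
  have "0 < n1 * d * \<theta> / c" using theta depth_pos index_gt_1 speed_pos by simp
  then show ?thesis unfolding B_eq[abs_def]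
    by (intro filterlim_tendsto_pos_mult_at_top[OF tendsto_const] filterlim_ident)
qed

text \<open>
  The function \<open>y + arcsin (y / B)\<close> increases from \<open>0\<close> to \<open>B + \<pi> / 2\<close> on \<open>[0, B]\<close>, so it takes each value
  \<open>j \<pi>\<close> below \<open>B + \<pi> / 2\<close> exactly once. This counts and orders the roots.
\<close>

lemma mode_structure:
  assumes w: "0 < w"
  shows "real (N w) * pi < B w + pi / 2" "B w + pi / 2 \<le> (real (N w) + 1) * pi"
    and "\<And>j. j \<in> {1..N w} \<Longrightarrow> 0 < \<sigma> w j \<and> \<sigma> w j < B w \<and> \<sigma> w j + arcsin (u w j) = real j * pi"
proof -
  define b where "b = B w"
  have b: "0 < b" using B_pos[OF w] by (simp add: b_def)
  define n where "n = nat (\<lceil>b / pi + 1 / 2\<rceil> - 1)"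
  have "0 \<le> \<lceil>b / pi + 1 / 2\<rceil> - 1"
    using b by (simp add: one_le_ceiling add_pos_pos)
  then have "real n = of_int \<lceil>b / pi + 1 / 2\<rceil> - 1" by (simp add: n_def)
  then have "real n < b / pi + 1 / 2" "b / pi + 1 / 2 \<le> real n + 1"
    using ceiling_correct[of "b / pi + 1 / 2"] by auto
  then have "real n * pi < (b / pi + 1 / 2) * pi" "(b / pi + 1 / 2) * pi \<le> (real n + 1) * pi"
    by (auto intro: mult_strict_right_mono mult_right_mono)
  moreover have "(b / pi + 1 / 2) * pi = b + pi / 2" by (simp add: distrib_right)
  ultimately have n: "real n * pi < b + pi / 2" "b + pi / 2 \<le> (real n + 1) * pi" by auto
  have "\<exists>y. 0 < y \<and> y < b \<and> y + arcsin (y / b) = real j * pi" if j: "j \<in> {1..n}" for j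
  proof -
    have "real j * pi \<le> real n * pi" using j by (intro mult_right_mono) auto
    then have "real j * pi < b + pi / 2" using n(1) by linarith
    moreover have "0 < real j * pi" using j by simp
    ultimately show ?thesis using dispersion_root_exists[OF b] by metis
  qed
  then obtain s where s: "\<And>j. j \<in> {1..n} \<Longrightarrow> 0 < s j \<and> s j < b \<and> s j + arcsin (s j / b) = real j * pi" by metis
  have mono: "strict_mono_on {1..n} s"
  proof (rule strict_mono_onI)
    fix i j assume ij: "i \<in> {1..n}" "j \<in> {1..n}" "i < j"
    show "s i < s j"
    proof (rule ccontr)
      assume "\<not> s i < s j"
      then have "s j + arcsin (s j / b) \<le> s i + arcsin (s i / b)"
        using dispersion_strict_mono[of "s j" "s i" b] s[OF ij(1)] s[OF ij(2)] by (cases "s j = s i") auto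
      then have "real j * pi \<le> real i * pi" using s ij by simp
      then show False using ij by simp
    qed
  qed
  have roots: "mode_roots d n1 c w = s ` {1..n}"
  proof (intro set_eqI iffI)
    fix y assume "y \<in> mode_roots d n1 c w"
    then have y: "0 < y" "y < b" "tan y = - y / sqrt (b\<^sup>2 - y\<^sup>2)" by (auto simp: mode_roots_def b_def)
    then obtain i where i: "1 \<le> i" "y + arcsin (y / b) = real i * pi" using tan_dispersion_iff[of y b] by auto
    have "y + arcsin (y / b) < b + arcsin (b / b)" using y by (intro dispersion_strict_mono) auto
    moreover have "arcsin (b / b) = pi / 2" using b by simp
    ultimately have "real i * pi < (real n + 1) * pi" using i n by linarith
    then have "real i < real n + 1" by (rule mult_right_less_imp_less) simp
    then have i': "i \<in> {1..n}" using i by auto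
    have "s i = y"
    proof (rule ccontr)
      assume "s i \<noteq> y"
      then have "s i + arcsin (s i / b) \<noteq> y + arcsin (y / b)"
        using dispersion_strict_mono[of "s i" y b] dispersion_strict_mono[of y "s i" b] s[OF i'] y by linarith
      then show False using s[OF i'] i by simp
    qed
    then show "y \<in> s ` {1..n}" using i' by blast
  next
    fix y assume "y \<in> s ` {1..n}"
    then obtain i where i: "i \<in> {1..n}" "y = s i" by blast
    then show "y \<in> mode_roots d n1 c w"
      using s[OF i(1)] tan_dispersion_iff[of y b] by (auto simp: mode_roots_def b_def)
  qed
  have "inj_on s {1..n}" using mono by (rule strict_mono_on_imp_inj_on)
  then have N: "N w = n" by (simp add: num_modes_def roots card_image)
  show "real (N w) * pi < B w + pi / 2" "B w + pi / 2 \<le> (real (N w) + 1) * pi" using n by (simp_all add: N b_def)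
  fix j assume j: "j \<in> {1..N w}"
  have "\<sigma> w j = map s [1..<Suc n] ! (j - 1)"
    by (simp only: mode_sigma_def roots sorted_list_of_strict_image[OF mono])
  also have "\<dots> = s j" using j N by (subst nth_map) (auto simp del: upt_Suc)
  finally show "0 < \<sigma> w j \<and> \<sigma> w j < B w \<and> \<sigma> w j + arcsin (u w j) = real j * pi"
    using s[of j] j N by (simp add: b_def u_def)
qed

lemma N_B_bounds:
  assumes "0 < w"
  shows "\<bar>real (N w) * pi - B w\<bar> \<le> pi / 2"
  using mode_structure(1,2)[OF assms] unfolding distrib_right abs_le_iff by linarith

lemma u_bounds:
  assumes "0 < w" "j \<in> {1..N w}"
  shows "0 < u w j" "u w j < 1" "0 < arcsin (u w j)" "arcsin (u w j) < pi / 2"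
proof -
  show 1: "0 < u w j" "u w j < 1" using mode_structure(3)[OF assms] by (auto simp: u_def)
  show "0 < arcsin (u w j)" "arcsin (u w j) < pi / 2"
    using 1 arcsin_less_arcsin[of 0 "u w j"] arcsin_less_arcsin[of "u w j" 1] by auto
qed

lemma sigma_bounds:
  assumes "0 < w" "j \<in> {1..N w}"
  shows "real j * pi - pi / 2 < \<sigma> w j" "\<sigma> w j < real j * pi" "0 < \<sigma> w j" "\<sigma> w j < B w"
  using mode_structure(3)[OF assms] u_bounds[OF assms] by auto

lemma u_eq_approx:
  assumes w: "0 < w" and j: "j \<in> {1..N w}"
  shows "\<bar>u w j - real j / real (N w)\<bar> \<le> pi / B w"
proof -
  define n where "n = real (N w)"
  have n: "0 < n" "real j \<le> n" using j by (auto simp: n_def)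
  note b = B_pos[OF w]
  have "u w j - real j / n = (\<sigma> w j - real j * pi) / B w + real j / n * ((n * pi - B w) / B w)"
    using n b by (simp add: u_def field_simps)
  also have "\<bar>\<dots>\<bar> \<le> \<bar>(\<sigma> w j - real j * pi) / B w\<bar> + \<bar>real j / n * ((n * pi - B w) / B w)\<bar>" by (rule abs_triangle_ineq)
  also have "\<dots> \<le> (pi / 2) / B w + 1 * ((pi / 2) / B w)"
  proof (rule add_mono)
    show "\<bar>(\<sigma> w j - real j * pi) / B w\<bar> \<le> (pi / 2) / B w"
      unfolding abs_divide abs_of_pos[OF b] using sigma_bounds[OF w j] b by (intro divide_right_mono) auto
    show "\<bar>real j / n * ((n * pi - B w) / B w)\<bar> \<le> 1 * ((pi / 2) / B w)"
      unfolding abs_mult abs_divide abs_of_pos[OF b] using N_B_bounds[OF w] b n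
      by (intro mult_mono divide_right_mono) (auto simp: n_def)
  qed
  also have "\<dots> = pi / B w" by simp
  finally show ?thesis by (simp add: n_def)
qed

lemma zeta_square:
  assumes "0 < w" "j \<in> {1..N w}"
  shows "(\<zeta> w j)\<^sup>2 = (B w)\<^sup>2 - (\<sigma> w j)\<^sup>2" "0 < \<zeta> w j"
proof -
  have "(\<sigma> w j)\<^sup>2 < (B w)\<^sup>2" using sigma_bounds[OF assms] by (intro power_strict_mono) auto
  then show "(\<zeta> w j)\<^sup>2 = (B w)\<^sup>2 - (\<sigma> w j)\<^sup>2" "0 < \<zeta> w j" by (auto simp: mode_zeta_def)
qed

text \<open>
  As \<open>\<sigma>\<^sub>j = j \<pi> - \<alpha>\<close> with \<open>sin \<alpha> = \<sigma>\<^sub>j / B\<close> and \<open>cos \<alpha> = \<zeta>\<^sub>j / B\<close>, the two sine terms of the normalization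
  are rational in \<open>\<sigma>\<^sub>j\<close> and \<open>\<zeta>\<^sub>j\<close>, and add up to \<open>1 / \<zeta>\<^sub>j\<close>.
\<close>

lemma amp_square:
  assumes w: "0 < w" and j: "j \<in> {1..N w}"
  shows "(amp w j)\<^sup>2 = 2 / d * (\<zeta> w j / (\<zeta> w j + 1))"
proof -
  define s z b \<alpha> where "s = \<sigma> w j" and "z = \<zeta> w j" and "b = B w" and "\<alpha> = arcsin (u w j)"
  have b: "0 < b" using B_pos[OF w] by (simp add: b_def)
  have z: "0 < z" "z\<^sup>2 = b\<^sup>2 - s\<^sup>2" using zeta_square[OF w j] by (auto simp: z_def b_def s_def)
  have s: "0 < s" "s = real j * pi - \<alpha>" using mode_structure(3)[OF w j] by (auto simp: s_def \<alpha>_def)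
  have sin\<alpha>: "sin \<alpha> = s / b" using u_bounds[OF w j] by (simp add: \<alpha>_def u_def s_def b_def)
  have cos\<alpha>: "cos \<alpha> = z / b"
  proof -
    have "cos \<alpha> = sqrt (1 - (s / b)\<^sup>2)" using u_bounds[OF w j] by (simp add: \<alpha>_def cos_arcsin u_def s_def b_def)
    also have "1 - (s / b)\<^sup>2 = (z / b)\<^sup>2" using b z by (simp add: power_divide diff_divide_distrib)
    finally show ?thesis using z b by simp
  qed
  have "sin s * sin s = (sin \<alpha>)\<^sup>2"
    using sin_npi[of j] sin_cos_squared_add[of "real j * pi"]
    by (simp add: s sin_diff power2_eq_square algebra_simps)
  then have 1: "(sin s)\<^sup>2 = (s / b)\<^sup>2" by (simp add: sin\<alpha> power2_eq_square)
  have "sin (2 * s) = sin (- (2 * \<alpha>) + 2 * real j * pi)" by (simp add: s algebra_simps)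
  also have "\<dots> = sin (- (2 * \<alpha>)) * cos (2 * real j * pi) + cos (- (2 * \<alpha>)) * sin (2 * real j * pi)" by (rule sin_add)
  also have "\<dots> = - sin (2 * \<alpha>)"
    using cos_npi[of "2 * j"] sin_npi[of "2 * j"] by simp
  also have "\<dots> = - 2 * (s / b) * (z / b)" by (simp add: sin_double sin\<alpha> cos\<alpha>)
  finally have 2: "sin (2 * s) = - 2 * (s / b) * (z / b)" .
  have "1 + (sin s)\<^sup>2 / z - sin (2 * s) / (2 * s) = 1 + (s\<^sup>2 + z\<^sup>2) / (b\<^sup>2 * z)"
    using s(1) z(1) b unfolding 1 2 by (simp add: power_divide field_simps power2_eq_square)
  also have "s\<^sup>2 + z\<^sup>2 = b\<^sup>2" using z by simp
  also have "1 + b\<^sup>2 / (b\<^sup>2 * z) = 1 + 1 / z" using b by simp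
  finally have 3: "1 + (sin s)\<^sup>2 / z - sin (2 * s) / (2 * s) = (z + 1) / z" using z by (simp add: field_simps)
  have "amp w j = sqrt (2 / d / ((z + 1) / z))"
    unfolding 3[symmetric] by (simp add: mode_amp_def s_def z_def)
  then have "(amp w j)\<^sup>2 = 2 / d / ((z + 1) / z)" using z depth_pos by simp
  then show ?thesis using z by (simp add: z_def)
qed

lemma amp_square_bounds:
  assumes "0 < w" "j \<in> {1..N w}"
  shows "0 < (amp w j)\<^sup>2" "(amp w j)\<^sup>2 \<le> 2 / d"
proof -
  have z: "0 < \<zeta> w j" using zeta_square[OF assms] by auto
  show "0 < (amp w j)\<^sup>2" unfolding amp_square[OF assms] using z depth_pos by (intro mult_pos_pos divide_pos_pos) auto
  have "\<zeta> w j / (\<zeta> w j + 1) \<le> 1" using z by simp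
  then have "2 / d * (\<zeta> w j / (\<zeta> w j + 1)) \<le> 2 / d * 1" using depth_pos by (intro mult_left_mono) auto
  then show "(amp w j)\<^sup>2 \<le> 2 / d" unfolding amp_square[OF assms] by simp
qed

lemma sigma_gap:
  assumes w: "0 < w" and j: "1 \<le> j" "j < N w"
  shows "\<sigma> w (Suc j) - \<sigma> w j = pi - (arcsin (u w (Suc j)) - arcsin (u w j))"
    "pi / 2 < \<sigma> w (Suc j) - \<sigma> w j" "\<sigma> w (Suc j) - \<sigma> w j < pi"
proof -
  have m: "j \<in> {1..N w}" "Suc j \<in> {1..N w}" using j by auto
  show 1: "\<sigma> w (Suc j) - \<sigma> w j = pi - (arcsin (u w (Suc j)) - arcsin (u w j))"
    using mode_structure(3)[OF w m(1)] mode_structure(3)[OF w m(2)] by (simp add: distrib_right)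
  show 2: "pi / 2 < \<sigma> w (Suc j) - \<sigma> w j"
    using u_bounds[OF w m(1)] u_bounds[OF w m(2)] unfolding 1 by linarith
  then have "\<sigma> w j < \<sigma> w (Suc j)" using pi_gt_zero by linarith
  then have "u w j < u w (Suc j)" using B_pos[OF w] by (simp add: u_def divide_strict_right_mono)
  then have "arcsin (u w j) < arcsin (u w (Suc j))"
    using u_bounds[OF w m(1)] u_bounds[OF w m(2)] by (intro arcsin_less_arcsin) auto
  then show "\<sigma> w (Suc j) - \<sigma> w j < pi" unfolding 1 by simp
qed

lemma sigma_mono:
  assumes w: "0 < w" and "1 \<le> i" "i \<le> j" "j \<le> N w"
  shows "\<sigma> w i \<le> \<sigma> w j"
  using assms(3,4)
proof (induction j rule: dec_induct)
  case (step k)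
  have "pi / 2 < \<sigma> w (Suc k) - \<sigma> w k" by (rule sigma_gap(2)[OF w]) (use step assms(2) in auto)
  moreover have "\<sigma> w i \<le> \<sigma> w k" using step by simp
  ultimately show ?case using pi_gt_zero by linarith
qed simp

text \<open>
  The last root is below \<open>B\<close>, and the roots are at least \<open>\<pi> / 2\<close> apart, so only the last one can come
  close to \<open>B\<close>. With \<open>amp_square\<close>, all normalizations but the last tend to \<open>2 / d\<close>.
\<close>

lemma zeta_bulk:
  assumes w: "0 < w" and j: "1 \<le> j" "j < N w"
  shows "pi / 2 * (B w - pi) \<le> (\<zeta> w j)\<^sup>2"
proof -
  define n where "n = N w - 1"
  have n: "1 \<le> n" "n < N w" "j \<le> n" "Suc n = N w" using j by (auto simp: n_def)
  have "pi / 2 * (B w - pi) \<le> (\<sigma> w (Suc n) - \<sigma> w n) * (\<sigma> w (Suc n) + \<sigma> w n)"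
  proof (cases "B w - pi \<le> 0")
    case True
    have "0 \<le> (\<sigma> w (Suc n) - \<sigma> w n) * (\<sigma> w (Suc n) + \<sigma> w n)"
      using sigma_gap(2)[OF w n(1,2)] sigma_bounds[OF w, of n] sigma_bounds[OF w, of "Suc n"] n pi_gt_zero
      by (intro mult_nonneg_nonneg) auto
    moreover have "pi / 2 * (B w - pi) \<le> 0" using True by (intro mult_nonneg_nonpos) auto
    ultimately show ?thesis by linarith
  next
    case False
    have "B w - pi \<le> \<sigma> w (Suc n)"
      using sigma_bounds(1)[OF w, of "Suc n"] mode_structure(2)[OF w] n by (simp add: distrib_right)
    also have "\<dots> \<le> \<sigma> w (Suc n) + \<sigma> w n" using sigma_bounds[OF w, of n] n by simp
    finally have 1: "B w - pi \<le> \<sigma> w (Suc n) + \<sigma> w n" .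
    have "0 \<le> \<sigma> w (Suc n) - \<sigma> w n" using sigma_gap(2)[OF w n(1,2)] pi_gt_zero by linarith
    then show ?thesis using 1 False sigma_gap(2)[OF w n(1,2)] by (intro mult_mono) auto
  qed
  also have "\<dots> = (\<sigma> w (Suc n))\<^sup>2 - (\<sigma> w n)\<^sup>2" by (simp add: power2_eq_square algebra_simps)
  also have "\<dots> \<le> (B w)\<^sup>2 - (\<sigma> w j)\<^sup>2"
    using sigma_bounds[OF w, of "Suc n"] sigma_bounds[OF w, of j] sigma_mono[OF w j(1) n(3)] n j
    by (intro diff_mono power_mono) auto
  also have "\<dots> = (\<zeta> w j)\<^sup>2" using zeta_square[OF w, of j] j by simp
  finally show ?thesis .
qed

text \<open>
  The cosine of the angle between the wave vector of mode \<open>j\<close> and the range axis: \<open>\<beta>\<^sub>j = n\<^sub>1 k propagation_cos\<close>.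
\<close>

definition propagation_cos :: "real \<Rightarrow> nat \<Rightarrow> real" where
  "propagation_cos w j = sqrt (1 - \<theta>\<^sup>2 * (u w j)\<^sup>2)"

lemma wavenumber_eq: "wavenumber c w = B w / (n1 * d * \<theta>)"
  using theta depth_pos index_gt_1 by (simp add: mode_bound_def)

lemma propagation_cos_bounds:
  assumes "0 < w" "j \<in> {1..N w}"
  shows "1 / n1 \<le> propagation_cos w j" "propagation_cos w j \<le> 1"
proof -
  have "\<theta>\<^sup>2 * (u w j)\<^sup>2 \<le> \<theta>\<^sup>2 * 1\<^sup>2"
    using u_bounds[OF assms] by (intro mult_left_mono power_mono) auto
  then have "(1 / n1)\<^sup>2 \<le> 1 - \<theta>\<^sup>2 * (u w j)\<^sup>2" unfolding theta_square by (simp add: power_divide)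
  then show "1 / n1 \<le> propagation_cos w j" unfolding propagation_cos_def by (rule real_le_rsqrt)
  show "propagation_cos w j \<le> 1" by (simp add: propagation_cos_def)
qed

lemma beta_eq:
  assumes w: "0 < w" and j: "j \<in> {1..N w}"
  shows "\<beta> w j = B w / (d * \<theta>) * propagation_cos w j"
proof -
  have b: "0 < B w" by (rule B_pos[OF w])
  have "n1\<^sup>2 * (wavenumber c w)\<^sup>2 - (\<sigma> w j)\<^sup>2 / d\<^sup>2 = (B w / (d * \<theta>))\<^sup>2 * (1 - \<theta>\<^sup>2 * (u w j)\<^sup>2)"
    using theta depth_pos index_gt_1 b by (simp add: wavenumber_eq u_def power_mult_distrib power_divide field_simps)
  then show ?thesis
    using theta depth_pos b by (simp add: mode_beta_def propagation_cos_def real_sqrt_mult)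
qed

text \<open>
  Rationalizing the difference of square roots exhibits the gap \<open>\<sigma>\<^sub>l - \<sigma>\<^sub>j\<close>, whose limit is known,
  in front of factors that depend on the positions only.
\<close>

lemma beta_diff:
  assumes w: "0 < w" and j: "j \<in> {1..N w}" "l \<in> {1..N w}"
  shows "\<beta> w j - \<beta> w l = (\<sigma> w l - \<sigma> w j) * (u w l + u w j) * \<theta> / (d * (propagation_cos w l + propagation_cos w j))"
proof -
  define s t where "s = propagation_cos w j" and "t = propagation_cos w l"
  have st: "0 < s" "0 < t" using propagation_cos_bounds[OF w j(1)] propagation_cos_bounds[OF w j(2)] index_gt_1
    by (auto simp: s_def t_def intro: less_le_trans[of 0 "1 / n1"])
  have sq: "(propagation_cos w i)\<^sup>2 = 1 - \<theta>\<^sup>2 * (u w i)\<^sup>2" if "i \<in> {1..N w}" for i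
  proof -
    have "0 < propagation_cos w i" using propagation_cos_bounds(1)[OF w that] index_gt_1 by (auto intro: less_le_trans[of 0 "1 / n1"])
    then show ?thesis unfolding propagation_cos_def by simp
  qed
  have "s\<^sup>2 - t\<^sup>2 = \<theta>\<^sup>2 * ((u w l - u w j) * (u w l + u w j))"
    using sq[OF j(1)] sq[OF j(2)] by (simp add: s_def t_def power2_eq_square algebra_simps)
  then have "(s - t) * (t + s) = \<theta>\<^sup>2 * ((u w l - u w j) * (u w l + u w j))" by (simp add: power2_eq_square algebra_simps)
  then have "s - t = \<theta>\<^sup>2 * ((u w l - u w j) * (u w l + u w j)) / (t + s)" using st by (simp add: field_simps)
  then have "B w / (d * \<theta>) * (s - t) = B w / (d * \<theta>) * (\<theta>\<^sup>2 * ((u w l - u w j) * (u w l + u w j)) / (t + s))" by simp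
  also have "\<dots> = (B w * (u w l - u w j)) * (u w l + u w j) * \<theta> / (d * (t + s))"
    using theta depth_pos st by (simp add: power2_eq_square)
  also have "B w * (u w l - u w j) = \<sigma> w l - \<sigma> w j" using B_pos[OF w] by (simp add: u_def algebra_simps)
  finally have "B w / (d * \<theta>) * (s - t) = (\<sigma> w l - \<sigma> w j) * (u w l + u w j) * \<theta> / (d * (t + s))" .
  moreover have "\<beta> w j - \<beta> w l = B w / (d * \<theta>) * (s - t)"
    by (simp only: beta_eq[OF w j(1)] beta_eq[OF w j(2)] s_def t_def right_diff_distrib)
  ultimately show ?thesis by (simp only: s_def t_def)
qed

end

section \<open>Coupling between neighbouring modes\<close>

locale ocean = waveguide d n1 c + medium M V d a g0
  for d n1 c a :: real and M :: "'a measure" and V :: "real \<Rightarrow> real \<Rightarrow> 'a \<Rightarrow> real" and g0 :: "real \<Rightarrow> real \<Rightarrow> real"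
begin

abbreviation "\<Gamma> \<equiv> Gamma_c M V d n1 c"
abbreviation "\<Lambda> \<equiv> Lambda_c M V d n1 c"

text \<open>
  The covariance form at twice the product of the sines \<open>sin (s x / d)\<close> and \<open>sin (t x / d)\<close>.
\<close>

definition Qc :: "real \<Rightarrow> real \<Rightarrow> real" where
  "Qc s t = Q (\<lambda>x. cos ((t - s) / d * x) - cos ((t + s) / d * x))"

lemma sin_times_sin_eq: "sin (s * x / d) * sin (t * x / d) = 1 / 2 * (cos ((t - s) / d * x) - cos ((t + s) / d * x))"
proof -
  have "sin (t * x / d) * sin (s * x / d) = (cos (t * x / d - s * x / d) - cos (t * x / d + s * x / d)) / 2"
    by (rule sin_times_sin)
  moreover have "t * x / d - s * x / d = (t - s) / d * x" "t * x / d + s * x / d = (t + s) / d * x"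
    by (simp_all add: diff_divide_distrib add_divide_distrib algebra_simps)
  ultimately show ?thesis by (simp add: mult.commute)
qed

lemma Qc_bounds: "0 \<le> Qc s t" "Qc s t \<le> 4 * Q_bound"
proof -
  show "0 \<le> Qc s t" by (simp add: Qc_def Q_nonneg)
  have "Qc s t \<le> 2\<^sup>2 * Q_bound" unfolding Qc_def
  proof (rule Q_le)
    fix x
    show "\<bar>cos ((t - s) / d * x) - cos ((t + s) / d * x)\<bar> \<le> 2"
      using abs_cos_le_one[of "(t - s) / d * x"] abs_cos_le_one[of "(t + s) / d * x"] by linarith
  qed (use d in \<open>auto intro!: continuous_intros\<close>)
  then show "Qc s t \<le> 4 * Q_bound" by simp
qed

lemma Qc_commute: "Qc s t = Qc t s"
proof -
  have "cos ((t - s) / d * x) = cos ((s - t) / d * x)" for x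
  proof -
    have "(t - s) / d * x = - ((s - t) / d * x)" by (simp add: diff_divide_distrib algebra_simps)
    then show ?thesis by (simp only: cos_minus)
  qed
  then show ?thesis by (simp add: Qc_def add.commute)
qed

text \<open>
  Propagating and radiating modes are both multiples of sines in the ocean section, so this one
  computation evaluates \<open>\<Gamma>\<close> and \<open>\<Lambda>\<close>.
\<close>

lemma mode_products_spectrum:
  assumes f: "\<And>x. x \<in> {0..d} \<Longrightarrow> f x = A * sin (s * x / d)" and g: "\<And>x. x \<in> {0..d} \<Longrightarrow> g x = A' * sin (t * x / d)"
  shows "(LINT z:{0..}|lborel. (\<integral>\<omega>. coupling_process V d f g 0 \<omega> * coupling_process V d f g z \<omega> \<partial>M) * cos (b * z))
    = A\<^sup>2 * A'\<^sup>2 / 4 * Qc s t * (a / (a\<^sup>2 + b\<^sup>2))"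
proof -
  have fg: "f x * g x = (A * A' / 2) * (cos ((t - s) / d * x) - cos ((t + s) / d * x))" if "x \<in> {0..d}" for x
    using sin_times_sin_eq[of s x t] by (simp add: f[OF that] g[OF that] mult_ac)
  have "continuous_on {0..d} (\<lambda>x. (A * A' / 2) * (cos ((t - s) / d * x) - cos ((t + s) / d * x)))"
    using d by (intro continuous_intros) auto
  then have "continuous_on {0..d} (\<lambda>x. f x * g x)"
    by (subst continuous_on_cong[OF refl fg]) auto
  moreover have "Q (\<lambda>x. f x * g x) = (A * A' / 2)\<^sup>2 * Qc s t"
    unfolding Qc_def Q_scale[symmetric] by (rule Q_cong) (rule fg)
  ultimately show ?thesis by (simp only: coupling_spectrum power_mult_distrib power_divide) simp
qed

lemma Gamma_eq:
  "\<Gamma> w j l = (wavenumber c w) ^ 4 / (2 * \<beta> w j * \<beta> w l) *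
    ((amp w j)\<^sup>2 * (amp w l)\<^sup>2 / 4 * Qc (\<sigma> w j) (\<sigma> w l) * (a / (a\<^sup>2 + (\<beta> w l - \<beta> w j)\<^sup>2)))"
  unfolding Gamma_c_def
  by (subst mode_products_spectrum[where A = "amp w j" and A' = "amp w l" and s = "\<sigma> w j" and t = "\<sigma> w l"])
     (auto simp: mode_phi_def)

lemma Gamma_commute: "\<Gamma> w j l = \<Gamma> w l j"
  unfolding Gamma_eq by (simp add: Qc_commute[of "\<sigma> w j"] power2_commute[of "\<beta> w j"] mult_ac)

text \<open>
  The difference \<open>\<beta>\<^sub>j - \<beta>\<^sub>j\<^sub>+\<^sub>1\<close> in the form given by \<open>beta_diff\<close>.
\<close>

definition gap :: "real \<Rightarrow> nat \<Rightarrow> real" where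
  "gap w j = (\<sigma> w (Suc j) - \<sigma> w j) * (u w (Suc j) + u w j) * \<theta> / (d * (propagation_cos w (Suc j) + propagation_cos w j))"

text \<open>
  What remains of \<open>\<Gamma> / N\<^sup>2\<close> once the normalizations \<open>A\<^sub>j\<^sup>2 A\<^sub>j\<^sub>+\<^sub>1\<^sup>2\<close> are split off. Along the last
  edge, where \<open>A\<^sub>N\<^sup>2\<close> may tend to \<open>0\<close>, it still has the limit of the bulk.
\<close>

definition bulk_rate :: "real \<Rightarrow> nat \<Rightarrow> real" where
  "bulk_rate w j = 1 / (8 * n1 ^ 4 * d\<^sup>2 * \<theta>\<^sup>2) * (B w / real (N w))\<^sup>2 * (1 / propagation_cos w j * (1 / propagation_cos w (Suc j)))
     * Qc (\<sigma> w j) (\<sigma> w (Suc j)) * (a / (a\<^sup>2 + (gap w j)\<^sup>2))"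

lemma propagation_cos_pos: "0 < w \<Longrightarrow> j \<in> {1..N w} \<Longrightarrow> 0 < propagation_cos w j"
  using propagation_cos_bounds(1)[of w j] index_gt_1 by (auto intro: less_le_trans[of 0 "1 / n1"])

lemma Gamma_next_eq:
  assumes w: "0 < w" and j: "1 \<le> j" "j < N w"
  shows "\<Gamma> w (Suc j) j / (real (N w))\<^sup>2 = (amp w j)\<^sup>2 * (amp w (Suc j))\<^sup>2 * bulk_rate w j"
proof -
  have jm: "j \<in> {1..N w}" "Suc j \<in> {1..N w}" using j by auto
  have n: "0 < real (N w)" using j by simp
  have k: "(wavenumber c w) ^ 4 / (2 * \<beta> w (Suc j) * \<beta> w j)
     = 4 * (1 / (8 * n1 ^ 4 * d\<^sup>2 * \<theta>\<^sup>2) * (B w)\<^sup>2 * (1 / propagation_cos w j * (1 / propagation_cos w (Suc j))))"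
    unfolding wavenumber_eq beta_eq[OF w jm(1)] beta_eq[OF w jm(2)]
    using theta depth_pos index_gt_1 B_pos[OF w] propagation_cos_pos[OF w jm(1)] propagation_cos_pos[OF w jm(2)]
    by (simp add: power_divide power_mult_distrib field_simps power2_eq_square power4_eq_xxxx)
  have "\<Gamma> w (Suc j) j = 4 * (1 / (8 * n1 ^ 4 * d\<^sup>2 * \<theta>\<^sup>2) * (B w)\<^sup>2 * (1 / propagation_cos w j * (1 / propagation_cos w (Suc j)))) *
    ((amp w (Suc j))\<^sup>2 * (amp w j)\<^sup>2 / 4 * Qc (\<sigma> w j) (\<sigma> w (Suc j)) * (a / (a\<^sup>2 + (gap w j)\<^sup>2)))"
    unfolding Gamma_eq k beta_diff[OF w jm] gap_def Qc_commute[of "\<sigma> w (Suc j)"] ..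
  moreover have "4 * (x1 * (B w)\<^sup>2 * x2) * (x3 * x4 / 4 * x5 * x6) / (real (N w))\<^sup>2 = x4 * x3 * (x1 * (B w / real (N w))\<^sup>2 * x2 * x5 * x6)"
    for x1 x2 x3 x4 x5 x6 :: real
    by (simp add: power_divide)
  ultimately show ?thesis unfolding bulk_rate_def by (simp only:)
qed

lemma B_le_N: assumes "0 < w" "1 \<le> N w" shows "B w / real (N w) \<le> 2 * pi"
proof -
  have "1 * pi \<le> real (N w) * pi" using assms(2) by (intro mult_right_mono) auto
  then have "B w \<le> 2 * pi * real (N w)"
    using mode_structure(2)[OF assms(1)] pi_gt_zero by (simp only: distrib_right mult_1_left mult.assoc mult.commute[of pi])
  then show ?thesis using assms by (simp add: divide_le_eq)
qed

lemma Lorentzian_bounds: "0 \<le> a / (a\<^sup>2 + x\<^sup>2)" "a / (a\<^sup>2 + x\<^sup>2) \<le> 1 / a"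
proof -
  have "a / (a\<^sup>2 + x\<^sup>2) \<le> a / (a * a)"
    using a by (intro divide_left_mono mult_pos_pos) (auto simp: add_pos_nonneg power2_eq_square)
  then show "a / (a\<^sup>2 + x\<^sup>2) \<le> 1 / a" using a by simp
qed (use a in auto)

definition "bulk_rate_bound = 1 / (8 * n1 ^ 4 * d\<^sup>2 * \<theta>\<^sup>2) * (2 * pi)\<^sup>2 * (n1 * n1) * (4 * Q_bound) * (1 / a)"

lemma bulk_rate_bounds:
  assumes w: "0 < w" and j: "1 \<le> j" "j < N w"
  shows "0 \<le> bulk_rate w j" "bulk_rate w j \<le> bulk_rate_bound"
proof -
  have jm: "j \<in> {1..N w}" "Suc j \<in> {1..N w}" using j by auto
  note tp = propagation_cos_pos[OF w jm(1)] propagation_cos_pos[OF w jm(2)]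
  have t: "1 / propagation_cos w j \<le> n1" "1 / propagation_cos w (Suc j) \<le> n1"
    using propagation_cos_bounds(1)[OF w jm(1)] propagation_cos_bounds(1)[OF w jm(2)] tp index_gt_1
    by (simp_all add: field_simps)
  have BN: "0 \<le> B w / real (N w)" "B w / real (N w) \<le> 2 * pi"
    using B_pos[OF w] B_le_N[OF w] j by auto
  have cpos: "0 \<le> 1 / (8 * n1 ^ 4 * d\<^sup>2 * \<theta>\<^sup>2)" using index_gt_1 by simp
  have p: "0 \<le> 1 / propagation_cos w j" "0 \<le> 1 / propagation_cos w (Suc j)" "0 \<le> n1" using tp index_gt_1 by auto
  show "0 \<le> bulk_rate w j"
    unfolding bulk_rate_def by (intro mult_nonneg_nonneg cpos zero_le_power2 p Qc_bounds Lorentzian_bounds)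
  have Qb: "0 \<le> 4 * Q_bound" using Q_bound_nonneg by simp
  show "bulk_rate w j \<le> bulk_rate_bound"
    unfolding bulk_rate_def bulk_rate_bound_def
    by (intro mult_mono order_refl power_mono BN t mult_nonneg_nonneg cpos zero_le_power2 p Qc_bounds Lorentzian_bounds Qb)
qed

lemma N_at_top: "filterlim N at_top at_top"
proof -
  have "filterlim (\<lambda>w. - (1 / 2) + 1 / pi * B w) at_top at_top"
    by (intro filterlim_tendsto_add_at_top[OF tendsto_const] filterlim_tendsto_pos_mult_at_top[OF tendsto_const] B_at_top) simp
  moreover have "\<forall>\<^sub>F w in at_top. - (1 / 2) + 1 / pi * B w \<le> real (N w)"
  proof (rule eventually_mono[OF eventually_gt_at_top[of 0]])
    fix w :: real assume w: "0 < w"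
    then have "B w - pi / 2 \<le> real (N w) * pi"
      using mode_structure(2)[OF w] by (simp only: distrib_right mult_1_left)
    then have "(B w - pi / 2) / pi \<le> real (N w)" by (simp add: divide_le_eq)
    then show "- (1 / 2) + 1 / pi * B w \<le> real (N w)" by (simp add: diff_divide_distrib)
  qed
  ultimately have "filterlim (\<lambda>w. real (N w)) at_top at_top" by (rule filterlim_at_top_mono)
  then have "\<forall>\<^sub>F w in at_top. real Z \<le> real (N w)" for Z by (rule filterlim_at_top[THEN iffD1, THEN spec])
  then show ?thesis unfolding filterlim_at_top by simp
qed

lemma amp_square_tendsto:
  assumes W: "filterlim W at_top G" and J: "\<forall>\<^sub>F i in G. 1 \<le> J i \<and> J i < N (W i)"
  shows "((\<lambda>i. (amp (W i) (J i))\<^sup>2) \<longlongrightarrow> 2 / d) G"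
proof -
  have BW: "filterlim (\<lambda>i. B (W i)) at_top G" by (rule filterlim_compose[OF B_at_top W])
  have "filterlim (\<lambda>i. sqrt (pi / 2 * (- pi + B (W i)))) at_top G"
    by (intro filterlim_compose[OF sqrt_at_top] filterlim_tendsto_pos_mult_at_top[OF tendsto_const]
        filterlim_tendsto_add_at_top[OF tendsto_const] BW) simp
  moreover have pos: "\<forall>\<^sub>F i in G. 0 < W i" using W by (simp add: filterlim_at_top_dense)
  have "\<forall>\<^sub>F i in G. sqrt (pi / 2 * (- pi + B (W i))) \<le> \<zeta> (W i) (J i)"
    using pos J
  proof eventually_elim
    case (elim i)
    then have "pi / 2 * (B (W i) - pi) \<le> (\<zeta> (W i) (J i))\<^sup>2" by (intro zeta_bulk) auto
    moreover have "- pi + B (W i) = B (W i) - pi" by simp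
    moreover have "0 < \<zeta> (W i) (J i)" by (rule zeta_square(2)) (use elim in auto)
    ultimately show ?case by (simp only: real_le_lsqrt less_imp_le)
  qed
  ultimately have "filterlim (\<lambda>i. \<zeta> (W i) (J i)) at_top G" by (rule filterlim_at_top_mono)
  then have "((\<lambda>i. 1 / (1 + \<zeta> (W i) (J i))) \<longlongrightarrow> 0) G"
    by (intro tendsto_divide_0[OF tendsto_const] filterlim_at_top_imp_at_infinity
        filterlim_tendsto_add_at_top[OF tendsto_const])
  then have "((\<lambda>i. 2 / d * (1 - 1 / (1 + \<zeta> (W i) (J i)))) \<longlongrightarrow> 2 / d * (1 - 0)) G"
    by (intro tendsto_intros)
  moreover have "\<forall>\<^sub>F i in G. 2 / d * (1 - 1 / (1 + \<zeta> (W i) (J i))) = (amp (W i) (J i))\<^sup>2"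
    using pos J
  proof eventually_elim
    case (elim i)
    then have "0 < \<zeta> (W i) (J i)" using zeta_square(2)[of "W i" "J i"] by auto
    moreover have "(amp (W i) (J i))\<^sup>2 = 2 / d * (\<zeta> (W i) (J i) / (\<zeta> (W i) (J i) + 1))"
      by (rule amp_square) (use elim in auto)
    ultimately show ?case by (simp add: field_simps)
  qed
  ultimately have "((\<lambda>i. (amp (W i) (J i))\<^sup>2) \<longlongrightarrow> 2 / d * (1 - 0)) G" by (rule Lim_transform_eventually)
  then show ?thesis by simp
qed

lemma inverse_B_tendsto:
  assumes W: "filterlim W at_top G"
  shows "((\<lambda>i. x / B (W i)) \<longlongrightarrow> 0) G"
  by (intro tendsto_divide_0[OF tendsto_const] filterlim_at_top_imp_at_infinity filterlim_compose[OF B_at_top W])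

lemma B_over_N_tendsto:
  assumes W: "filterlim W at_top G"
  shows "((\<lambda>i. B (W i) / real (N (W i))) \<longlongrightarrow> pi) G"
proof -
  have pos: "\<forall>\<^sub>F i in G. 0 < W i" using W by (simp add: filterlim_at_top_dense)
  have "((\<lambda>i. real (N (W i)) * pi / B (W i) - 1) \<longlongrightarrow> 0) G"
  proof (rule Lim_null_comparison[OF _ inverse_B_tendsto[OF W, of "pi / 2"]])
    show "\<forall>\<^sub>F i in G. norm (real (N (W i)) * pi / B (W i) - 1) \<le> pi / 2 / B (W i)"
      using pos
    proof eventually_elim
      case (elim i)
      have b: "0 < B (W i)" by (rule B_pos[OF elim])
      have "real (N (W i)) * pi / B (W i) - 1 = (real (N (W i)) * pi - B (W i)) / B (W i)" using b by (simp add: diff_divide_distrib)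
      then show ?case using N_B_bounds[OF elim] b by (simp only: real_norm_def abs_divide abs_of_pos divide_right_mono less_imp_le)
    qed
  qed
  then have "((\<lambda>i. real (N (W i)) * pi / B (W i)) \<longlongrightarrow> 1) G" by (simp add: LIM_zero_iff)
  then have "((\<lambda>i. pi / (real (N (W i)) * pi / B (W i))) \<longlongrightarrow> pi / 1) G" by (intro tendsto_intros) auto
  then show ?thesis by simp
qed

lemma u_tendsto:
  assumes W: "filterlim W at_top G" and J: "\<forall>\<^sub>F i in G. 1 \<le> J i \<and> J i \<le> N (W i)"
    and v: "((\<lambda>i. real (J i) / real (N (W i))) \<longlongrightarrow> v) G"
  shows "((\<lambda>i. u (W i) (J i)) \<longlongrightarrow> v) G"
proof -
  have pos: "\<forall>\<^sub>F i in G. 0 < W i" using W by (simp add: filterlim_at_top_dense)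
  have "((\<lambda>i. u (W i) (J i) - real (J i) / real (N (W i))) \<longlongrightarrow> 0) G"
  proof (rule Lim_null_comparison[OF _ inverse_B_tendsto[OF W, of pi]])
    show "\<forall>\<^sub>F i in G. norm (u (W i) (J i) - real (J i) / real (N (W i))) \<le> pi / B (W i)"
      using pos J by eventually_elim (simp add: u_eq_approx)
  qed
  from tendsto_add[OF this v] show ?thesis by simp
qed

text \<open>
  Along any filter of pairs of frequencies and modes with \<open>j / N \<rightarrow> v\<close>. The condition \<open>\<sigma> \<rightarrow> \<infinity>\<close> keeps away
  the first few modes: there the frequency \<open>(\<sigma>\<^sub>j + \<sigma>\<^sub>j\<^sub>+\<^sub>1) / d\<close> stays bounded, and its contribution to the
  covariance form does not disappear.
\<close>

lemma bulk_rate_tendsto: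
  assumes W: "filterlim W at_top G" and J: "\<forall>\<^sub>F i in G. 1 \<le> J i \<and> J i < N (W i)"
    and v: "((\<lambda>i. real (J i) / real (N (W i))) \<longlongrightarrow> v) G" "v \<in> {0..1}"
    and \<sigma>: "filterlim (\<lambda>i. \<sigma> (W i) (J i)) at_top G"
  shows "((\<lambda>i. bulk_rate (W i) (J i)) \<longlongrightarrow> a_infty d n1 a g0 v * (d / 2)\<^sup>2) G"
proof -
  have pos: "\<forall>\<^sub>F i in G. 0 < W i" using W by (simp add: filterlim_at_top_dense)
  have u1: "((\<lambda>i. u (W i) (J i)) \<longlongrightarrow> v) G"
    by (rule u_tendsto[OF W _ v(1)]) (rule eventually_mono[OF J], auto)
  have "((\<lambda>i. u (W i) (Suc (J i)) - u (W i) (J i)) \<longlongrightarrow> 0) G"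
  proof (rule Lim_null_comparison[OF _ inverse_B_tendsto[OF W, of pi]])
    show "\<forall>\<^sub>F i in G. norm (u (W i) (Suc (J i)) - u (W i) (J i)) \<le> pi / B (W i)"
      using pos J
    proof eventually_elim
      case (elim i)
      have b: "0 < B (W i)" by (rule B_pos) (use elim in auto)
      have "u (W i) (Suc (J i)) - u (W i) (J i) = (\<sigma> (W i) (Suc (J i)) - \<sigma> (W i) (J i)) / B (W i)"
        by (simp add: u_def diff_divide_distrib)
      moreover have "\<bar>\<sigma> (W i) (Suc (J i)) - \<sigma> (W i) (J i)\<bar> \<le> pi"
        using sigma_gap(2,3)[of "W i" "J i"] elim pi_gt_zero by linarith
      ultimately show ?case using b by (simp only: real_norm_def abs_divide abs_of_pos divide_right_mono less_imp_le)
    qed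
  qed
  from tendsto_add[OF this u1] have u2: "((\<lambda>i. u (W i) (Suc (J i))) \<longlongrightarrow> v) G" by simp
  have um: "\<forall>\<^sub>F i in G. u (W i) (J i) \<in> {-1..1}" "\<forall>\<^sub>F i in G. u (W i) (Suc (J i)) \<in> {-1..1}"
  proof -
    have um0: "u w j \<in> {-1..1}" if "0 < w" "j \<in> {1..N w}" for w j using u_bounds(1,2)[OF that] by auto
    show "\<forall>\<^sub>F i in G. u (W i) (J i) \<in> {-1..1}" "\<forall>\<^sub>F i in G. u (W i) (Suc (J i)) \<in> {-1..1}"
      by (rule eventually_mono[OF eventually_conj[OF pos J]], rule um0, (simp; fail), (simp; fail))+
  qed
  have asn: "((\<lambda>i. arcsin (x i)) \<longlongrightarrow> arcsin v) G" if "(x \<longlongrightarrow> v) G" "\<forall>\<^sub>F i in G. x i \<in> {-1..1}" for x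
    by (rule continuous_on_tendsto_compose[OF continuous_on_arcsin' that(1) _ that(2)]) (use v in auto)
  have "((\<lambda>i. pi - (arcsin (u (W i) (Suc (J i))) - arcsin (u (W i) (J i)))) \<longlongrightarrow> pi - (arcsin v - arcsin v)) G"
    by (intro tendsto_intros asn u1 u2 um)
  then have "((\<lambda>i. pi - (arcsin (u (W i) (Suc (J i))) - arcsin (u (W i) (J i)))) \<longlongrightarrow> pi) G" by simp
  moreover have "\<forall>\<^sub>F i in G. pi - (arcsin (u (W i) (Suc (J i))) - arcsin (u (W i) (J i))) = \<sigma> (W i) (Suc (J i)) - \<sigma> (W i) (J i)"
    using pos J by eventually_elim (simp add: sigma_gap(1))
  ultimately have \<Delta>: "((\<lambda>i. \<sigma> (W i) (Suc (J i)) - \<sigma> (W i) (J i)) \<longlongrightarrow> pi) G" by (rule Lim_transform_eventually)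
  \<comment> \<open>The limit of \<open>propagation_cos\<close>; the factor \<open>1 / t\<^sup>2\<close> merges with the Lorentzian into the
    denominator of \<open>a\<^sub>\<infinity>\<close>.\<close>
  define t where "t = sqrt (1 - \<theta>\<^sup>2 * v\<^sup>2)"
  have "\<theta>\<^sup>2 * v\<^sup>2 \<le> \<theta>\<^sup>2 * 1" using v(2) by (intro mult_left_mono power_le_one) auto
  also have "\<theta>\<^sup>2 * 1 < 1" using index_gt_1 by (simp add: theta_square)
  finally have t: "0 < t" "t\<^sup>2 = 1 - \<theta>\<^sup>2 * v\<^sup>2" by (auto simp: t_def)
  have t1: "((\<lambda>i. propagation_cos (W i) (J i)) \<longlongrightarrow> t) G" "((\<lambda>i. propagation_cos (W i) (Suc (J i))) \<longlongrightarrow> t) G"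
    unfolding propagation_cos_def t_def by (intro tendsto_intros u1 u2)+
  have "((\<lambda>i. (\<sigma> (W i) (Suc (J i)) - \<sigma> (W i) (J i)) / d) \<longlongrightarrow> pi / d) G"
    using d by (intro tendsto_intros \<Delta>) auto
  moreover have "filterlim (\<lambda>i. (\<sigma> (W i) (Suc (J i)) + \<sigma> (W i) (J i)) / d) at_top G"
  proof (rule filterlim_at_top_mono)
    show "filterlim (\<lambda>i. 1 / d * \<sigma> (W i) (J i)) at_top G"
      using d by (intro filterlim_tendsto_pos_mult_at_top[OF tendsto_const] \<sigma>) auto
    show "\<forall>\<^sub>F i in G. 1 / d * \<sigma> (W i) (J i) \<le> (\<sigma> (W i) (Suc (J i)) + \<sigma> (W i) (J i)) / d"
      using pos J
    proof eventually_elim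
      case (elim i)
      have "0 < \<sigma> (W i) (Suc (J i))" by (rule sigma_bounds(3)) (use elim in auto)
      then show ?case using d by (simp add: divide_right_mono)
    qed
  qed
  ultimately have q: "((\<lambda>i. Qc (\<sigma> (W i) (J i)) (\<sigma> (W i) (Suc (J i)))) \<longlongrightarrow> S0 d g0) G"
    unfolding Qc_def by (rule Q_cos_diff_filterlim)
  have g: "((\<lambda>i. gap (W i) (J i)) \<longlongrightarrow> pi * (v + v) * \<theta> / (d * (t + t))) G"
    unfolding gap_def using t d by (intro tendsto_intros \<Delta> u1 u2 t1) auto
  have apos: "a\<^sup>2 + x\<^sup>2 \<noteq> 0" for x using a by (simp add: sum_power2_eq_zero_iff)
  have "((\<lambda>i. bulk_rate (W i) (J i)) \<longlongrightarrow> 1 / (8 * n1 ^ 4 * d\<^sup>2 * \<theta>\<^sup>2) * pi\<^sup>2 * (1 / t * (1 / t)) * S0 d g0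
     * (a / (a\<^sup>2 + (pi * (v + v) * \<theta> / (d * (t + t)))\<^sup>2))) G"
    unfolding bulk_rate_def using t apos by (intro tendsto_intros B_over_N_tendsto[OF W] t1 q g) auto
  also have "1 / (8 * n1 ^ 4 * d\<^sup>2 * \<theta>\<^sup>2) * pi\<^sup>2 * (1 / t * (1 / t)) * S0 d g0
     * (a / (a\<^sup>2 + (pi * (v + v) * \<theta> / (d * (t + t)))\<^sup>2)) = a_infty d n1 a g0 v * (d / 2)\<^sup>2"
  proof -
    define D where "D = 1 - (1 - pi\<^sup>2 / (a\<^sup>2 * d\<^sup>2)) * (\<theta> * v)\<^sup>2"
    have "pi * (v + v) * \<theta> / (d * (t + t)) = pi * v * \<theta> / (d * t)" using t d by (simp add: field_simps)
    then have "t\<^sup>2 * (a\<^sup>2 + (pi * (v + v) * \<theta> / (d * (t + t)))\<^sup>2) = a\<^sup>2 * t\<^sup>2 + (pi * v * \<theta>)\<^sup>2 / d\<^sup>2"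
      using t(1) d by (simp add: power_divide power_mult_distrib distrib_left)
    also have "\<dots> = a\<^sup>2 * D"
      unfolding t(2) D_def using a by (simp add: power_mult_distrib algebra_simps)
    finally have D: "t\<^sup>2 * (a\<^sup>2 + (pi * (v + v) * \<theta> / (d * (t + t)))\<^sup>2) = a\<^sup>2 * D" .
    have E0: "1 / t * (1 / t) * (a / X) = a / (t\<^sup>2 * X)" for X by (simp add: power2_eq_square)
    have E: "1 / t * (1 / t) * (a / (a\<^sup>2 + (pi * (v + v) * \<theta> / (d * (t + t)))\<^sup>2)) = 1 / (a * D)"
      unfolding E0 D using a by (simp add: power2_eq_square)
    have F: "x1 * x2 * y * x3 * z = x1 * x2 * x3 * (y * z)" for x1 x2 x3 y z :: real by simp
    have H: "x1 * (1 / (8 * n * e * q)) * (1 / (a * D)) = x1 / (2 * a * n * (e * e) * q) / D * (e / 4)"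
      if "e \<noteq> 0" for x1 n q e :: real
      using that by (auto simp: divide_simps)
    have d4: "d ^ 4 = d\<^sup>2 * d\<^sup>2" "(d / 2)\<^sup>2 = d\<^sup>2 / 4" by (simp_all add: power_divide)
    have "1 / (8 * n1 ^ 4 * d\<^sup>2 * \<theta>\<^sup>2) * pi\<^sup>2 * S0 d g0 * (1 / (a * D))
        = pi\<^sup>2 * S0 d g0 * (1 / (8 * n1 ^ 4 * d\<^sup>2 * \<theta>\<^sup>2)) * (1 / (a * D))" by (simp only: mult_ac)
    also have "\<dots> = a_infty d n1 a g0 v * (d / 2)\<^sup>2"
      unfolding a_infty_def a_zero_def D_def[symmetric] d4 using depth_pos by (intro H) simp
    finally show ?thesis unfolding F E .
  qed
  finally show ?thesis .
qed

end

section \<open>Loss to the radiating modes\<close>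

text \<open>
  The quotient on the right is \<open>A\<^sub>\<gamma>\<^sup>2\<close> up to the factor \<open>d / \<pi>\<close>, with \<open>x = \<xi>\<close> and \<open>b + e + t = \<eta>\<close>; here \<open>b\<close> is the
  mode bound and \<open>b + e\<close> a resonance, where \<open>cos \<eta> = 0\<close>. At distance \<open>t \<approx> \<tau>\<close> from the resonance,
  \<open>\<xi>\<^sup>2\<close> is of order \<open>b E\<close>, and so is \<open>\<eta>\<^sup>2 cos\<^sup>2 \<eta> \<le> (2 b \<tau>)\<^sup>2\<close> by the choice of \<open>\<tau>\<close>. The summand \<open>1 / b\<close> of \<open>E\<close> keeps
  \<open>\<tau>\<close> positive when the resonance sits at the cutoff itself, \<open>e = 0\<close>.
\<close>

lemma resonance_lower_bound:
  fixes b e :: real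
  defines "E \<equiv> e + 1 / b"
  defines "\<tau> \<equiv> sqrt (E / b)"
  assumes b: "0 < b" and e: "0 \<le> e" and Eb: "2 * E \<le> b"
    and t: "\<tau> / 2 \<le> t" "t \<le> \<tau>" and x: "0 < x" "x\<^sup>2 = (e + t) * (2 * b + e + t)"
    and s: "s\<^sup>2 \<le> 1" and c: "\<bar>c\<bar> \<le> t" and D: "0 < x\<^sup>2 * s\<^sup>2 + (b + e + t)\<^sup>2 * c\<^sup>2"
  shows "1 / (10 * sqrt (b * E)) \<le> x / (x\<^sup>2 * s\<^sup>2 + (b + e + t)\<^sup>2 * c\<^sup>2)"
proof -
  have E: "0 < E" "e \<le> E" "1 / b \<le> E" using b e by (auto simp: E_def add_nonneg_pos)
  have \<tau>2: "\<tau>\<^sup>2 = E / b" using E b by (simp add: \<tau>_def)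
  have \<tau>0: "0 < \<tau>" using E b by (simp add: \<tau>_def)
  have "(1 / b)\<^sup>2 = 1 / b * (1 / b)" by (rule power2_eq_square)
  also have "\<dots> \<le> E * (1 / b)" by (rule mult_right_mono[OF E(3)]) (use b in simp)
  also have "\<dots> = \<tau>\<^sup>2" unfolding \<tau>2 by simp
  finally have "(1 / b)\<^sup>2 \<le> \<tau>\<^sup>2" .
  then have \<tau>1: "1 / b \<le> \<tau>" by (rule power2_le_imp_le) (rule less_imp_le[OF \<tau>0])
  have "\<tau>\<^sup>2 = E * (1 / b)" unfolding \<tau>2 by simp
  also have "\<dots> \<le> E * E" by (rule mult_left_mono[OF E(3)]) (use E in simp)
  also have "\<dots> = E\<^sup>2" by (rule power2_eq_square[symmetric])
  finally have "\<tau>\<^sup>2 \<le> E\<^sup>2" .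
  then have \<tau>E: "\<tau> \<le> E" by (rule power2_le_imp_le) (rule less_imp_le[OF E(1)])
  have t0: "0 < t" using t \<tau>0 by linarith
  have "b * E \<le> (e + t) * (2 * b)"
  proof -
    have "E \<le> 2 * (e + t)" using t \<tau>1 e by (simp add: E_def)
    then have "b * E \<le> b * (2 * (e + t))" using b by (intro mult_left_mono) auto
    then show ?thesis by (simp add: mult_ac)
  qed
  also have "\<dots> \<le> (e + t) * (2 * b + e + t)" using e t0 by (intro mult_left_mono) auto
  finally have lo: "b * E \<le> x\<^sup>2" by (simp add: x)
  have "sqrt (b * E) \<le> x" using lo x by (intro real_le_lsqrt) auto
  have "x\<^sup>2 \<le> (2 * E) * (3 * b)"
    unfolding x(2) using E \<tau>E t t0 e b Eb by (intro mult_mono) auto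
  then have "x\<^sup>2 * s\<^sup>2 \<le> (2 * E) * (3 * b) * 1" using s E b by (intro mult_mono) auto
  moreover have "(b + e + t)\<^sup>2 * c\<^sup>2 \<le> (2 * b)\<^sup>2 * \<tau>\<^sup>2"
  proof (rule mult_mono)
    show "(b + e + t)\<^sup>2 \<le> (2 * b)\<^sup>2" using E \<tau>E t t0 e b Eb by (intro power_mono) auto
    show "c\<^sup>2 \<le> \<tau>\<^sup>2" using c t \<tau>0 by (intro abs_le_square_iff[THEN iffD1]) auto
  qed auto
  moreover have "(2 * b)\<^sup>2 * \<tau>\<^sup>2 = 4 * (b * E)" unfolding \<tau>2 using b by (simp add: power2_eq_square)
  ultimately have up: "x\<^sup>2 * s\<^sup>2 + (b + e + t)\<^sup>2 * c\<^sup>2 \<le> 10 * (b * E)" by (simp add: mult_ac)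
  have bE: "0 < b * E" using b E by simp
  have "1 / (10 * r) = r / (10 * (r * r))" if "0 < r" for r :: real using that by simp
  moreover have "sqrt (b * E) * sqrt (b * E) = b * E" "0 < sqrt (b * E)" using bE by simp_all
  ultimately have "1 / (10 * sqrt (b * E)) = sqrt (b * E) / (10 * (b * E))" by metis
  also have "\<dots> \<le> x / (x\<^sup>2 * s\<^sup>2 + (b + e + t)\<^sup>2 * c\<^sup>2)"
    using \<open>sqrt (b * E) \<le> x\<close> up D bE x by (intro frac_le) auto
  finally show ?thesis .
qed

context ocean begin

definition rad_rate :: "real \<Rightarrow> real \<Rightarrow> real" where
  "rad_rate w g = (wavenumber c w) ^ 4 / (4 * sqrt g * \<beta> w (N w)) *
     ((amp w (N w))\<^sup>2 * (rad_amp d n1 c w g)\<^sup>2 / 4 * Qc (\<sigma> w (N w)) (rad_eta d n1 c w g)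
       * (a / (a\<^sup>2 + (sqrt g - \<beta> w (N w))\<^sup>2)))"

lemma Lambda_eq: "\<Lambda> w (N w) = (LINT g:{0<..<(wavenumber c w)\<^sup>2}|lborel. rad_rate w g)"
proof -
  have inner: "(LINT z:{0..}|lborel. (\<integral>\<omega>. coupling_process V d (mode_phi d n1 c w (N w)) (rad_phi d n1 c w g) 0 \<omega>
      * coupling_process V d (mode_phi d n1 c w (N w)) (rad_phi d n1 c w g) z \<omega> \<partial>M) * cos ((sqrt g - \<beta> w (N w)) * z))
    = (amp w (N w))\<^sup>2 * (rad_amp d n1 c w g)\<^sup>2 / 4 * Qc (\<sigma> w (N w)) (rad_eta d n1 c w g)
       * (a / (a\<^sup>2 + (sqrt g - \<beta> w (N w))\<^sup>2))" for g
    by (rule mode_products_spectrum) (auto simp: mode_phi_def rad_phi_def)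
  show ?thesis unfolding Lambda_c_def rad_rate_def inner ..
qed

lemma beta_gt_wavenumber:
  assumes w: "0 < w" and j: "j \<in> {1..N w}"
  shows "wavenumber c w < \<beta> w j" "\<beta> w j \<le> n1 * wavenumber c w"
proof -
  have k: "0 < wavenumber c w" using w speed_pos by (simp add: wavenumber_def)
  have b: "B w = n1 * wavenumber c w * d * \<theta>" by (simp add: mode_bound_def)
  have "(\<sigma> w j)\<^sup>2 < (B w)\<^sup>2" using sigma_bounds[OF w j] by (intro power_strict_mono) auto
  then have "(\<sigma> w j)\<^sup>2 / d\<^sup>2 < (B w)\<^sup>2 / d\<^sup>2" using depth_pos by (intro divide_strict_right_mono) auto
  also have "(B w)\<^sup>2 / d\<^sup>2 = n1\<^sup>2 * (wavenumber c w)\<^sup>2 * \<theta>\<^sup>2" using depth_pos by (simp add: b power_mult_distrib)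
  also have "\<dots> = n1\<^sup>2 * (wavenumber c w)\<^sup>2 - (wavenumber c w)\<^sup>2" using index_gt_1 by (simp add: theta_square right_diff_distrib)
  finally show "wavenumber c w < \<beta> w j" unfolding mode_beta_def using k by (intro real_less_rsqrt) simp
  show "\<beta> w j \<le> n1 * wavenumber c w" unfolding mode_beta_def
    using index_gt_1 k by (intro real_le_lsqrt) (auto simp: power_mult_distrib)
qed

context
  fixes w :: real
  assumes w: "0 < w" and N1: "1 \<le> N w"
begin

abbreviation "k \<equiv> wavenumber c w"
abbreviation "\<eta> \<equiv> rad_eta d n1 c w"
abbreviation "\<xi> \<equiv> rad_xi d c w"

lemma k_pos: "0 < k" using w speed_pos by (simp add: wavenumber_def)

lemma eta_xi:
  assumes g: "g \<in> {0<..<k\<^sup>2}"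
  shows "0 < \<xi> g" "\<xi> g \<le> \<eta> g" "(\<xi> g)\<^sup>2 = (\<eta> g)\<^sup>2 - (B w)\<^sup>2" "(\<eta> g)\<^sup>2 = d\<^sup>2 * (n1\<^sup>2 * k\<^sup>2 - g)" "B w \<le> \<eta> g"
proof -
  have n1: "1 \<le> n1\<^sup>2" using index_gt_1 by simp
  then have nk: "k\<^sup>2 \<le> n1\<^sup>2 * k\<^sup>2" by (simp add: mult_le_cancel_right1)
  show x: "0 < \<xi> g" using g depth_pos by (simp add: rad_xi_def)
  show xe: "\<xi> g \<le> \<eta> g" using nk depth_pos by (simp add: rad_xi_def rad_eta_def)
  show e: "(\<eta> g)\<^sup>2 = d\<^sup>2 * (n1\<^sup>2 * k\<^sup>2 - g)" using g nk by (simp add: rad_eta_def power_mult_distrib)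
  have x2: "(\<xi> g)\<^sup>2 = d\<^sup>2 * (k\<^sup>2 - g)" using g by (simp add: rad_xi_def power_mult_distrib)
  have "(B w)\<^sup>2 = d\<^sup>2 * (n1\<^sup>2 * k\<^sup>2 - k\<^sup>2)"
    using index_gt_1 unfolding mode_bound_def power_mult_distrib theta_square by (simp add: right_diff_distrib)
  then show eq: "(\<xi> g)\<^sup>2 = (\<eta> g)\<^sup>2 - (B w)\<^sup>2" unfolding x2 e by (simp add: algebra_simps)
  have "0 \<le> (\<eta> g)\<^sup>2 - (B w)\<^sup>2" unfolding eq[symmetric] by (rule zero_le_power2)
  then have "(B w)\<^sup>2 \<le> (\<eta> g)\<^sup>2" by (simp only: diff_ge_0_iff_ge)
  then show "B w \<le> \<eta> g" by (rule power2_le_imp_le) (rule order_trans[OF less_imp_le[OF x] xe])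
qed

lemma rad_amp_square:
  assumes g: "g \<in> {0<..<k\<^sup>2}"
  shows "(rad_amp d n1 c w g)\<^sup>2 = d * \<xi> g / (pi * ((\<xi> g)\<^sup>2 * (sin (\<eta> g))\<^sup>2 + (\<eta> g)\<^sup>2 * (cos (\<eta> g))\<^sup>2))"
    "(\<xi> g)\<^sup>2 \<le> (\<xi> g)\<^sup>2 * (sin (\<eta> g))\<^sup>2 + (\<eta> g)\<^sup>2 * (cos (\<eta> g))\<^sup>2"
    "(rad_amp d n1 c w g)\<^sup>2 \<le> d / (pi * \<xi> g)"
proof -
  note ex = eta_xi[OF g]
  show le: "(\<xi> g)\<^sup>2 \<le> (\<xi> g)\<^sup>2 * (sin (\<eta> g))\<^sup>2 + (\<eta> g)\<^sup>2 * (cos (\<eta> g))\<^sup>2"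
  proof -
    have "(\<xi> g)\<^sup>2 = (\<xi> g)\<^sup>2 * (sin (\<eta> g))\<^sup>2 + (\<xi> g)\<^sup>2 * (cos (\<eta> g))\<^sup>2"
      unfolding distrib_left[symmetric] sin_cos_squared_add by simp
    also have "\<dots> \<le> (\<xi> g)\<^sup>2 * (sin (\<eta> g))\<^sup>2 + (\<eta> g)\<^sup>2 * (cos (\<eta> g))\<^sup>2"
      using ex(1,2) by (intro add_left_mono mult_right_mono power_mono) auto
    finally show ?thesis .
  qed
  have p: "0 < (\<xi> g)\<^sup>2" using ex(1) by simp
  define X where "X = (\<xi> g)\<^sup>2 * (sin (\<eta> g))\<^sup>2 + (\<eta> g)\<^sup>2 * (cos (\<eta> g))\<^sup>2"
  have X: "(\<xi> g)\<^sup>2 \<le> X" "0 < X" unfolding X_def using le p by linarith+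
  note rad_amp_def[of d n1 c w g, folded X_def]
  moreover have "0 \<le> d * \<xi> g / (pi * X)" using X ex(1) depth_pos by simp
  ultimately have eq: "(rad_amp d n1 c w g)\<^sup>2 = d * \<xi> g / (pi * X)" by (simp only: real_sqrt_pow2)
  then show "(rad_amp d n1 c w g)\<^sup>2 = d * \<xi> g / (pi * ((\<xi> g)\<^sup>2 * (sin (\<eta> g))\<^sup>2 + (\<eta> g)\<^sup>2 * (cos (\<eta> g))\<^sup>2))"
    by (simp only: X_def)
  have "d * \<xi> g / (pi * X) \<le> d * \<xi> g / (pi * (\<xi> g)\<^sup>2)"
  proof (rule divide_left_mono)
    show "pi * (\<xi> g)\<^sup>2 \<le> pi * X" by (rule mult_left_mono[OF X(1)]) simp
    show "0 \<le> d * \<xi> g" using ex(1) depth_pos by simp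
    show "0 < pi * X * (pi * (\<xi> g)\<^sup>2)" by (rule mult_pos_pos[OF mult_pos_pos[OF pi_gt_zero X(2)] mult_pos_pos[OF pi_gt_zero p]])
  qed
  also have "\<dots> = d / (pi * \<xi> g)" using ex(1) by (simp add: power2_eq_square)
  finally show "(rad_amp d n1 c w g)\<^sup>2 \<le> d / (pi * \<xi> g)" unfolding eq .
qed

lemma rad_rate_nonneg: "g \<in> {0<..<k\<^sup>2} \<Longrightarrow> 0 \<le> rad_rate w g"
proof -
  assume g: "g \<in> {0<..<k\<^sup>2}"
  have "0 < \<beta> w (N w)" using beta_gt_wavenumber(1)[OF w, of "N w"] N1 k_pos by auto
  then have "0 \<le> k ^ 4 / (4 * sqrt g * \<beta> w (N w))" using g by simp
  moreover have "0 \<le> (amp w (N w))\<^sup>2 * (rad_amp d n1 c w g)\<^sup>2 / 4" by simp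
  ultimately show "0 \<le> rad_rate w g"
    unfolding rad_rate_def by (intro mult_nonneg_nonneg Qc_bounds(1) Lorentzian_bounds(1))
qed

text \<open>
  Since \<open>\<xi> \<le> \<eta>\<close>, the denominator of \<open>A\<^sub>\<gamma>\<^sup>2\<close> is at least \<open>\<pi> \<xi>\<^sup>2\<close>, so that \<open>A\<^sub>\<gamma>\<^sup>2 \<le> d / (\<pi> \<xi>)\<close>. Integrability has to be
  known before \<open>\<Lambda>\<^sub>N\<close> can be bounded from below: the integral of a non-integrable function is \<open>0\<close>.
\<close>

lemma rad_rate_integrable: "set_integrable lborel {0<..<k\<^sup>2} (rad_rate w)"
proof -
  have b: "0 < \<beta> w (N w)" using beta_gt_wavenumber(1)[OF w, of "N w"] N1 k_pos by auto
  have apos: "a\<^sup>2 + x\<^sup>2 \<noteq> 0" for x using a by (simp add: sum_power2_eq_zero_iff)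
  define C where "C = k ^ 4 / (4 * \<beta> w (N w)) * ((amp w (N w))\<^sup>2 * (1 / pi) / 4 * (4 * Q_bound) * (1 / a))"
  have cont_Qc: "continuous_on {0<..<k\<^sup>2} (\<lambda>g. Qc (\<sigma> w (N w)) (\<eta> g))"
  proof -
    have "continuous_on {0<..<k\<^sup>2} (\<lambda>g. (\<lambda>(p, q). Q (\<lambda>x. cos (p * x) - cos (q * x))) ((\<eta> g - \<sigma> w (N w)) / d, (\<eta> g + \<sigma> w (N w)) / d))"
      unfolding rad_eta_def using d
      by (intro continuous_on_compose2[OF Q_cos_diff_continuous] continuous_intros) auto
    then show ?thesis by (simp add: Qc_def)
  qed
  have cont: "continuous_on {0<..<k\<^sup>2} (rad_rate w)"
  proof -
    have den: "pi * ((\<xi> g)\<^sup>2 * (sin (\<eta> g))\<^sup>2 + (\<eta> g)\<^sup>2 * (cos (\<eta> g))\<^sup>2) \<noteq> 0" if "g \<in> {0<..<k\<^sup>2}" for g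
    proof -
      have "0 < (\<xi> g)\<^sup>2" using eta_xi(1)[OF that] by simp
      then have "0 < (\<xi> g)\<^sup>2 * (sin (\<eta> g))\<^sup>2 + (\<eta> g)\<^sup>2 * (cos (\<eta> g))\<^sup>2" using rad_amp_square(2)[OF that] by linarith
      then show ?thesis by simp
    qed
    have xe: "continuous_on {0<..<k\<^sup>2} \<xi>" "continuous_on {0<..<k\<^sup>2} \<eta>"
      unfolding rad_eta_def rad_xi_def by (intro continuous_intros)+
    show ?thesis unfolding rad_rate_def rad_amp_def using b
      by (intro continuous_intros cont_Qc xe) (use den apos in auto)
  qed
  show ?thesis
  proof (rule set_integrable_bound)
    show "set_integrable lborel {0<..<k\<^sup>2} (\<lambda>g. C * (1 / (sqrt g * sqrt (k\<^sup>2 - g))))"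
      using integrable_inverse_sqrt_product[of "k\<^sup>2"] k_pos by (intro set_integrable_mult_right) auto
    show "set_borel_measurable lborel {0<..<k\<^sup>2} (rad_rate w)"
      unfolding set_borel_measurable_def using borel_measurable_continuous_on_indicator[OF _ cont] by simp
    show "AE g in lborel. g \<in> {0<..<k\<^sup>2} \<longrightarrow> norm (rad_rate w g) \<le> norm (C * (1 / (sqrt g * sqrt (k\<^sup>2 - g))))"
    proof (intro AE_I2 impI)
      fix g assume g: "g \<in> {0<..<k\<^sup>2}"
      have sg: "0 < sqrt g" "0 < sqrt (k\<^sup>2 - g)" using g by auto
      have "rad_rate w g \<le> k ^ 4 / (4 * sqrt g * \<beta> w (N w)) * ((amp w (N w))\<^sup>2 * (d / (pi * \<xi> g)) / 4 * (4 * Q_bound) * (1 / a))"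
      proof -
        have p: "0 \<le> d / (pi * \<xi> g)" using eta_xi(1)[OF g] depth_pos by simp
        have 1: "(amp w (N w))\<^sup>2 * (rad_amp d n1 c w g)\<^sup>2 / 4 \<le> (amp w (N w))\<^sup>2 * (d / (pi * \<xi> g)) / 4"
          by (intro divide_right_mono mult_left_mono rad_amp_square(3)[OF g]) auto
        have p4: "0 \<le> (amp w (N w))\<^sup>2 * (d / (pi * \<xi> g)) / 4"
          by (rule divide_nonneg_nonneg[OF mult_nonneg_nonneg[OF zero_le_power2 p]]) simp
        have 2: "(amp w (N w))\<^sup>2 * (rad_amp d n1 c w g)\<^sup>2 / 4 * Qc (\<sigma> w (N w)) (\<eta> g)
            \<le> (amp w (N w))\<^sup>2 * (d / (pi * \<xi> g)) / 4 * (4 * Q_bound)"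
          by (rule mult_mono[OF 1 Qc_bounds(2) p4 Qc_bounds(1)])
        have q4: "0 \<le> (amp w (N w))\<^sup>2 * (d / (pi * \<xi> g)) / 4 * (4 * Q_bound)"
          using p4 Q_bound_nonneg by (intro mult_nonneg_nonneg) auto
        have "0 \<le> k ^ 4 / (4 * sqrt g * \<beta> w (N w))" using b sg by simp
        then show ?thesis
          unfolding rad_rate_def by (rule mult_left_mono[OF mult_mono[OF 2 Lorentzian_bounds(2) q4 Lorentzian_bounds(1)]])
      qed
      also have "d / (pi * \<xi> g) = 1 / pi * (1 / sqrt (k\<^sup>2 - g))" using depth_pos by (simp add: rad_xi_def)
      also have "k ^ 4 / (4 * sqrt g * \<beta> w (N w)) * ((amp w (N w))\<^sup>2 * (1 / pi * (1 / sqrt (k\<^sup>2 - g))) / 4 * (4 * Q_bound) * (1 / a))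
          = C * (1 / (sqrt g * sqrt (k\<^sup>2 - g)))"
        unfolding C_def by simp
      finally have "rad_rate w g \<le> C * (1 / (sqrt g * sqrt (k\<^sup>2 - g)))" .
      then show "norm (rad_rate w g) \<le> norm (C * (1 / (sqrt g * sqrt (k\<^sup>2 - g))))"
        unfolding real_norm_def abs_of_nonneg[OF rad_rate_nonneg[OF g]] by (rule order_trans[OF _ abs_ge_self])
    qed
  qed
qed

end

text \<open>
  Let \<open>\<eta>' = (N + 1/2) \<pi>\<close>, the first resonance above the mode bound \<open>b\<close>, and \<open>e = \<eta>' - b\<close>. The losses
  are bounded from below by those to the radiating modes with \<open>\<eta> \<in> [\<eta>' + \<tau> / 2, \<eta>' + \<tau>]\<close>. There \<open>A\<^sub>\<gamma>\<^sup>2\<close> is at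
  least of order \<open>1 / sqrt (b E)\<close>; the frequency \<open>\<eta> - \<sigma>\<^sub>N\<close> is close to \<open>\<pi>\<close>, so that the covariance form is
  at least \<open>S\<^sub>0 / 2\<close>; and the Lorentzian is bounded below because \<open>\<beta>\<^sub>N - sqrt \<gamma>\<close> is bounded. The window has
  length of order \<open>sqrt (b E)\<close> in \<open>\<gamma>\<close>, which compensates the decay of \<open>A\<^sub>\<gamma>\<^sup>2\<close>. What is left is
  \<open>k\<^sup>4 / (sqrt \<gamma> \<beta>\<^sub>N) A\<^sub>N\<^sup>2\<close>, of order \<open>b\<^sup>2 A\<^sub>N\<^sup>2\<close>.
\<close>

lemma Lambda_lower_bound:
  assumes S0: "0 < S0 d g0"
  shows "\<exists>\<kappa>>0. \<forall>\<^sub>F w in at_top. \<kappa> * ((B w)\<^sup>2 * (amp w (N w))\<^sup>2) \<le> \<Lambda> w (N w)"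
proof -
  obtain \<delta> Bq where \<delta>: "0 < \<delta>" and near: "\<And>p q. \<bar>p - pi / d\<bar> < \<delta> \<Longrightarrow> Bq < q \<Longrightarrow> \<bar>Q (\<lambda>x. cos (p * x) - cos (q * x)) - S0 d g0\<bar> < S0 d g0 / 2"
    using Q_cos_diff_near_S0[of "S0 d g0 / 2"] S0 by auto
  define cc where "cc = 4 * (pi + 1) * n1 * \<theta> / d"
  define lor where "lor = a / (a\<^sup>2 + cc\<^sup>2)"
  have lor: "0 < lor" using a by (simp add: lor_def add_pos_nonneg)
  define \<kappa> where "\<kappa> = 1 / (n1 * d * \<theta>)\<^sup>2 / (4 * n1) * (1 / (10 * pi * d) / 4 * (S0 d g0 / 2) * lor)"
  have \<kappa>: "0 < \<kappa>" unfolding \<kappa>_def using index_gt_1 depth_pos theta S0 lor by (intro mult_pos_pos divide_pos_pos) auto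
  have N1: "\<forall>\<^sub>F w in at_top. 1 \<le> N w" using N_at_top by (simp add: filterlim_at_top)
  have bbig: "\<forall>\<^sub>F w in at_top. x < B w" for x using B_at_top by (simp add: filterlim_at_top_dense)
  have "((\<lambda>w. real (N w) / real (N w)) \<longlongrightarrow> 1) at_top"
    by (rule Lim_transform_eventually[OF tendsto_const], rule eventually_mono[OF N1]) auto
  then have "((\<lambda>w. u w (N w)) \<longlongrightarrow> 1) at_top"
    by (intro u_tendsto[where W = "\<lambda>w. w" and J = N] filterlim_ident) (use N1 in auto)
  moreover have "\<forall>\<^sub>F w in at_top. u w (N w) \<in> {-1..1}"
    using N1 eventually_gt_at_top[of 0]
  proof eventually_elim
    case (elim w)
    then show ?case using u_bounds(1,2)[of w "N w"] by auto
  qed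
  ultimately have "((\<lambda>w. arcsin (u w (N w))) \<longlongrightarrow> arcsin 1) at_top"
    by (intro continuous_on_tendsto_compose[OF continuous_on_arcsin']) auto
  \<comment> \<open>Used for \<open>\<eta>' - \<sigma>\<^sub>N = \<pi> / 2 + arcsin (\<sigma>\<^sub>N / b)\<close>, which tends to \<open>\<pi>\<close>.\<close>
  then have asn: "\<forall>\<^sub>F w in at_top. \<bar>arcsin (u w (N w)) - pi / 2\<bar> < \<delta> * d / 2"
    using tendstoD[of _ "arcsin 1" at_top "\<delta> * d / 2"] \<delta> d by (simp add: dist_real_def)
  show ?thesis
  proof (intro exI[of _ \<kappa>] conjI \<kappa>)
    show "\<forall>\<^sub>F w in at_top. \<kappa> * ((B w)\<^sup>2 * (amp w (N w))\<^sup>2) \<le> \<Lambda> w (N w)"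
      using N1 bbig[of "10"] bbig[of "30 * n1\<^sup>2"] bbig[of "d * Bq"] bbig[of "5 / (\<delta> * d / 2)\<^sup>2"] asn eventually_gt_at_top[of 0]
    proof eventually_elim
      case (elim w)
      note w = elim(7) and N1 = elim(1)
      define b where "b = B w"
      define e where "e = (real (N w) + 1 / 2) * pi - b"
      define E where "E = e + 1 / b"
      define \<tau> where "\<tau> = sqrt (E / b)"
      define s where "s = \<sigma> w (N w)"
      have b10: "10 < b" and b30: "30 * n1\<^sup>2 < b" using elim by (auto simp: b_def)
      have Nm: "N w \<in> {1..N w}" using N1 by simp
      have e: "0 \<le> e" "e < pi"
        using mode_structure(1,2)[OF w] by (simp_all add: e_def b_def distrib_right)
      have E: "0 < E" "E \<le> 5" "1 / b \<le> E"
      proof -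
        have "1 / b \<le> 1" "0 < 1 / b" using b10 by auto
        then show "0 < E" "E \<le> 5" "1 / b \<le> E" using e pi_less_4 unfolding E_def by linarith+
      qed
      have \<tau>2: "\<tau>\<^sup>2 = E / b" using E b10 by (simp add: \<tau>_def)
      have \<tau>0: "0 < \<tau>" using E b10 by (simp add: \<tau>_def)
      have \<tau>1: "\<tau> \<le> 1"
      proof (rule power2_le_imp_le)
        show "\<tau>\<^sup>2 \<le> 1\<^sup>2" unfolding \<tau>2 using E b10 by (simp add: divide_le_eq)
      qed simp
      have \<tau>\<delta>: "\<tau> < \<delta> * d / 2"
      proof (rule power2_less_imp_less)
        have "5 < b * (\<delta> * d / 2)\<^sup>2" using elim(5) \<delta> d by (simp add: b_def divide_less_eq)
        then have "E < b * (\<delta> * d / 2)\<^sup>2" using E by linarith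
        then show "\<tau>\<^sup>2 < (\<delta> * d / 2)\<^sup>2" unfolding \<tau>2 using b10 by (simp add: divide_less_eq mult.commute)
      qed (use \<delta> d in simp)
      have \<tau>E: "\<tau> \<le> E"
      proof (rule power2_le_imp_le)
        have "E * (1 / b) \<le> E * E" using E by (intro mult_left_mono) auto
        then show "\<tau>\<^sup>2 \<le> E\<^sup>2" unfolding \<tau>2 by (simp add: power2_eq_square)
      qed (use E in simp)
      have s: "s = real (N w) * pi - arcsin (u w (N w))" "0 < s" "s < b"
        using mode_structure(3)[OF w Nm] by (auto simp: s_def b_def)
      have k0: "0 < wavenumber c w" by (rule k_pos[OF w N1])
      have kb: "wavenumber c w = b / (n1 * d * \<theta>)" by (simp add: wavenumber_eq b_def)
      define K where "K = (wavenumber c w)\<^sup>2"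
      have K0: "0 < K" using k0 by (simp add: K_def)
      have dK: "d\<^sup>2 * (n1\<^sup>2 * K) = b\<^sup>2 + d\<^sup>2 * K"
        using index_gt_1 unfolding b_def mode_bound_def power_mult_distrib theta_square K_def
        by (simp add: algebra_simps)
      \<comment> \<open>The ends of the window in \<open>\<eta>\<close>, and below the corresponding values of \<open>\<gamma>\<close>.\<close>
      define P R where "P = b + e + \<tau> / 2" and "R = b + e + \<tau>"
      have PR: "b < P" "P \<le> R" "R \<le> 2 * b" using e \<tau>0 \<tau>1 pi_less_4 b10 by (auto simp: P_def R_def)
      define g1 g2 where "g1 = K - (R\<^sup>2 - b\<^sup>2) / d\<^sup>2" and "g2 = K - (P\<^sup>2 - b\<^sup>2) / d\<^sup>2"
      have "b\<^sup>2 < P\<^sup>2" using PR b10 by (intro power_strict_mono) auto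
      then have g2: "g2 < K" using depth_pos by (simp add: g2_def)
      have g1: "0 < g1"
      proof -
        have "R\<^sup>2 - b\<^sup>2 = (e + \<tau>) * (R + b)" by (simp add: R_def power2_eq_square algebra_simps)
        also have "\<dots> \<le> (2 * 5) * (3 * b)" using e \<tau>0 \<tau>1 pi_less_4 b10 PR by (intro mult_mono) auto
        also have "\<dots> = 30 * b" by simp
        also have "\<dots> < d\<^sup>2 * K"
        proof -
          have "30 * n1\<^sup>2 * \<theta>\<^sup>2 \<le> 30 * n1\<^sup>2 * 1" using theta by (intro mult_left_mono power_le_one) auto
          then have "30 * n1\<^sup>2 * \<theta>\<^sup>2 < b" using b30 by simp
          then have "(30 * n1\<^sup>2 * \<theta>\<^sup>2) * b < b * b" using b10 by (intro mult_strict_right_mono) auto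
          moreover have "d\<^sup>2 * K * (n1\<^sup>2 * \<theta>\<^sup>2) = b * b"
            using depth_pos index_gt_1 theta by (simp add: K_def kb power2_eq_square)
          ultimately have "(30 * b) * (n1\<^sup>2 * \<theta>\<^sup>2) < (d\<^sup>2 * K) * (n1\<^sup>2 * \<theta>\<^sup>2)" by (simp add: mult_ac)
          then show ?thesis by (rule mult_right_less_imp_less) simp
        qed
        finally show ?thesis using depth_pos by (simp add: g1_def divide_less_eq mult.commute)
      qed
      have g12: "g2 - g1 = (R\<^sup>2 - P\<^sup>2) / d\<^sup>2" by (simp add: g1_def g2_def diff_divide_distrib)
      define m where "m = K / (4 * n1) * ((amp w (N w))\<^sup>2 * (d / pi * (1 / (10 * sqrt (b * E)))) / 4 * (S0 d g0 / 2) * lor)"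
      have m0: "0 \<le> m"
        unfolding m_def using K0 index_gt_1 depth_pos S0 lor E b10
        by (intro mult_nonneg_nonneg divide_nonneg_nonneg) auto
      have point: "m \<le> rad_rate w g" if g: "g \<in> {g1..g2}" for g
      proof -
        have gK: "g \<in> {0<..<(wavenumber c w)\<^sup>2}" using g g1 g2 by (auto simp: K_def)
        define h where "h = rad_eta d n1 c w g"
        define x where "x = rad_xi d c w g"
        have xh: "0 < x" "x \<le> h" "x\<^sup>2 = h\<^sup>2 - b\<^sup>2" "h\<^sup>2 = d\<^sup>2 * (n1\<^sup>2 * K - g)" "b \<le> h"
          using eta_xi[OF w N1 gK] by (simp_all only: x_def h_def K_def b_def)
        have h2: "h\<^sup>2 = b\<^sup>2 + d\<^sup>2 * (K - g)" unfolding xh(4) right_diff_distrib dK by simp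
        have "(R\<^sup>2 - b\<^sup>2) / d\<^sup>2 \<ge> K - g" "(P\<^sup>2 - b\<^sup>2) / d\<^sup>2 \<le> K - g" using g by (auto simp: g1_def g2_def)
        then have "d\<^sup>2 * (K - g) \<le> R\<^sup>2 - b\<^sup>2" "P\<^sup>2 - b\<^sup>2 \<le> d\<^sup>2 * (K - g)"
          using depth_pos by (simp_all add: le_divide_eq divide_le_eq mult.commute)
        then have "h\<^sup>2 \<le> R\<^sup>2" "P\<^sup>2 \<le> h\<^sup>2" unfolding h2 by simp_all
        then have hPR: "P \<le> h" "h \<le> R" using PR b10 xh by (auto intro: power2_le_imp_le)
        define t where "t = h - b - e"
        have t: "\<tau> / 2 \<le> t" "t \<le> \<tau>" "h = b + e + t" using hPR by (auto simp: t_def P_def R_def)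
        have "cos h = cos (real (N w) * pi + (pi / 2 + t))" by (simp add: t(3) e_def algebra_simps)
        also have "\<dots> = (-1) ^ N w * cos (pi / 2 + t)" by (simp add: cos_add)
        finally have "\<bar>cos h\<bar> = \<bar>sin t\<bar>" by (simp add: abs_mult cos_add)
        also have "\<dots> \<le> t" using abs_sin_x_le_abs_x[of t] t \<tau>0 by simp
        finally have ch: "\<bar>cos h\<bar> \<le> t" .
        have Dpos: "0 < x\<^sup>2 * (sin h)\<^sup>2 + h\<^sup>2 * (cos h)\<^sup>2"
        proof -
          have "0 < x\<^sup>2" using xh(1) by simp
          also have "x\<^sup>2 \<le> x\<^sup>2 * (sin h)\<^sup>2 + h\<^sup>2 * (cos h)\<^sup>2"
            using rad_amp_square(2)[OF w N1 gK] by (simp only: x_def h_def)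
          finally show ?thesis .
        qed
        have res: "1 / (10 * sqrt (b * E)) \<le> x / (x\<^sup>2 * (sin h)\<^sup>2 + h\<^sup>2 * (cos h)\<^sup>2)"
          unfolding t(3) E_def
        proof (rule resonance_lower_bound)
          show "x\<^sup>2 = (e + t) * (2 * b + e + t)" unfolding xh(3) t(3) by (simp add: power2_eq_square algebra_simps)
          show "0 < x\<^sup>2 * (sin (b + e + t))\<^sup>2 + (b + e + t)\<^sup>2 * (cos (b + e + t))\<^sup>2" using Dpos unfolding t(3) .
          show "\<bar>cos (b + e + t)\<bar> \<le> t" using ch unfolding t(3) .
          show "sqrt ((e + 1 / b) / b) / 2 \<le> t" "t \<le> sqrt ((e + 1 / b) / b)" using t by (simp_all only: \<tau>_def E_def)
          have "2 * E \<le> b" using E(2) b10 by linarith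
          then show "2 * (e + 1 / b) \<le> b" by (simp only: E_def)
          show "(sin (b + e + t))\<^sup>2 \<le> 1" using abs_sin_le_one by (simp add: abs_square_le_1)
        qed (use b10 e xh in auto)
        have A: "d / pi * (1 / (10 * sqrt (b * E))) \<le> (rad_amp d n1 c w g)\<^sup>2"
        proof -
          have "(rad_amp d n1 c w g)\<^sup>2 = d / pi * (x / (x\<^sup>2 * (sin h)\<^sup>2 + h\<^sup>2 * (cos h)\<^sup>2))"
            unfolding rad_amp_square(1)[OF w N1 gK] x_def h_def by simp
          then show ?thesis using mult_left_mono[OF res, of "d / pi"] depth_pos by simp
        qed
        have hs: "h - s = pi / 2 + arcsin (u w (N w)) + t" by (simp add: t(3) e_def s(1) algebra_simps)
        have hs2: "0 \<le> h - s" "h - s \<le> pi + 1"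
          using u_bounds(3,4)[OF w Nm] t \<tau>0 \<tau>1 unfolding hs by linarith+
        have Qlow: "S0 d g0 / 2 \<le> Qc s h"
        proof -
          have "\<bar>(h - s) - pi\<bar> < \<delta> * d"
            unfolding hs using elim(6) t \<tau>\<delta> \<tau>0 by (simp only: abs_less_iff) linarith
          then have "\<bar>(h - s) - pi\<bar> / d < \<delta>" using d by (simp add: divide_less_eq)
          then have "\<bar>(h - s) / d - pi / d\<bar> < \<delta>" using d by (simp add: diff_divide_distrib[symmetric])
          moreover have "Bq < (h + s) / d" using elim(4) xh(5) s d by (simp add: less_divide_eq b_def mult.commute)
          ultimately have "\<bar>Qc s h - S0 d g0\<bar> < S0 d g0 / 2" unfolding Qc_def by (rule near)
          then show ?thesis by linarith
        qed
        have \<beta>k: "wavenumber c w < \<beta> w (N w)" "\<beta> w (N w) \<le> n1 * wavenumber c w" using beta_gt_wavenumber[OF w Nm] by auto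
        have \<beta>0: "0 < \<beta> w (N w)" using \<beta>k k0 by linarith
        have sg: "0 < sqrt g" "sqrt g \<le> wavenumber c w" using gK k0 by (auto intro: real_le_lsqrt)
        have L: "lor \<le> a / (a\<^sup>2 + (sqrt g - \<beta> w (N w))\<^sup>2)"
        proof -
          have \<beta>2: "(\<beta> w (N w))\<^sup>2 = n1\<^sup>2 * K - s\<^sup>2 / d\<^sup>2"
          proof -
            have "s\<^sup>2 \<le> b\<^sup>2" using s by (intro power_mono) auto
            also have "\<dots> \<le> d\<^sup>2 * (n1\<^sup>2 * K)" unfolding dK using K0 by simp
            finally have "s\<^sup>2 / d\<^sup>2 \<le> n1\<^sup>2 * K" using depth_pos by (simp add: divide_le_eq mult.commute)
            then show ?thesis by (simp add: mode_beta_def K_def s_def)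
          qed
          have "g = n1\<^sup>2 * K - h\<^sup>2 / d\<^sup>2" unfolding xh(4) using depth_pos by simp
          then have "g - (\<beta> w (N w))\<^sup>2 = - ((h - s) * (h + s) / d\<^sup>2)"
          proof -
            have "(h - s) * (h + s) / d\<^sup>2 = h\<^sup>2 / d\<^sup>2 - s\<^sup>2 / d\<^sup>2"
              by (simp add: power2_eq_square diff_divide_distrib[symmetric] algebra_simps)
            then show ?thesis using \<open>g = n1\<^sup>2 * K - h\<^sup>2 / d\<^sup>2\<close> unfolding \<beta>2 by linarith
          qed
          moreover have "g - (\<beta> w (N w))\<^sup>2 = (sqrt g - \<beta> w (N w)) * (sqrt g + \<beta> w (N w))"
            using sg gK by (simp add: algebra_simps power2_eq_square)
          ultimately have eq: "\<bar>sqrt g - \<beta> w (N w)\<bar> * (sqrt g + \<beta> w (N w)) = (h - s) * (h + s) / d\<^sup>2"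
            using sg \<beta>0 hs2 s xh(5) b10
            by (smt (verit, best) abs_minus_cancel abs_mult abs_of_nonneg divide_nonneg_nonneg mult_nonneg_nonneg zero_le_power2)
          have "\<bar>sqrt g - \<beta> w (N w)\<bar> * wavenumber c w \<le> \<bar>sqrt g - \<beta> w (N w)\<bar> * (sqrt g + \<beta> w (N w))"
            by (intro mult_left_mono) (use sg \<beta>k in linarith, simp)
          also have "\<dots> \<le> (pi + 1) * (4 * b) / d\<^sup>2"
            unfolding eq using hs2 s hPR PR xh(5) b10 by (intro divide_right_mono mult_mono) auto
          also have "\<dots> = cc * wavenumber c w"
            using depth_pos index_gt_1 theta by (simp add: cc_def kb power2_eq_square field_simps)
          finally have "\<bar>sqrt g - \<beta> w (N w)\<bar> \<le> cc" using k0 by (rule mult_right_le_imp_le)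
          then have "(sqrt g - \<beta> w (N w))\<^sup>2 \<le> cc\<^sup>2" by (intro abs_le_square_iff[THEN iffD1]) auto
          then show ?thesis unfolding lor_def using a
            by (intro divide_left_mono mult_pos_pos) (auto simp: add_pos_nonneg)
        qed
        have Kk: "K / (4 * n1) \<le> (wavenumber c w) ^ 4 / (4 * sqrt g * \<beta> w (N w))"
        proof -
          have "K / (4 * n1) = (wavenumber c w) ^ 4 / (4 * wavenumber c w * (n1 * wavenumber c w))"
            using k0 by (simp add: K_def power2_eq_square power4_eq_xxxx)
          also have "\<dots> \<le> (wavenumber c w) ^ 4 / (4 * sqrt g * \<beta> w (N w))"
          proof (rule divide_left_mono)
            show "4 * sqrt g * \<beta> w (N w) \<le> 4 * wavenumber c w * (n1 * wavenumber c w)"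
              using sg \<beta>k \<beta>0 k0 by (intro mult_mono) auto
            show "0 \<le> (wavenumber c w) ^ 4" by simp
            show "0 < 4 * wavenumber c w * (n1 * wavenumber c w) * (4 * sqrt g * \<beta> w (N w))"
              using index_gt_1 by (intro mult_pos_pos k0 sg(1) \<beta>0) auto
          qed
          finally show ?thesis .
        qed
        have p1: "0 \<le> d / pi * (1 / (10 * sqrt (b * E)))" using depth_pos b10 E by simp
        have 1: "(amp w (N w))\<^sup>2 * (d / pi * (1 / (10 * sqrt (b * E)))) / 4 \<le> (amp w (N w))\<^sup>2 * (rad_amp d n1 c w g)\<^sup>2 / 4"
          by (rule divide_right_mono[OF mult_left_mono[OF A zero_le_power2]]) simp
        have p2: "0 \<le> (amp w (N w))\<^sup>2 * (rad_amp d n1 c w g)\<^sup>2 / 4" by simp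
        have p3: "0 \<le> S0 d g0 / 2" using S0 by simp
        have 2: "(amp w (N w))\<^sup>2 * (d / pi * (1 / (10 * sqrt (b * E)))) / 4 * (S0 d g0 / 2)
            \<le> (amp w (N w))\<^sup>2 * (rad_amp d n1 c w g)\<^sup>2 / 4 * Qc s h"
          by (rule mult_mono[OF 1 Qlow p2 p3])
        have 3: "(amp w (N w))\<^sup>2 * (d / pi * (1 / (10 * sqrt (b * E)))) / 4 * (S0 d g0 / 2) * lor
            \<le> (amp w (N w))\<^sup>2 * (rad_amp d n1 c w g)\<^sup>2 / 4 * Qc s h * (a / (a\<^sup>2 + (sqrt g - \<beta> w (N w))\<^sup>2))"
          by (rule mult_mono[OF 2 L mult_nonneg_nonneg[OF p2 Qc_bounds(1)] less_imp_le[OF lor]])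
        have p4: "0 \<le> (wavenumber c w) ^ 4 / (4 * sqrt g * \<beta> w (N w))" using sg \<beta>0 by simp
        have p5: "0 \<le> (amp w (N w))\<^sup>2 * (d / pi * (1 / (10 * sqrt (b * E)))) / 4 * (S0 d g0 / 2) * lor"
          by (intro mult_nonneg_nonneg divide_nonneg_nonneg[of _ 4] p1 p3 less_imp_le[OF lor] zero_le_power2) simp
        show ?thesis unfolding m_def rad_rate_def s_def[symmetric] h_def[symmetric]
          by (rule mult_mono[OF Kk 3 p4 p5])
      qed
      have g12': "g1 \<le> g2"
      proof -
        have "P\<^sup>2 \<le> R\<^sup>2" using PR b10 by (intro power_mono) auto
        then have "0 \<le> g2 - g1" unfolding g12 by simp
        then show ?thesis by simp
      qed
      have "m * (g2 - g1) \<le> \<Lambda> w (N w)"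
      proof -
        have "(LINT g:{0<..<K}|lborel. m * indicator {g1..g2} g) = (LINT g|lborel. indicator {g1..g2} g *\<^sub>R m)"
          unfolding set_lebesgue_integral_def
          by (intro Bochner_Integration.integral_cong refl) (use g1 g2 in \<open>auto simp: indicator_def\<close>)
        also have "\<dots> = m * (g2 - g1)" using g12' by simp
        finally have 1: "(LINT g:{0<..<K}|lborel. m * indicator {g1..g2} g) = m * (g2 - g1)" .
        have "(LINT g:{0<..<K}|lborel. m * indicator {g1..g2} g) \<le> (LINT g:{0<..<K}|lborel. rad_rate w g)"
        proof (rule set_integral_mono)
          show "set_integrable lborel {0<..<K} (rad_rate w)" unfolding K_def by (rule rad_rate_integrable[OF w N1])
          show "set_integrable lborel {0<..<K} (\<lambda>g. m * indicator {g1..g2} g)"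
            unfolding set_integrable_def
          proof (rule Bochner_Integration.integrable_bound)
            have "integrable lborel (indicator {g1..g2} :: real \<Rightarrow> real)"
              by (rule integrable_real_indicator) (auto simp: emeasure_lborel_Icc_eq)
            then show "integrable lborel (\<lambda>g. m * indicator {g1..g2} g)" by simp
          qed (auto simp: indicator_def)
          fix g assume "g \<in> {0<..<K}"
          then show "m * indicator {g1..g2} g \<le> rad_rate w g"
            using point[of g] rad_rate_nonneg[OF w N1, of g] by (auto simp: indicator_def K_def)
        qed
        then show ?thesis unfolding 1 Lambda_eq K_def[symmetric] .
      qed
      moreover have "\<kappa> * ((B w)\<^sup>2 * (amp w (N w))\<^sup>2) \<le> m * (g2 - g1)"
      proof -
        have bt: "b * \<tau> = sqrt (b * E)"
          using b10 E by (simp add: \<tau>_def real_sqrt_mult real_sqrt_divide field_simps)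
        have "b * \<tau> \<le> (\<tau> / 2) * (R + P)"
        proof -
          have "\<tau> * (2 * b) \<le> \<tau> * (R + P)" using \<tau>0 PR by (intro mult_left_mono) auto
          then show ?thesis by (simp add: mult_ac)
        qed
        also have "\<dots> = R\<^sup>2 - P\<^sup>2" by (simp add: P_def R_def power2_eq_square field_simps)
        finally have "sqrt (b * E) / d\<^sup>2 \<le> g2 - g1" unfolding g12 bt by (rule divide_right_mono) simp
        then have "m * (sqrt (b * E) / d\<^sup>2) \<le> m * (g2 - g1)" using m0 by (rule mult_left_mono)
        moreover have "m * (sqrt (b * E) / d\<^sup>2) = \<kappa> * (b\<^sup>2 * (amp w (N w))\<^sup>2)"
        proof -
          have r: "0 < sqrt (b * E)" using b10 E by simp
          have K: "K = b\<^sup>2 * (1 / (n1 * d * \<theta>)\<^sup>2)" by (simp add: K_def kb power_divide)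
          have scale: "k1 * q / (4 * n) * (X * (d / p * (1 / (10 * r))) / 4 * y * l) * (r / d\<^sup>2)
              = q / (4 * n) * (1 / (10 * p * d) / 4 * y * l) * (k1 * X)"
            if "r \<noteq> 0" "n \<noteq> 0" "p \<noteq> 0" for k1 q n X p r y l :: real
            using that depth_pos by (simp add: power2_eq_square field_simps)
          show ?thesis unfolding m_def \<kappa>_def K by (rule scale) (use r b10 E index_gt_1 in auto)
        qed
        ultimately show ?thesis by (simp add: b_def)
      qed
      ultimately show ?case by linarith
    qed
  qed
qed

end

section \<open>The mode powers as a chain\<close>

context ocean begin

lemma a_infty_denominator_pos:
  assumes "v \<in> {0..1}"
  shows "0 < 1 - (1 - pi\<^sup>2 / (a\<^sup>2 * d\<^sup>2)) * (\<theta> * v)\<^sup>2"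
proof -
  have "(\<theta> * v)\<^sup>2 \<le> \<theta>\<^sup>2 * 1" unfolding power_mult_distrib
    using assms by (intro mult_left_mono power_le_one) auto
  then have "(\<theta> * v)\<^sup>2 < 1" using index_gt_1 by (simp add: theta_square) (smt (verit) zero_less_power divide_pos_pos)
  moreover have "0 \<le> pi\<^sup>2 / (a\<^sup>2 * d\<^sup>2) * (\<theta> * v)\<^sup>2" by simp
  ultimately show ?thesis unfolding left_diff_distrib mult_1_left by linarith
qed

lemma S0_pos:
  assumes "solves_diffusion (a_infty d n1 a g0) T1"
  shows "0 < S0 d g0"
proof (rule ccontr)
  assume "\<not> 0 < S0 d g0"
  then have "S0 d g0 = 0" using Q_nonneg[of "\<lambda>x. cos (pi / d * x)"] by (simp add: S0_eq_Q)
  then have "a_infty d n1 a g0 v = 0" for v by (simp add: a_infty_def a_zero_def)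
  then show False using diffusion_coefficient_nonzero assms by blast
qed

lemma a_infty_pos:
  assumes "0 < S0 d g0" "v \<in> {0..1}"
  shows "0 < a_infty d n1 a g0 v"
  unfolding a_infty_def a_zero_def
  using a_infty_denominator_pos[OF assms(2)] assms(1) a depth_pos index_gt_1 theta by (intro divide_pos_pos mult_pos_pos) auto

lemma a_infty_continuous: "continuous_on {0..1} (a_infty d n1 a g0)"
  unfolding a_infty_def
  by (intro continuous_intros) (use a_infty_denominator_pos in fastforce)

definition coupling :: "real \<Rightarrow> nat \<Rightarrow> real" where
  "coupling w j = (if j = 0 then 0 else if j < N w then \<Gamma> w (Suc j) j else \<Lambda> w (N w))"

lemma Gamma_next_nonneg:
  assumes "0 < w" "1 \<le> j" "j < N w"
  shows "0 \<le> \<Gamma> w (Suc j) j"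
proof -
  have "0 \<le> \<Gamma> w (Suc j) j / (real (N w))\<^sup>2"
    unfolding Gamma_next_eq[OF assms] by (intro mult_nonneg_nonneg bulk_rate_bounds(1)[OF assms] zero_le_power2)
  moreover have "0 < (real (N w))\<^sup>2" using assms by simp
  ultimately show ?thesis by (simp add: zero_le_divide_iff)
qed

lemma Lambda_nonneg: "0 < w \<Longrightarrow> 1 \<le> N w \<Longrightarrow> 0 \<le> \<Lambda> w (N w)"
  unfolding Lambda_eq set_lebesgue_integral_def
  by (intro Bochner_Integration.integral_nonneg) (auto simp: indicator_def rad_rate_nonneg)

lemma coupling_nonneg: "0 < w \<Longrightarrow> 1 \<le> N w \<Longrightarrow> 0 \<le> coupling w j"
  using Gamma_next_nonneg Lambda_nonneg by (simp add: coupling_def)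

text \<open>
  Uniformity in \<open>j\<close> is convergence along the filter of pairs \<open>(w, j)\<close> with both components large and
  \<open>j + 2 \<le> N\<close>; by \<open>tendsto_zero_by_clusters\<close> the ratio \<open>j / N\<close> may be assumed to converge.
\<close>

lemma coupling_bulk:
  assumes F: "F \<le> at_top" and \<epsilon>: "0 < \<epsilon>"
  shows "\<exists>J. \<forall>\<^sub>F w in F. \<forall>j. J \<le> j \<longrightarrow> j + 2 \<le> N w \<longrightarrow>
      \<bar>coupling w j / (real (N w))\<^sup>2 - a_infty d n1 a g0 (real j / real (N w))\<bar> \<le> \<epsilon>"
proof -
  define \<F> where "\<F> = inf (inf (filtercomap fst F) (filtercomap snd at_top)) (principal {(w, j). j + 2 \<le> N w})"
  define Z where "Z p = coupling (fst p) (snd p) / (real (N (fst p)))\<^sup>2 - a_infty d n1 a g0 (real (snd p) / real (N (fst p)))"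
    for p :: "real \<times> nat"
  have fstF: "filterlim fst F \<F>"
    by (rule filterlim_mono[OF filterlim_filtercomap order_refl]) (simp add: \<F>_def le_infI1)
  then have W0: "filterlim fst at_top \<F>" using F by (rule filterlim_mono) simp
  have sndF: "filterlim snd at_top \<F>"
    by (rule filterlim_mono[OF filterlim_filtercomap order_refl]) (simp add: \<F>_def le_infI1)
  have range: "\<forall>\<^sub>F p in \<F>. snd p + 2 \<le> N (fst p)"
    unfolding \<F>_def by (auto simp: eventually_inf_principal intro!: always_eventually)
  have "(Z \<longlongrightarrow> 0) \<F>"
  proof (rule tendsto_zero_by_clusters)
    show "\<forall>\<^sub>F p in \<F>. real (snd p) / real (N (fst p)) \<in> {0..1}"
      using range by eventually_elim (auto simp: divide_le_eq)
    fix G v assume G: "G \<le> \<F>" and v: "v \<in> {0..1}" "((\<lambda>p. real (snd p) / real (N (fst p))) \<longlongrightarrow> v) G"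
    have W: "filterlim fst at_top G" using W0 G by (rule filterlim_mono[OF _ order_refl])
    have sndG: "filterlim snd at_top G" using sndF G by (rule filterlim_mono[OF _ order_refl])
    have rangeG: "\<forall>\<^sub>F p in G. snd p + 2 \<le> N (fst p)" using range G by (rule filter_leD[rotated])
    have pos: "\<forall>\<^sub>F p in G. 1 \<le> snd p" using sndG by (simp add: filterlim_at_top)
    have w0: "\<forall>\<^sub>F p in G. 0 < fst p" using W by (simp add: filterlim_at_top_dense)
    have J1: "\<forall>\<^sub>F p in G. 1 \<le> snd p \<and> snd p < N (fst p)"
      using rangeG pos by eventually_elim auto
    have J2: "\<forall>\<^sub>F p in G. 1 \<le> Suc (snd p) \<and> Suc (snd p) < N (fst p)"
      using rangeG pos by eventually_elim auto
    have sig: "filterlim (\<lambda>p. \<sigma> (fst p) (snd p)) at_top G"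
    proof (rule filterlim_at_top_mono)
      show "filterlim (\<lambda>p. real (snd p)) at_top G" by (rule filterlim_compose[OF filterlim_real_sequentially sndG])
      show "\<forall>\<^sub>F p in G. real (snd p) \<le> \<sigma> (fst p) (snd p)"
        using J1 w0
      proof eventually_elim
        case (elim p)
        have "real (snd p) \<le> (real (snd p) - 1 / 2) * 2" using elim by simp
        also have "\<dots> \<le> (real (snd p) - 1 / 2) * pi"
          using elim pi_ge_two by (intro mult_left_mono) auto
        also have "\<dots> = real (snd p) * pi - pi / 2" by (simp add: left_diff_distrib)
        also have "\<dots> < \<sigma> (fst p) (snd p)" by (rule sigma_bounds) (use elim in auto)
        finally show ?case by simp
      qed
    qed
    have "((\<lambda>p. (amp (fst p) (snd p))\<^sup>2 * (amp (fst p) (Suc (snd p)))\<^sup>2 * bulk_rate (fst p) (snd p))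
        \<longlongrightarrow> 2 / d * (2 / d) * (a_infty d n1 a g0 v * (d / 2)\<^sup>2)) G"
      by (intro tendsto_mult amp_square_tendsto[OF W J1] amp_square_tendsto[OF W J2] bulk_rate_tendsto[OF W J1 v(2,1) sig])
    also have "2 / d * (2 / d) * (a_infty d n1 a g0 v * (d / 2)\<^sup>2) = a_infty d n1 a g0 v"
      using depth_pos by (simp add: power2_eq_square)
    finally have "((\<lambda>p. (amp (fst p) (snd p))\<^sup>2 * (amp (fst p) (Suc (snd p)))\<^sup>2 * bulk_rate (fst p) (snd p)) \<longlongrightarrow> a_infty d n1 a g0 v) G" .
    moreover have "\<forall>\<^sub>F p in G. (amp (fst p) (snd p))\<^sup>2 * (amp (fst p) (Suc (snd p)))\<^sup>2 * bulk_rate (fst p) (snd p)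
        = coupling (fst p) (snd p) / (real (N (fst p)))\<^sup>2"
      using J1 w0
    proof eventually_elim
      case (elim p)
      then show ?case using Gamma_next_eq[of "fst p" "snd p"] by (simp add: coupling_def)
    qed
    ultimately have "((\<lambda>p. coupling (fst p) (snd p) / (real (N (fst p)))\<^sup>2) \<longlongrightarrow> a_infty d n1 a g0 v) G"
      by (rule Lim_transform_eventually)
    moreover have "((\<lambda>p. a_infty d n1 a g0 (real (snd p) / real (N (fst p)))) \<longlongrightarrow> a_infty d n1 a g0 v) G"
      by (rule continuous_on_tendsto_compose[OF a_infty_continuous v(2,1)])
         (use rangeG in \<open>eventually_elim, auto simp: divide_le_eq\<close>)
    ultimately have "(Z \<longlongrightarrow> a_infty d n1 a g0 v - a_infty d n1 a g0 v) G" unfolding Z_def by (rule tendsto_diff)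
    then show "(Z \<longlongrightarrow> 0) G" by simp
  qed
  from tendstoD[OF this \<epsilon>] have "\<forall>\<^sub>F p in \<F>. \<bar>Z p\<bar> \<le> \<epsilon>"
    by (rule eventually_mono) (simp add: dist_real_def)
  then have "\<forall>\<^sub>F p in inf (filtercomap fst F) (filtercomap snd at_top). p \<in> {(w, j). j + 2 \<le> N w} \<longrightarrow> \<bar>Z p\<bar> \<le> \<epsilon>"
    unfolding \<F>_def eventually_inf_principal .
  then obtain P Q where PQ: "eventually P (filtercomap fst F)" "eventually Q (filtercomap snd at_top)"
      "\<And>p. P p \<Longrightarrow> Q p \<Longrightarrow> p \<in> {(w, j). j + 2 \<le> N w} \<longrightarrow> \<bar>Z p\<bar> \<le> \<epsilon>"
    unfolding eventually_inf by (elim exE conjE) (rule that, assumption, assumption, drule spec, erule mp, rule conjI, assumption+)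
  from PQ(1) obtain P' where P': "eventually P' F" "\<And>p. P' (fst p) \<Longrightarrow> P p" unfolding eventually_filtercomap by blast
  from PQ(2) obtain Q' where Q': "eventually Q' at_top" "\<And>p. Q' (snd p) \<Longrightarrow> Q p" unfolding eventually_filtercomap by blast
  from Q'(1) obtain J where J: "\<And>j. J \<le> j \<Longrightarrow> Q' j" unfolding eventually_at_top_linorder by blast
  show ?thesis
  proof (intro exI[of _ J] eventually_mono[OF P'(1)] allI impI)
    fix w j assume "P' w" "J \<le> j" "j + 2 \<le> N w"
    then have "\<bar>Z (w, j)\<bar> \<le> \<epsilon>" using PQ(3)[of "(w, j)"] P'(2)[of "(w, j)"] Q'(2)[of "(w, j)"] J[of j] by simp
    then show "\<bar>coupling w j / (real (N w))\<^sup>2 - a_infty d n1 a g0 (real j / real (N w))\<bar> \<le> \<epsilon>" by (simp add: Z_def)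
  qed
qed

lemma coupling_upper:
  assumes w: "0 < w" and j: "j \<in> {1..<N w}"
  shows "coupling w j \<le> ((2 / d)\<^sup>2 * bulk_rate_bound) * (real (N w))\<^sup>2"
proof -
  have j': "1 \<le> j" "j < N w" using j by auto
  have jm: "j \<in> {1..N w}" "Suc j \<in> {1..N w}" using j by auto
  have "\<Gamma> w (Suc j) j / (real (N w))\<^sup>2 \<le> (2 / d) * (2 / d) * bulk_rate_bound"
    unfolding Gamma_next_eq[OF w j'] using amp_square_bounds[OF w jm(1)] amp_square_bounds[OF w jm(2)] bulk_rate_bounds[OF w j'] depth_pos
    by (intro mult_mono) auto
  moreover have "0 < (real (N w))\<^sup>2" using j by simp
  ultimately show ?thesis using j by (simp add: coupling_def divide_le_eq power2_eq_square)
qed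

text \<open>
  Here the definition of the continuum limit enters: \<open>A\<^sub>N\<^sup>2\<close> is comparable to \<open>\<zeta>\<^sub>N\<close> when \<open>\<zeta>\<^sub>N\<close> is small,
  and bounded below otherwise.
\<close>

lemma N_amp_square_at_top:
  assumes F: "F \<le> at_top" and cut: "filterlim (\<lambda>w. real (N w) * \<zeta> w (N w)) at_top F"
  shows "filterlim (\<lambda>w. real (N w) * (amp w (N w))\<^sup>2) at_top F"
proof -
  have W: "filterlim (\<lambda>w. w) at_top F" using F by (simp add: filterlim_def filtermap_ident)
  have NF: "filterlim N at_top F" by (rule filterlim_compose[OF N_at_top W])
  have NrF: "filterlim (\<lambda>w. real (N w)) at_top F" by (rule filterlim_compose[OF filterlim_real_sequentially NF])
  show ?thesis
    unfolding filterlim_at_top_dense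
  proof
    fix x :: real
    define y where "y = d * \<bar>x\<bar> + 1"
    have y: "0 < y" using depth_pos by (simp add: y_def add_nonneg_pos)
    have "\<forall>\<^sub>F w in F. y < real (N w)" "\<forall>\<^sub>F w in F. y < real (N w) * \<zeta> w (N w)" "\<forall>\<^sub>F w in F. 0 < w"
      using NrF cut W unfolding filterlim_at_top_dense by auto
    then show "\<forall>\<^sub>F w in F. x < real (N w) * (amp w (N w))\<^sup>2"
    proof eventually_elim
      case (elim w)
      have "0 < real (N w)" using elim y by linarith
      then have Nm: "N w \<in> {1..N w}" by simp
      define z where "z = \<zeta> w (N w)"
      have z: "0 < z" using zeta_square(2)[OF elim(3) Nm] by (simp add: z_def)
      have "y / 2 \<le> real (N w) * (z / (z + 1))"
      proof (cases "1 \<le> z")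
        case True
        then have "1 / 2 \<le> z / (z + 1)" by (simp add: field_simps)
        then have "y * (1 / 2) \<le> real (N w) * (z / (z + 1))" using elim y by (intro mult_mono) auto
        then show ?thesis by simp
      next
        case False
        then have "z / 2 \<le> z / (z + 1)" using z by (intro divide_left_mono) auto
        then have "real (N w) * (z / 2) \<le> real (N w) * (z / (z + 1))" by (intro mult_left_mono) auto
        then show ?thesis using elim(2) by (simp add: z_def)
      qed
      then have "2 / d * (y / 2) \<le> 2 / d * (real (N w) * (z / (z + 1)))" using depth_pos by (intro mult_left_mono) auto
      also have "\<dots> = real (N w) * (amp w (N w))\<^sup>2" using amp_square[OF elim(3) Nm] by (simp add: z_def)
      also have "2 / d * (y / 2) = \<bar>x\<bar> + 1 / d" using depth_pos by (simp add: y_def field_simps)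
      moreover have "0 < 1 / d" using depth_pos by simp
      ultimately show ?case by linarith
    qed
  qed
qed

text \<open>
  Divided by \<open>N\<close>, either rate is at least a factor with positive limit times \<open>N A\<^sub>N\<^sup>2\<close>.
\<close>

lemma coupling_last:
  assumes S0: "0 < S0 d g0" and F: "F \<le> at_top" and cut: "filterlim (\<lambda>w. real (N w) * \<zeta> w (N w)) at_top F"
  shows "filterlim (\<lambda>w. coupling w (N w - 1) / real (N w)) at_top F"
    and "filterlim (\<lambda>w. coupling w (N w) / real (N w)) at_top F"
proof -
  have W: "filterlim (\<lambda>w. w) at_top F" using F by (simp add: filterlim_def filtermap_ident)
  have NF: "filterlim N at_top F" by (rule filterlim_compose[OF N_at_top W])
  have w0: "\<forall>\<^sub>F w in F. 0 < w" using W by (simp add: filterlim_at_top_dense)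
  have N2: "\<forall>\<^sub>F w in F. 2 \<le> N w" using NF by (simp add: filterlim_at_top)
  note NA = N_amp_square_at_top[OF F cut]
  have J: "\<forall>\<^sub>F w in F. 1 \<le> N w - 1 \<and> N w - 1 < N w" using N2 by eventually_elim auto
  have invN: "((\<lambda>w. 1 / real (N w)) \<longlongrightarrow> 0) F"
    by (rule tendsto_divide_0[OF tendsto_const])
       (rule filterlim_compose[OF filterlim_at_top_imp_at_infinity[OF filterlim_real_sequentially] NF])
  have "((\<lambda>w. 1 - 1 / real (N w)) \<longlongrightarrow> 1 - 0) F" by (intro tendsto_diff tendsto_const invN)
  then have "((\<lambda>w. 1 - 1 / real (N w)) \<longlongrightarrow> 1) F" by simp
  moreover have "\<forall>\<^sub>F w in F. 1 - 1 / real (N w) = real (N w - 1) / real (N w)"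
    using N2 by eventually_elim (simp add: of_nat_diff diff_divide_distrib)
  ultimately have v: "((\<lambda>w. real (N w - 1) / real (N w)) \<longlongrightarrow> 1) F" by (rule Lim_transform_eventually)
  have sig: "filterlim (\<lambda>w. \<sigma> w (N w - 1)) at_top F"
  proof (rule filterlim_at_top_mono)
    show "filterlim (\<lambda>w. - 2 + real (N w)) at_top F"
      by (intro filterlim_tendsto_add_at_top[OF tendsto_const] filterlim_compose[OF filterlim_real_sequentially NF])
    show "\<forall>\<^sub>F w in F. - 2 + real (N w) \<le> \<sigma> w (N w - 1)"
      using w0 N2
    proof eventually_elim
      case (elim w)
      have "- 2 + real (N w) \<le> (real (N w) - 3 / 2) * 1" by simp
      also have "\<dots> \<le> (real (N w) - 3 / 2) * pi" using elim pi_ge_two by (intro mult_left_mono) auto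
      also have "\<dots> = real (N w - 1) * pi - pi / 2" using elim by (simp add: of_nat_diff algebra_simps)
      also have "\<dots> < \<sigma> w (N w - 1)" by (rule sigma_bounds) (use elim in auto)
      finally show ?case by simp
    qed
  qed
  have "((\<lambda>w. (amp w (N w - 1))\<^sup>2 * bulk_rate w (N w - 1)) \<longlongrightarrow> 2 / d * (a_infty d n1 a g0 1 * (d / 2)\<^sup>2)) F"
    by (intro tendsto_mult amp_square_tendsto[OF W J] bulk_rate_tendsto[OF W J v _ sig]) auto
  moreover have "0 < 2 / d * (a_infty d n1 a g0 1 * (d / 2)\<^sup>2)"
    using a_infty_pos[OF S0, of 1] depth_pos by (intro mult_pos_pos) auto
  ultimately have "filterlim (\<lambda>w. ((amp w (N w - 1))\<^sup>2 * bulk_rate w (N w - 1)) * (real (N w) * (amp w (N w))\<^sup>2)) at_top F"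
    by (rule filterlim_tendsto_pos_mult_at_top[OF _ _ NA])
  then show "filterlim (\<lambda>w. coupling w (N w - 1) / real (N w)) at_top F"
  proof (rule filterlim_at_top_mono)
    show "\<forall>\<^sub>F w in F. ((amp w (N w - 1))\<^sup>2 * bulk_rate w (N w - 1)) * (real (N w) * (amp w (N w))\<^sup>2) \<le> coupling w (N w - 1) / real (N w)"
      using w0 N2
    proof eventually_elim
      case (elim w)
      define j where "j = N w - 1"
      have j: "1 \<le> j" "j < N w" "Suc j = N w" "0 < real (N w)" using elim by (auto simp: j_def)
      have "coupling w j / real (N w) = real (N w) * (\<Gamma> w (Suc j) j / (real (N w))\<^sup>2)"
        using j by (simp add: coupling_def power2_eq_square)
      also have "\<dots> = ((amp w j)\<^sup>2 * bulk_rate w j) * (real (N w) * (amp w (N w))\<^sup>2)"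
        by (simp only: Gamma_next_eq[OF elim(1) j(1,2)]) (simp add: j(3) mult_ac)
      finally show ?case by (simp add: j_def)
    qed
  qed
  obtain \<kappa> where \<kappa>: "0 < \<kappa>" "\<forall>\<^sub>F w in at_top. \<kappa> * ((B w)\<^sup>2 * (amp w (N w))\<^sup>2) \<le> \<Lambda> w (N w)"
    using Lambda_lower_bound[OF S0] by blast
  have \<kappa>F: "\<forall>\<^sub>F w in F. \<kappa> * ((B w)\<^sup>2 * (amp w (N w))\<^sup>2) \<le> \<Lambda> w (N w)"
    using \<kappa>(2) F by (rule filter_leD[rotated])
  have "((\<lambda>w. \<kappa> * (B w / real (N w))\<^sup>2) \<longlongrightarrow> \<kappa> * pi\<^sup>2) F"
    by (intro tendsto_intros B_over_N_tendsto[OF W])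
  then have "filterlim (\<lambda>w. (\<kappa> * (B w / real (N w))\<^sup>2) * (real (N w) * (amp w (N w))\<^sup>2)) at_top F"
    by (rule filterlim_tendsto_pos_mult_at_top[OF _ _ NA]) (use \<kappa> in simp)
  then show "filterlim (\<lambda>w. coupling w (N w) / real (N w)) at_top F"
  proof (rule filterlim_at_top_mono)
    show "\<forall>\<^sub>F w in F. (\<kappa> * (B w / real (N w))\<^sup>2) * (real (N w) * (amp w (N w))\<^sup>2) \<le> coupling w (N w) / real (N w)"
      using \<kappa>F N2
    proof eventually_elim
      case (elim w)
      have n: "0 < real (N w)" using elim by simp
      have "(\<kappa> * (B w / real (N w))\<^sup>2) * (real (N w) * (amp w (N w))\<^sup>2) = \<kappa> * ((B w)\<^sup>2 * (amp w (N w))\<^sup>2) / real (N w)"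
        using n by (simp add: power2_eq_square)
      also have "\<dots> \<le> \<Lambda> w (N w) / real (N w)" using elim n by (intro divide_right_mono) auto
      finally show ?case using n by (simp add: coupling_def)
    qed
  qed
qed

text \<open>
  The extension by \<open>0\<close> supplies the empty site \<open>N + 1\<close>.
\<close>

definition chain :: "(nat \<Rightarrow> nat \<Rightarrow> real \<Rightarrow> real) \<Rightarrow> real \<Rightarrow> nat \<Rightarrow> nat \<Rightarrow> real \<Rightarrow> real" where
  "chain T w l j z = (if j \<in> {1..N w} then T l j z else 0)"

lemma chain_of_coupled_power:
  assumes T: "solves_coupled_power M V d n1 c w T" and N3: "3 \<le> N w" and l: "l \<in> {1..N w}"
  shows "chain_solution (N w) (coupling w) (chain T w l)"
  unfolding chain_solution_def
proof (intro conjI allI ballI impI)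
  fix z :: real assume "0 \<le> z"
  show "chain T w l (Suc (N w)) z = 0" by (simp add: chain_def)
next
  fix j z assume j: "j \<in> {1..N w}" and z: "(0::real) \<le> z"
  have eqs: "(T l (N w) has_real_derivative
              (- \<Lambda> w (N w) * T l (N w) z + \<Gamma> w (N w - 1) (N w) * (T l (N w - 1) z - T l (N w) z))) (at z within {0..})"
           "\<And>j. j\<in>{2..N w - 1} \<Longrightarrow>
              (T l j has_real_derivative
                 (\<Gamma> w (j - 1) j * (T l (j - 1) z - T l j z)
                  + \<Gamma> w (j + 1) j * (T l (j + 1) z - T l j z))) (at z within {0..})"
           "(T l 1 has_real_derivative
              (\<Gamma> w 2 1 * (T l 2 z - T l 1 z))) (at z within {0..})"
    using T l z unfolding solves_coupled_power_def Let_def by blast+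
  have ch: "chain T w l j = T l j" using j by (simp add: chain_def fun_eq_iff)
  have prev: "\<Gamma> w (j - 1) j = coupling w (j - 1)" if "2 \<le> j"
    using that j Gamma_commute[of w "j - 1" j] by (auto simp: coupling_def)
  consider "j = 1" | "j = N w" | "j \<in> {2..N w - 1}" using j by force
  then show "(chain T w l j has_real_derivative
      coupling w j * (chain T w l (Suc j) z - chain T w l j z) - coupling w (j - 1) * (chain T w l j z - chain T w l (j - 1) z))
      (at z within {0..})"
  proof cases
    case 1
    have "coupling w 1 = \<Gamma> w 2 1" using N3 by (simp add: coupling_def numeral_2_eq_2)
    moreover have "coupling w 0 = 0" by (simp add: coupling_def)
    moreover have "chain T w l 2 = T l 2" using N3 by (simp add: chain_def fun_eq_iff)
    ultimately show ?thesis using eqs(3) 1 ch by (simp add: numeral_2_eq_2)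
  next
    case 2
    have "coupling w (N w) = \<Lambda> w (N w)" using N3 by (simp add: coupling_def)
    moreover have "chain T w l (N w - 1) = T l (N w - 1)" "chain T w l (Suc (N w)) z = 0" using N3 by (auto simp: chain_def fun_eq_iff)
    ultimately show ?thesis using eqs(1) 2 ch prev N3 by (simp add: algebra_simps)
  next
    case 3
    have "coupling w j = \<Gamma> w (j + 1) j" using 3 by (auto simp: coupling_def)
    moreover have "chain T w l (j - 1) = T l (j - 1)" "chain T w l (Suc j) = T l (Suc j)" using 3 by (auto simp: chain_def fun_eq_iff)
    ultimately show ?thesis using eqs(2)[OF 3] ch prev 3 by (simp add: algebra_simps)
  qed
qed

end

section \<open>The refocused profile\<close>

context ocean begin

lemma amp_square_deviation:
  assumes w: "0 < w" and j: "1 \<le> j" "j < N w" and B: "pi < B w"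
  shows "\<bar>(amp w j)\<^sup>2 - 2 / d\<bar> \<le> 2 / d / sqrt (pi / 2 * (B w - pi))"
proof -
  have jm: "j \<in> {1..N w}" using j by auto
  have z: "0 < \<zeta> w j" by (rule zeta_square(2)[OF w jm])
  have "0 < pi / 2 * (B w - pi)" using B by simp
  moreover have "sqrt (pi / 2 * (B w - pi)) \<le> \<zeta> w j" using zeta_bulk[OF w j] z by (intro real_le_lsqrt) auto
  ultimately have r: "0 < sqrt (pi / 2 * (B w - pi))" "sqrt (pi / 2 * (B w - pi)) \<le> \<zeta> w j + 1" by auto
  have "\<zeta> w j / (\<zeta> w j + 1) = 1 - 1 / (\<zeta> w j + 1)" using z by (simp add: field_simps)
  then have "(amp w j)\<^sup>2 - 2 / d = - (2 / d / (\<zeta> w j + 1))"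
    unfolding amp_square[OF w jm] by (simp add: right_diff_distrib)
  then have "\<bar>(amp w j)\<^sup>2 - 2 / d\<bar> = 2 / d / (\<zeta> w j + 1)" using z depth_pos by simp
  also have "\<dots> \<le> 2 / d / sqrt (pi / 2 * (B w - pi))"
    using r z depth_pos by (intro divide_left_mono mult_pos_pos) auto
  finally show ?thesis .
qed

lemma amp_square_dev_bounded:
  assumes "0 < w" "j \<in> {1..N w}"
  shows "\<bar>(amp w j)\<^sup>2 - 2 / d\<bar> \<le> 2 / d"
  using amp_square_bounds[OF assms] by linarith

lemma amp_square_average:
  assumes F: "F \<le> at_top"
  shows "((\<lambda>w. (\<Sum>j=1..N w. \<bar>(amp w j)\<^sup>2 - 2 / d\<bar>) / real (N w)) \<longlongrightarrow> 0) F"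
proof (rule average_tendsto_zero)
  have W: "filterlim (\<lambda>w. w) at_top F" using F by (simp add: filterlim_def filtermap_ident)
  show "filterlim N at_top F" by (rule filterlim_compose[OF N_at_top W])
  have w0: "\<forall>\<^sub>F w in F. 0 < w" using W by (simp add: filterlim_at_top_dense)
  have BF: "filterlim B at_top F" by (rule filterlim_compose[OF B_at_top W])
  show "\<forall>\<^sub>F w in F. \<forall>j\<in>{1..N w}. \<bar>(amp w j)\<^sup>2 - 2 / d\<bar> \<le> 2 / d"
    using w0 by eventually_elim (use amp_square_dev_bounded in blast)
  fix \<eta> \<epsilon> :: real assume \<epsilon>: "0 < \<epsilon>"
  have "filterlim (\<lambda>w. sqrt (pi / 2 * (- pi + B w))) at_top F"
    by (intro filterlim_compose[OF sqrt_at_top] filterlim_tendsto_pos_mult_at_top[OF tendsto_const]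
        filterlim_tendsto_add_at_top[OF tendsto_const] BF) simp
  then have "((\<lambda>w. 2 / d / sqrt (pi / 2 * (- pi + B w))) \<longlongrightarrow> 0) F"
    by (intro tendsto_divide_0[OF tendsto_const] filterlim_at_top_imp_at_infinity)
  then have "\<forall>\<^sub>F w in F. 2 / d / sqrt (pi / 2 * (- pi + B w)) < \<epsilon>" using \<epsilon> by (rule order_tendstoD(2))
  moreover have "\<forall>\<^sub>F w in F. pi < B w" using BF by (simp add: filterlim_at_top_dense)
  ultimately show "\<forall>\<^sub>F w in F. \<forall>j. 1 \<le> j \<longrightarrow> j < N w \<longrightarrow> \<eta> * real (N w) \<le> real j \<longrightarrow> \<bar>(amp w j)\<^sup>2 - 2 / d\<bar> \<le> \<epsilon>"
    using w0
  proof eventually_elim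
    case (elim w)
    have "2 / d / sqrt (pi / 2 * (B w - pi)) < \<epsilon>" using elim(1) by simp
    then show ?case using amp_square_deviation[OF elim(3) _ _ elim(2)] by (meson less_imp_le order_trans)
  qed
qed

text \<open>
  For \<open>j \<ge> \<eta> N\<close> the argument \<open>\<sigma>\<^sub>j \<delta>\<close> is at least \<open>\<eta> N \<delta>\<close>, which tends to infinity.
\<close>

lemma sinc_average:
  assumes F: "F \<le> at_top" and \<delta>: "filterlim (\<lambda>w. real (N w) * \<delta> w) at_top F"
  shows "((\<lambda>w. (\<Sum>j=1..N w. \<bar>sinc (\<sigma> w j * \<delta> w)\<bar>) / real (N w)) \<longlongrightarrow> 0) F"
proof (rule average_tendsto_zero)
  have W: "filterlim (\<lambda>w. w) at_top F" using F by (simp add: filterlim_def filtermap_ident)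
  show "filterlim N at_top F" by (rule filterlim_compose[OF N_at_top W])
  have w0: "\<forall>\<^sub>F w in F. 0 < w" using W by (simp add: filterlim_at_top_dense)
  have sinc1: "\<bar>sinc x\<bar> \<le> 1" for x
    using abs_sin_x_le_abs_x[of x] by (simp add: divide_le_eq)
  show "\<forall>\<^sub>F w in F. \<forall>j\<in>{1..N w}. \<bar>sinc (\<sigma> w j * \<delta> w)\<bar> \<le> 1" by (intro always_eventually allI ballI sinc1)
  fix \<eta> \<epsilon> :: real assume \<eta>: "0 < \<eta>" and \<epsilon>: "0 < \<epsilon>"
  have "\<forall>\<^sub>F w in F. 1 / (\<eta> * \<epsilon>) < real (N w) * \<delta> w" using \<delta> by (simp add: filterlim_at_top_dense)
  then show "\<forall>\<^sub>F w in F. \<forall>j. 1 \<le> j \<longrightarrow> j < N w \<longrightarrow> \<eta> * real (N w) \<le> real j \<longrightarrow> \<bar>sinc (\<sigma> w j * \<delta> w)\<bar> \<le> \<epsilon>"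
    using w0
  proof eventually_elim
    case (elim w)
    show ?case
    proof (intro allI impI)
      fix j assume j: "1 \<le> j" "j < N w" "\<eta> * real (N w) \<le> real j"
      have n: "0 < real (N w)" using j by simp
      have "0 < 1 / (\<eta> * \<epsilon>)" using \<eta> \<epsilon> by simp
      then have d0: "0 < \<delta> w" using elim(1) n by (meson less_trans zero_less_mult_pos)
      have "real j \<le> (real j - 1 / 2) * 2" using j by simp
      also have "\<dots> \<le> (real j - 1 / 2) * pi" using j pi_ge_two by (intro mult_left_mono) auto
      also have "\<dots> = real j * pi - pi / 2" by (simp add: left_diff_distrib)
      also have "\<dots> < \<sigma> w j" by (rule sigma_bounds) (use elim j in auto)
      finally have "\<eta> * real (N w) < \<sigma> w j" using j(3) by linarith
      then have "\<eta> * real (N w) * \<delta> w < \<sigma> w j * \<delta> w" using d0 by simp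
      moreover have "1 / \<epsilon> < \<eta> * real (N w) * \<delta> w"
        using elim(1) \<eta> \<epsilon> by (simp add: field_simps)
      ultimately have big: "1 / \<epsilon> < \<sigma> w j * \<delta> w" by linarith
      have "0 < 1 / \<epsilon>" using \<epsilon> by simp
      then have p: "0 < \<sigma> w j * \<delta> w" using big by linarith
      have "\<bar>sinc (\<sigma> w j * \<delta> w)\<bar> = \<bar>sin (\<sigma> w j * \<delta> w)\<bar> / (\<sigma> w j * \<delta> w)" using p by (simp only: abs_divide abs_of_pos if_not_P less_imp_neq[THEN not_sym] not_False_eq_True)
      also have "\<dots> \<le> 1 / (\<sigma> w j * \<delta> w)" using p by (intro divide_right_mono) auto
      also have "\<dots> \<le> \<epsilon>" using big p \<epsilon> by (simp add: divide_le_eq divide_less_eq mult.commute)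
      finally show "\<bar>sinc (\<sigma> w j * \<delta> w)\<bar> \<le> \<epsilon>" .
    qed
  qed
qed

text \<open>
  The mirror coefficient per unit of width, for a mirror whose ends have sum \<open>d y\<close> and
  difference \<open>d \<delta>\<close>.
\<close>

definition mirror_weight :: "(real \<Rightarrow> real) \<Rightarrow> (real \<Rightarrow> real) \<Rightarrow> real \<Rightarrow> nat \<Rightarrow> real" where
  "mirror_weight y \<delta> w j = (amp w j)\<^sup>2 * (1 - cos (\<sigma> w j * y w) * sinc (\<sigma> w j * \<delta> w))"

lemma mirror_weight_average:
  assumes F: "F \<le> at_top" and \<delta>: "filterlim (\<lambda>w. real (N w) * \<delta> w) at_top F"
  shows "((\<lambda>w. (\<Sum>j=1..N w. (mirror_weight y \<delta> w j - 2 / d)\<^sup>2) / real (N w)) \<longlongrightarrow> 0) F"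
proof -
  have W: "filterlim (\<lambda>w. w) at_top F" using F by (simp add: filterlim_def filtermap_ident)
  have w0: "\<forall>\<^sub>F w in F. 0 < w" using W by (simp add: filterlim_at_top_dense)
  have sinc1: "\<bar>sinc x\<bar> \<le> 1" for x
    using abs_sin_x_le_abs_x[of x] by (simp add: divide_le_eq)
  have "((\<lambda>w. 4 / d * ((\<Sum>j=1..N w. \<bar>(amp w j)\<^sup>2 - 2 / d\<bar>) / real (N w) + 2 / d * ((\<Sum>j=1..N w. \<bar>sinc (\<sigma> w j * \<delta> w)\<bar>) / real (N w))))
      \<longlongrightarrow> 4 / d * (0 + 2 / d * 0)) F"
    by (intro tendsto_intros amp_square_average[OF F] sinc_average[OF F \<delta>])
  then have lim: "((\<lambda>w. 4 / d * ((\<Sum>j=1..N w. \<bar>(amp w j)\<^sup>2 - 2 / d\<bar>) / real (N w) + 2 / d * ((\<Sum>j=1..N w. \<bar>sinc (\<sigma> w j * \<delta> w)\<bar>) / real (N w))))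
      \<longlongrightarrow> 0) F" by simp
  show ?thesis
  proof (rule Lim_null_comparison[OF _ lim])
    show "\<forall>\<^sub>F w in F. norm ((\<Sum>j=1..N w. (mirror_weight y \<delta> w j - 2 / d)\<^sup>2) / real (N w))
        \<le> 4 / d * ((\<Sum>j=1..N w. \<bar>(amp w j)\<^sup>2 - 2 / d\<bar>) / real (N w) + 2 / d * ((\<Sum>j=1..N w. \<bar>sinc (\<sigma> w j * \<delta> w)\<bar>) / real (N w)))"
      using w0
    proof eventually_elim
      case (elim w)
      have "(mirror_weight y \<delta> w j - 2 / d)\<^sup>2 \<le> 4 / d * (\<bar>(amp w j)\<^sup>2 - 2 / d\<bar> + 2 / d * \<bar>sinc (\<sigma> w j * \<delta> w)\<bar>)"
        if j: "j \<in> {1..N w}" for j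
      proof -
        define s where "s = sinc (\<sigma> w j * \<delta> w)"
        define x where "x = \<bar>mirror_weight y \<delta> w j - 2 / d\<bar>"
        have s: "\<bar>s\<bar> \<le> 1" unfolding s_def by (rule sinc1)
        have "mirror_weight y \<delta> w j - 2 / d = ((amp w j)\<^sup>2 - 2 / d) - (amp w j)\<^sup>2 * (cos (\<sigma> w j * y w) * s)"
          by (simp only: mirror_weight_def s_def right_diff_distrib mult_1_right)
        then have "x \<le> \<bar>(amp w j)\<^sup>2 - 2 / d\<bar> + \<bar>(amp w j)\<^sup>2 * (cos (\<sigma> w j * y w) * s)\<bar>"
          unfolding x_def by (simp only: abs_triangle_ineq4)
        also have "\<bar>(amp w j)\<^sup>2 * (cos (\<sigma> w j * y w) * s)\<bar> \<le> 2 / d * (1 * \<bar>s\<bar>)"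
          unfolding abs_mult using amp_square_bounds[OF elim j] depth_pos by (intro mult_mono) auto
        finally have x1: "x \<le> \<bar>(amp w j)\<^sup>2 - 2 / d\<bar> + 2 / d * \<bar>s\<bar>" by simp
        also have "\<dots> \<le> 2 / d + 2 / d * 1"
          using amp_square_dev_bounded[OF elim j] s depth_pos by (intro add_mono mult_left_mono) auto
        finally have x4: "x \<le> 4 / d" by simp
        have x0: "0 \<le> x" by (simp add: x_def)
        have "(mirror_weight y \<delta> w j - 2 / d)\<^sup>2 = x * x" by (simp add: x_def power2_eq_square)
        also have "\<dots> \<le> 4 / d * (\<bar>(amp w j)\<^sup>2 - 2 / d\<bar> + 2 / d * \<bar>s\<bar>)" using x0 x1 x4 depth_pos by (intro mult_mono) auto
        finally show ?thesis by (simp only: s_def)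
      qed
      then have "(\<Sum>j=1..N w. (mirror_weight y \<delta> w j - 2 / d)\<^sup>2)
          \<le> (\<Sum>j=1..N w. 4 / d * (\<bar>(amp w j)\<^sup>2 - 2 / d\<bar> + 2 / d * \<bar>sinc (\<sigma> w j * \<delta> w)\<bar>))" by (rule sum_mono)
      also have "\<dots> = 4 / d * ((\<Sum>j=1..N w. \<bar>(amp w j)\<^sup>2 - 2 / d\<bar>) + 2 / d * (\<Sum>j=1..N w. \<bar>sinc (\<sigma> w j * \<delta> w)\<bar>))"
        by (simp only: sum_distrib_left[symmetric] sum.distrib)
      finally have "(\<Sum>j=1..N w. (mirror_weight y \<delta> w j - 2 / d)\<^sup>2) / real (N w)
          \<le> 4 / d * ((\<Sum>j=1..N w. \<bar>(amp w j)\<^sup>2 - 2 / d\<bar>) + 2 / d * (\<Sum>j=1..N w. \<bar>sinc (\<sigma> w j * \<delta> w)\<bar>)) / real (N w)"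
        by (rule divide_right_mono) simp
      moreover have "0 \<le> (\<Sum>j=1..N w. (mirror_weight y \<delta> w j - 2 / d)\<^sup>2) / real (N w)" by (intro divide_nonneg_nonneg sum_nonneg) auto
      ultimately show ?case by (simp only: real_norm_def abs_of_nonneg times_divide_eq_right add_divide_distrib[symmetric])
    qed
  qed
qed

text \<open>
  The gaps \<open>\<sigma>\<^sub>l\<^sub>+\<^sub>1 - \<sigma>\<^sub>l\<close> fall short of \<open>\<pi>\<close> by increments of \<open>arcsin\<close>, which add up to at most \<open>\<pi> / 2\<close>. The sum
  therefore stays bounded by \<open>oscillating_sum_bound\<close>, as \<open>sin (\<pi> y / 2)\<close> stays away from \<open>0\<close>.
\<close>

lemma oscillating_average:
  assumes F: "F \<le> at_top" and y: "(y \<longlongrightarrow> y0) F" "0 < y0" "y0 < 2"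
    and f: "\<And>x. x \<in> {0..1} \<Longrightarrow> \<bar>f x\<bar> \<le> C" and K: "0 \<le> K"
    and lip: "\<And>x x'. x \<in> {0..1} \<Longrightarrow> x' \<in> {0..1} \<Longrightarrow> \<bar>f x - f x'\<bar> \<le> K * \<bar>x - x'\<bar>"
  shows "((\<lambda>w. (\<Sum>l=1..N w. f (real l / real (N w)) * cos (\<sigma> w l * y w)) / real (N w)) \<longlongrightarrow> 0) F"
proof -
  have W: "filterlim (\<lambda>w. w) at_top F" using F by (simp add: filterlim_def filtermap_ident)
  have NF: "filterlim N at_top F" by (rule filterlim_compose[OF N_at_top W])
  have w0: "\<forall>\<^sub>F w in F. 0 < w" using W by (simp add: filterlim_at_top_dense)
  have N1: "\<forall>\<^sub>F w in F. 1 \<le> N w" using NF by (simp add: filterlim_at_top)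
  have s0: "0 < sin (pi * y0 / 2)" using y by (intro sin_gt_zero) auto
  have "((\<lambda>w. 2 * sin (pi * y w / 2)) \<longlongrightarrow> 2 * sin (pi * y0 / 2)) F" by (intro tendsto_intros y) auto
  moreover have "sin (pi * y0 / 2) < 2 * sin (pi * y0 / 2)" using s0 by simp
  ultimately have sl: "\<forall>\<^sub>F w in F. sin (pi * y0 / 2) < 2 * sin (pi * y w / 2)" by (rule order_tendstoD(1))
  have yl: "\<forall>\<^sub>F w in F. y w < 2" "\<forall>\<^sub>F w in F. 0 < y w" using order_tendstoD[OF y(1)] y by auto
  define D where "D = (2 * C + C * 2 * (pi / 2) + K) / sin (pi * y0 / 2)"
  have "((\<lambda>w. D / real (N w)) \<longlongrightarrow> 0) F"
    by (rule tendsto_divide_0[OF tendsto_const])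
       (rule filterlim_compose[OF filterlim_at_top_imp_at_infinity[OF filterlim_real_sequentially] NF])
  then show ?thesis
  proof (rule Lim_null_comparison[rotated])
    show "\<forall>\<^sub>F w in F. norm ((\<Sum>l=1..N w. f (real l / real (N w)) * cos (\<sigma> w l * y w)) / real (N w)) \<le> D / real (N w)"
      using w0 N1 sl yl
    proof eventually_elim
      case (elim w)
      define n where "n = N w"
      have n: "1 \<le> n" "0 < real n" using elim by (auto simp: n_def)
      have in01: "real l / real n \<in> {0..1}" if "l \<le> n" for l using that n by auto
      have C0: "0 \<le> C" using f[of 0] by auto
      define X where "X = (\<Sum>l=1..n. f (real l / real n) * cos (\<sigma> w l * y w))"
      have "\<bar>2 * sin (pi * y w / 2)\<bar> * \<bar>X\<bar> \<le> 2 * C + C * \<bar>y w\<bar> * (\<Sum>l=1..<n. \<bar>pi - (\<sigma> w (Suc l) - \<sigma> w l)\<bar>)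
          + (\<Sum>l=1..<n. \<bar>f (real (Suc l) / real n) - f (real l / real n)\<bar>)"
        unfolding X_def by (rule oscillating_sum_bound[OF f n(1)]) (use in01 in auto)
      also have "\<dots> \<le> 2 * C + C * 2 * (pi / 2) + K"
      proof (intro add_mono mult_mono order_refl)
        have "(\<Sum>l=1..<n. \<bar>pi - (\<sigma> w (Suc l) - \<sigma> w l)\<bar>) = (\<Sum>l=1..<n. arcsin (u w (Suc l)) - arcsin (u w l))"
        proof (rule sum.cong[OF refl])
          fix l assume "l \<in> {1..<n}"
          then have l: "1 \<le> l" "l < N w" by (auto simp: n_def)
          show "\<bar>pi - (\<sigma> w (Suc l) - \<sigma> w l)\<bar> = arcsin (u w (Suc l)) - arcsin (u w l)"
            using sigma_gap(1,3)[OF elim(1) l] by linarith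
        qed
        also have "\<dots> = arcsin (u w n) - arcsin (u w 1)" using n(1) by (rule sum_Suc_diff')
        also have "\<dots> \<le> pi / 2"
          using u_bounds[OF elim(1), of n] u_bounds[OF elim(1), of 1] n by (simp add: n_def)
        finally show "(\<Sum>l=1..<n. \<bar>pi - (\<sigma> w (Suc l) - \<sigma> w l)\<bar>) \<le> pi / 2" .
        have "(\<Sum>l=1..<n. \<bar>f (real (Suc l) / real n) - f (real l / real n)\<bar>) \<le> (\<Sum>l=1..<n. K * (1 / real n))"
        proof (rule sum_mono)
          fix l assume l: "l \<in> {1..<n}"
          have "\<bar>real (Suc l) / real n - real l / real n\<bar> = 1 / real n" by (simp add: diff_divide_distrib[symmetric])
          then show "\<bar>f (real (Suc l) / real n) - f (real l / real n)\<bar> \<le> K * (1 / real n)"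
            using lip[of "real (Suc l) / real n" "real l / real n"] in01[of l] in01[of "Suc l"] l by auto
        qed
        also have "\<dots> = K * (real (n - 1) / real n)" by simp
        also have "\<dots> \<le> K * 1" using n K by (intro mult_left_mono) (auto simp: divide_le_eq)
        finally show "(\<Sum>l=1..<n. \<bar>f (real (Suc l) / real n) - f (real l / real n)\<bar>) \<le> K" by simp
      qed (use elim C0 in \<open>auto intro!: sum_nonneg mult_nonneg_nonneg\<close>)
      finally have "\<bar>2 * sin (pi * y w / 2)\<bar> * \<bar>X\<bar> \<le> 2 * C + C * 2 * (pi / 2) + K" .
      moreover have "sin (pi * y0 / 2) * \<bar>X\<bar> \<le> \<bar>2 * sin (pi * y w / 2)\<bar> * \<bar>X\<bar>" using elim by (intro mult_right_mono) auto
      ultimately have "\<bar>X\<bar> * sin (pi * y0 / 2) \<le> 2 * C + C * 2 * (pi / 2) + K" by (simp only: mult.commute[of "\<bar>X\<bar>"]) 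
      then have "\<bar>X\<bar> \<le> D" unfolding D_def using s0 by (simp only: pos_le_divide_eq)
      then have "\<bar>X\<bar> / real n \<le> D / real n" using n by (intro divide_right_mono) auto
      then show ?case by (simp add: X_def n_def)
    qed
  qed
qed

text \<open>
  With \<open>y = (x + x\<^sub>0) / d\<close>, the product of the modes is \<open>A\<^sub>l\<^sup>2 / 2\<close> times \<open>cos (2 \<pi> u\<^sub>l xt) - cos (\<sigma>\<^sub>l y)\<close>, because
  the offset \<open>x - x\<^sub>0\<close> equals \<open>2 \<pi> d xt / B\<close>. After replacing \<open>A\<^sub>l\<^sup>2\<close> by \<open>2 / d\<close> (error \<open>S1\<close>) and \<open>u\<^sub>l\<close> by \<open>l / N\<close>
  (error \<open>S2\<close>), the first cosine gives a Riemann sum (\<open>S3\<close>). The second one (\<open>S4\<close>) averages to zero: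
  \<open>y\<close> tends to \<open>2 x\<^sub>0 / d\<close>, which lies strictly between \<open>0\<close> and \<open>2\<close> for a source inside the ocean.
\<close>

lemma source_sum_tendsto:
  fixes x0 xt :: real
  assumes F: "F \<le> at_top" and x0: "x0 \<in> {0<..<d}"
    and c: "continuous_on {0..1} f" and f: "\<And>x. x \<in> {0..1} \<Longrightarrow> \<bar>f x\<bar> \<le> C" and K: "0 \<le> K"
    and lip: "\<And>x x'. x \<in> {0..1} \<Longrightarrow> x' \<in> {0..1} \<Longrightarrow> \<bar>f x - f x'\<bar> \<le> K * \<bar>x - x'\<bar>"
  shows "((\<lambda>w. (\<Sum>l=1..N w. f (real l / real (N w)) *
        (mode_phi d n1 c w l x0 * mode_phi d n1 c w l (x0 + ocean_wavelength n1 c w / \<theta> * xt))) / real (N w))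
      \<longlongrightarrow> 1 / d * (LINT v:{0..1}|lborel. f v * cos (2 * pi * v * xt))) F"
proof -
  have W: "filterlim (\<lambda>w. w) at_top F" using F by (simp add: filterlim_def filtermap_ident)
  have NF: "filterlim N at_top F" by (rule filterlim_compose[OF N_at_top W])
  have w0: "\<forall>\<^sub>F w in F. 0 < w" using W by (simp add: filterlim_at_top_dense)
  have N1: "\<forall>\<^sub>F w in F. 1 \<le> N w" using NF by (simp add: filterlim_at_top)
  define x where "x w = x0 + ocean_wavelength n1 c w / \<theta> * xt" for w
  have step: "ocean_wavelength n1 c w / \<theta> * xt = 2 * pi * d * xt / B w" if "0 < w" for w
    using theta that speed_pos index_gt_1 depth_pos by (simp add: ocean_wavelength_def B_eq mult_ac)
  have x_eq: "\<forall>\<^sub>F w in F. x0 + 2 * pi * d * xt / B w = x w" using w0 by eventually_elim (simp only: x_def step)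
  have "((\<lambda>w. x0 + 2 * pi * d * xt / B w) \<longlongrightarrow> x0 + 0) F" by (intro tendsto_add tendsto_const inverse_B_tendsto[OF W])
  then have "(x \<longlongrightarrow> x0 + 0) F" using x_eq by (rule Lim_transform_eventually)
  then have xlim: "(x \<longlongrightarrow> x0) F" by simp
  have xd: "\<forall>\<^sub>F w in F. x w < d" using order_tendstoD(2)[OF xlim] x0 by simp
  define y where "y w = (x w + x0) / d" for w
  have ylim: "(y \<longlongrightarrow> (x0 + x0) / d) F" unfolding y_def using depth_pos by (intro tendsto_intros xlim) auto
  have y02: "0 < (x0 + x0) / d" "(x0 + x0) / d < 2" using x0 by (auto simp: divide_less_eq)
  define S1 where "S1 w = (\<Sum>l=1..N w. f (real l / real (N w)) * (((amp w l)\<^sup>2 - 2 / d) / 2 * (cos (2 * pi * u w l * xt) - cos (\<sigma> w l * y w))))" for w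
  define S2 where "S2 w = (\<Sum>l=1..N w. f (real l / real (N w)) * (cos (2 * pi * u w l * xt) - cos (2 * pi * (real l / real (N w)) * xt)))" for w
  define S3 where "S3 w = (\<Sum>l=1..N w. f (real l / real (N w)) * cos (2 * pi * (real l / real (N w)) * xt))" for w
  define S4 where "S4 w = (\<Sum>l=1..N w. f (real l / real (N w)) * cos (\<sigma> w l * y w))" for w
  have C0: "0 \<le> C" using f[of 0] by auto
  have in01: "real l / real n \<in> {0..1}" if "l \<in> {1..n}" for l n :: nat using that by auto
  have L1: "((\<lambda>w. S1 w / real (N w)) \<longlongrightarrow> 0) F"
  proof (rule Lim_null_comparison)
    have "((\<lambda>w. C * ((\<Sum>l=1..N w. \<bar>(amp w l)\<^sup>2 - 2 / d\<bar>) / real (N w))) \<longlongrightarrow> C * 0) F"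
      by (intro tendsto_intros amp_square_average[OF F])
    then show "((\<lambda>w. C * ((\<Sum>l=1..N w. \<bar>(amp w l)\<^sup>2 - 2 / d\<bar>) / real (N w))) \<longlongrightarrow> 0) F" by simp
    show "\<forall>\<^sub>F w in F. norm (S1 w / real (N w)) \<le> C * ((\<Sum>l=1..N w. \<bar>(amp w l)\<^sup>2 - 2 / d\<bar>) / real (N w))"
    proof (rule always_eventually, rule allI)
      fix w
      have "\<bar>S1 w\<bar> \<le> (\<Sum>l=1..N w. C * \<bar>(amp w l)\<^sup>2 - 2 / d\<bar>)"
        unfolding S1_def
      proof (rule order_trans[OF sum_abs sum_mono])
        fix l assume l: "l \<in> {1..N w}"
        have "\<bar>cos (2 * pi * u w l * xt) - cos (\<sigma> w l * y w)\<bar> \<le> 2"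
          using abs_cos_le_one[of "2 * pi * u w l * xt"] abs_cos_le_one[of "\<sigma> w l * y w"] by linarith
        then have "\<bar>(amp w l)\<^sup>2 - 2 / d\<bar> / 2 * \<bar>cos (2 * pi * u w l * xt) - cos (\<sigma> w l * y w)\<bar> \<le> \<bar>(amp w l)\<^sup>2 - 2 / d\<bar> / 2 * 2"
          by (intro mult_left_mono) auto
        then have "\<bar>f (real l / real (N w))\<bar> * (\<bar>(amp w l)\<^sup>2 - 2 / d\<bar> / 2 * \<bar>cos (2 * pi * u w l * xt) - cos (\<sigma> w l * y w)\<bar>)
            \<le> C * \<bar>(amp w l)\<^sup>2 - 2 / d\<bar>"
          using f[OF in01[OF l]] C0 by (intro mult_mono) auto
        then show "\<bar>f (real l / real (N w)) * (((amp w l)\<^sup>2 - 2 / d) / 2 * (cos (2 * pi * u w l * xt) - cos (\<sigma> w l * y w)))\<bar>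
            \<le> C * \<bar>(amp w l)\<^sup>2 - 2 / d\<bar>" by (simp only: abs_mult abs_divide abs_numeral)
      qed
      then have "\<bar>S1 w\<bar> / real (N w) \<le> C * (\<Sum>l=1..N w. \<bar>(amp w l)\<^sup>2 - 2 / d\<bar>) / real (N w)"
        unfolding sum_distrib_left[symmetric] by (rule divide_right_mono) simp
      then show "norm (S1 w / real (N w)) \<le> C * ((\<Sum>l=1..N w. \<bar>(amp w l)\<^sup>2 - 2 / d\<bar>) / real (N w))" by simp
    qed
  qed
  have L2: "((\<lambda>w. S2 w / real (N w)) \<longlongrightarrow> 0) F"
  proof (rule Lim_null_comparison[OF _ inverse_B_tendsto[OF W, of "C * (2 * pi * pi * \<bar>xt\<bar>)"]])
    have lip: "\<bar>cos p - cos q\<bar> \<le> \<bar>p - q\<bar>" for p q :: real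
    proof -
      have "\<bar>cos p - cos q\<bar> = 2 * \<bar>sin ((p + q) / 2)\<bar> * \<bar>sin ((q - p) / 2)\<bar>" by (simp add: cos_diff_cos abs_mult)
      also have "\<dots> \<le> 2 * 1 * \<bar>(q - p) / 2\<bar>" by (intro mult_mono abs_sin_x_le_abs_x) auto
      finally show ?thesis by simp
    qed
    show "\<forall>\<^sub>F w in F. norm (S2 w / real (N w)) \<le> C * (2 * pi * pi * \<bar>xt\<bar>) / B w"
      using w0 N1
    proof eventually_elim
      case (elim w)
      have "\<bar>S2 w\<bar> \<le> (\<Sum>l=1..N w. C * (2 * pi * pi * \<bar>xt\<bar>) / B w)"
        unfolding S2_def
      proof (rule order_trans[OF sum_abs sum_mono])
        fix l assume l: "l \<in> {1..N w}"
        have "\<bar>cos (2 * pi * u w l * xt) - cos (2 * pi * (real l / real (N w)) * xt)\<bar> \<le> \<bar>2 * pi * u w l * xt - 2 * pi * (real l / real (N w)) * xt\<bar>"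
          by (rule lip)
        also have "\<dots> = 2 * pi * \<bar>xt\<bar> * \<bar>u w l - real l / real (N w)\<bar>"
        proof -
          have "2 * pi * u w l * xt - 2 * pi * (real l / real (N w)) * xt = 2 * pi * xt * (u w l - real l / real (N w))" by (simp add: algebra_simps)
          then show ?thesis by (simp add: abs_mult)
        qed
        also have "\<dots> \<le> 2 * pi * \<bar>xt\<bar> * (pi / B w)" by (intro mult_left_mono u_eq_approx elim l) auto
        finally have "\<bar>f (real l / real (N w))\<bar> * \<bar>cos (2 * pi * u w l * xt) - cos (2 * pi * (real l / real (N w)) * xt)\<bar> \<le> C * (2 * pi * \<bar>xt\<bar> * (pi / B w))"
          using f[OF in01[OF l]] C0 by (intro mult_mono) auto
        then show "\<bar>f (real l / real (N w)) * (cos (2 * pi * u w l * xt) - cos (2 * pi * (real l / real (N w)) * xt))\<bar> \<le> C * (2 * pi * pi * \<bar>xt\<bar>) / B w"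
          by (simp add: abs_mult mult_ac)
      qed
      also have "\<dots> = (C * (2 * pi * pi * \<bar>xt\<bar>) / B w) * real (N w)" by simp
      finally show ?case using elim by (simp add: pos_divide_le_eq)
    qed
  qed
  have L3: "((\<lambda>w. S3 w / real (N w)) \<longlongrightarrow> (LINT v:{0..1}|lborel. f v * cos (2 * pi * v * xt))) F"
  proof -
    have "continuous_on {0..1} (\<lambda>v. f v * cos (2 * pi * v * xt))" by (intro continuous_intros c)
    from filterlim_compose[OF Riemann_sum_tendsto[OF this] NF] show ?thesis unfolding S3_def .
  qed
  have L4: "((\<lambda>w. S4 w / real (N w)) \<longlongrightarrow> 0) F"
    unfolding S4_def by (rule oscillating_average[OF F ylim y02 f K lip])
  have "((\<lambda>w. S1 w / real (N w) + 1 / d * (S2 w / real (N w) + S3 w / real (N w) - S4 w / real (N w)))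
      \<longlongrightarrow> 0 + 1 / d * (0 + (LINT v:{0..1}|lborel. f v * cos (2 * pi * v * xt)) - 0)) F"
    by (intro tendsto_intros L1 L2 L3 L4)
  moreover have "\<forall>\<^sub>F w in F. S1 w / real (N w) + 1 / d * (S2 w / real (N w) + S3 w / real (N w) - S4 w / real (N w))
      = (\<Sum>l=1..N w. f (real l / real (N w)) * (mode_phi d n1 c w l x0 * mode_phi d n1 c w l (x w))) / real (N w)"
    using w0 xd
  proof eventually_elim
    case (elim w)
    have b: "0 < B w" by (rule B_pos[OF elim(1)])
    have phi: "mode_phi d n1 c w l x0 * mode_phi d n1 c w l (x w) = (amp w l)\<^sup>2 / 2 * (cos (2 * pi * u w l * xt) - cos (\<sigma> w l * y w))" for l
    proof -
      have "mode_phi d n1 c w l x0 * mode_phi d n1 c w l (x w) = (amp w l)\<^sup>2 * (sin (\<sigma> w l * x w / d) * sin (\<sigma> w l * x0 / d))"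
        using x0 elim(2) by (simp add: mode_phi_def power2_eq_square)
      also have "sin (\<sigma> w l * x w / d) * sin (\<sigma> w l * x0 / d)
          = (cos (\<sigma> w l * x w / d - \<sigma> w l * x0 / d) - cos (\<sigma> w l * x w / d + \<sigma> w l * x0 / d)) / 2" by (rule sin_times_sin)
      also have "\<sigma> w l * x w / d - \<sigma> w l * x0 / d = 2 * pi * u w l * xt"
      proof -
        have "x w = x0 + 2 * pi * d * xt / B w" by (simp only: x_def step[OF elim(1)])
        then show ?thesis using depth_pos b by (simp add: u_def distrib_left add_divide_distrib)
      qed
      also have "\<sigma> w l * x w / d + \<sigma> w l * x0 / d = \<sigma> w l * y w"
        by (simp add: y_def distrib_left add_divide_distrib)
      finally show ?thesis by simp
    qed
    have "S1 w + 1 / d * (S2 w + S3 w - S4 w)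
        = (\<Sum>l=1..N w. f (real l / real (N w)) * (mode_phi d n1 c w l x0 * mode_phi d n1 c w l (x w)))"
      unfolding S1_def S2_def S3_def S4_def phi sum.distrib[symmetric] sum_subtractf[symmetric] sum_distrib_left
      by (intro sum.cong refl) (simp add: algebra_simps diff_divide_distrib)
    moreover have "S1 w / real (N w) + 1 / d * (S2 w / real (N w) + S3 w / real (N w) - S4 w / real (N w))
        = (S1 w + 1 / d * (S2 w + S3 w - S4 w)) / real (N w)"
      by (simp add: add_divide_distrib diff_divide_distrib distrib_left right_diff_distrib)
    ultimately show ?case by simp
  qed
  ultimately have "((\<lambda>w. (\<Sum>l=1..N w. f (real l / real (N w)) * (mode_phi d n1 c w l x0 * mode_phi d n1 c w l (x w))) / real (N w))
      \<longlongrightarrow> 0 + 1 / d * (0 + (LINT v:{0..1}|lborel. f v * cos (2 * pi * v * xt)) - 0)) F"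
    by (rule Lim_transform_eventually)
  then show ?thesis by (simp only: x_def add_0_left diff_0_right)
qed

text \<open>
  \<open>N\<close> is of the order of the inverse wavelength, so this product grows like the wavelength to the
  power \<open>\<alpha> - 1 < 0\<close>.
\<close>

lemma mirror_wider_than_modes:
  assumes F: "F \<le> at_top" and \<alpha>: "\<alpha> \<in> {0..<1}" and D: "0 < D"
  shows "filterlim (\<lambda>w. real (N w) * (ocean_wavelength n1 c w powr \<alpha> * D)) at_top F"
proof -
  have W: "filterlim (\<lambda>w. w) at_top F" using F by (simp add: filterlim_def filtermap_ident)
  have w0: "\<forall>\<^sub>F w in F. 0 < w" using W by (simp add: filterlim_at_top_dense)
  have N1: "\<forall>\<^sub>F w in F. 1 \<le> N w" using filterlim_compose[OF N_at_top W] by (simp add: filterlim_at_top)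
  define K where "K = 2 * pi * d * \<theta>"
  have K: "0 < K" using depth_pos theta by (simp add: K_def)
  have "filterlim (\<lambda>w. exp ((1 - \<alpha>) * ln (1 / K * B w))) at_top F"
    using \<alpha> K by (intro filterlim_compose[OF exp_at_top] filterlim_compose[OF ln_at_top]
        filterlim_tendsto_pos_mult_at_top[OF tendsto_const] filterlim_compose[OF B_at_top W]) auto
  then have "filterlim (\<lambda>w. (K * D / (2 * pi)) * exp ((1 - \<alpha>) * ln (1 / K * B w))) at_top F"
    using K D by (intro filterlim_tendsto_pos_mult_at_top[OF tendsto_const]) auto
  then show ?thesis
  proof (rule filterlim_at_top_mono)
    show "\<forall>\<^sub>F w in F. (K * D / (2 * pi)) * exp ((1 - \<alpha>) * ln (1 / K * B w)) \<le> real (N w) * (ocean_wavelength n1 c w powr \<alpha> * D)"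
      using w0 N1
    proof eventually_elim
      case (elim w)
      have b: "0 < B w" by (rule B_pos[OF elim(1)])
      have lam: "ocean_wavelength n1 c w = K / B w"
        using theta elim speed_pos index_gt_1 depth_pos by (simp add: ocean_wavelength_def B_eq K_def)
      define r where "r = 1 / K * B w"
      have r: "0 < r" using K b by (simp add: r_def)
      have lr: "K / B w = 1 / r" using K b by (simp add: r_def)
      have "exp ((1 - \<alpha>) * ln r) = r powr (1 - \<alpha>)" using r by (simp add: powr_def)
      also have "\<dots> = r * (1 / r) powr \<alpha>" using r by (simp add: powr_diff powr_divide)
      finally have "(K * D / (2 * pi)) * exp ((1 - \<alpha>) * ln r) = (B w / (2 * pi)) * ((1 / r) powr \<alpha> * D)"
        using K by (simp add: r_def)
      also have "\<dots> \<le> real (N w) * ((1 / r) powr \<alpha> * D)"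
      proof (rule mult_right_mono)
        have "B w \<le> 2 * pi * real (N w)" using B_le_N[OF elim(1,2)] elim(2) by (simp add: pos_divide_le_eq)
        then show "B w / (2 * pi) \<le> real (N w)" by (simp add: pos_divide_le_eq mult.commute)
      qed (use D in simp)
      finally show ?case by (simp only: lam lr r_def)
    qed
  qed
qed

text \<open>
  By the symmetry of the chain, the sum over \<open>j\<close> of \<open>m\<^sub>j\<close> times the power transferred from \<open>l\<close> to \<open>j\<close> is
  the power in mode \<open>l\<close> for initial powers \<open>m\<^sub>j\<close>. It is split as \<open>2 / d * S + Y\<close>, according to
  \<open>m\<^sub>j = 2 / d + (m\<^sub>j - 2 / d)\<close>. Here \<open>S\<close> tends to \<open>T1\<close> by \<open>chain_diffusion_limit\<close>, and \<open>Y\<close> to \<open>0\<close> by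
  \<open>chain_stability\<close>, both in mean square, which is enough because the factors \<open>g\<close> of the modes are
  bounded. What remains is the sum of \<open>source_sum_tendsto\<close>.
\<close>

theorem refocused_profile_tendsto:
  fixes T :: "real \<Rightarrow> nat \<Rightarrow> nat \<Rightarrow> real \<Rightarrow> real" and T1 :: "real \<Rightarrow> real \<Rightarrow> real"
  assumes x0: "x0 \<in> {0<..<d}"
    and T: "\<And>w. 0 < w \<Longrightarrow> 2 \<le> N w \<Longrightarrow> solves_coupled_power M V d n1 c w (T w)"
    and \<alpha>: "\<alpha> \<in> {0..<1}" and d12: "0 < d1'" "0 < d2'" and L: "0 < L"
    and T1: "solves_diffusion (a_infty d n1 a g0) T1"
  shows "((\<lambda>w. (ocean_wavelength n1 c w) powr (1 - \<alpha>) / \<theta> *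
             refocused_profile d n1 c T \<alpha> dM d1' d2' x0 w
               (x0 + ocean_wavelength n1 c w / \<theta> * xt) L)
          \<longlongrightarrow> (d2' + d1') / d * limit_profile T1 xt L) (continuum_limit d n1 c)"
proof -
  define F where "F = continuum_limit d n1 c"
  have F: "F \<le> at_top" by (simp add: F_def continuum_limit_def)
  have cut: "filterlim (\<lambda>w. real (N w) * \<zeta> w (N w)) at_top F"
    by (rule filterlim_mono[OF filterlim_filtercomap order_refl]) (simp add: F_def continuum_limit_def)
  have W: "filterlim (\<lambda>w. w) at_top F" using F by (simp add: filterlim_def filtermap_ident)
  have NF: "filterlim N at_top F" by (rule filterlim_compose[OF N_at_top W])
  have w0: "\<forall>\<^sub>F w in F. 0 < w" using W by (simp add: filterlim_at_top_dense)
  have N3: "\<forall>\<^sub>F w in F. 3 \<le> N w" using NF by (simp add: filterlim_at_top)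
  have S0: "0 < S0 d g0" by (rule S0_pos[OF T1])
  define D where "D = d1' + d2'"
  have D: "0 < D" using d12 by (simp add: D_def)
  define lam where "lam w = ocean_wavelength n1 c w" for w
  define \<delta> where "\<delta> w = lam w powr \<alpha> * (D / d)" for w
  define y where "y w = (mirror_bottom n1 c \<alpha> dM d2' w + mirror_top n1 c \<alpha> dM d1' w) / d" for w
  define m where "m w j = mirror_weight y \<delta> w j" for w j
  define X where "X w l = chain (T w) w l" for w l
  define S where "S w j z = (\<Sum>l=1..N w. 1 * X w l j z)" for w j z
  define Y where "Y w j z = (\<Sum>l=1..N w. (m w l - 2 / d) * X w l j z)" for w j z
  define t where "t w j = T1 L (real j / real (N w))" for w j
  define x where "x w = x0 + ocean_wavelength n1 c w / \<theta> * xt" for w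
  define g where "g w l = mode_phi d n1 c w l x0 * mode_phi d n1 c w l (x w)" for w l
  have X: "chain_solution (N w) (coupling w) (X w l)" if "0 < w" "3 \<le> N w" "l \<in> {1..N w}" for w l
    unfolding X_def using that by (intro chain_of_coupled_power T) auto
  have X0: "X w l j 0 = (if j = l then 1 else 0)" if "0 < w" "3 \<le> N w" "l \<in> {1..N w}" "j \<in> {1..N w}" for w l j
  proof -
    have "solves_coupled_power M V d n1 c w (T w)" using that by (intro T) auto
    then show ?thesis using that unfolding solves_coupled_power_def Let_def X_def chain_def by auto
  qed
  have G0: "coupling w 0 = 0" for w by (simp add: coupling_def)

  \<comment> \<open>Each mode starts with power \<open>1\<close>, the initial condition of \<open>T1\<close>.\<close>
  have S_sol: "\<forall>\<^sub>F w in F. chain_solution (N w) (coupling w) (S w) \<and> (\<forall>j\<in>{1..N w}. S w j 0 = 1)"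
    using w0 N3
  proof eventually_elim
    case (elim w)
    have "S w j 0 = 1" if "j \<in> {1..N w}" for j
    proof -
      have "S w j 0 = (\<Sum>l=1..N w. if l = j then 1 else 0)"
        unfolding S_def using X0[OF elim _ that] by (intro sum.cong) auto
      then show ?thesis using that by simp
    qed
    moreover have "chain_solution (N w) (coupling w) (S w)"
      unfolding S_def[abs_def] by (rule chain_solution_sum) (rule X[OF elim])
    ultimately show ?case by blast
  qed
  have E1: "((\<lambda>w. (\<Sum>j=1..N w. (S w j L - t w j)\<^sup>2) / real (N w)) \<longlongrightarrow> 0) F"
    unfolding t_def
  proof (rule chain_diffusion_limit[OF NF _ coupling_bulk[OF F] _ coupling_last[OF S0 F cut] S_sol a_infty_continuous a_infty_pos[OF S0] _ L T1])
    show "\<forall>\<^sub>F w in F. coupling w 0 = 0 \<and> (\<forall>j\<in>{1..N w}. 0 \<le> coupling w j)"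
      using w0 N3 by eventually_elim (simp add: G0 coupling_nonneg)
    show "\<forall>\<^sub>F w in F. \<forall>j\<in>{1..<N w}. coupling w j \<le> ((2 / d)\<^sup>2 * bulk_rate_bound) * (real (N w))\<^sup>2"
      using w0 by eventually_elim (use coupling_upper in blast)
    show "0 \<le> (2 / d)\<^sup>2 * bulk_rate_bound"
      unfolding bulk_rate_bound_def using Q_bound_nonneg index_gt_1 a by (intro mult_nonneg_nonneg) auto
  qed

  \<comment> \<open>The initial data of \<open>Y\<close> are small in mean square as the mirror is wide.\<close>
  have N\<delta>: "filterlim (\<lambda>w. real (N w) * \<delta> w) at_top F"
    unfolding \<delta>_def lam_def using D depth_pos by (intro mirror_wider_than_modes[OF F \<alpha>]) auto
  have E2: "((\<lambda>w. (\<Sum>j=1..N w. (Y w j L)\<^sup>2) / real (N w)) \<longlongrightarrow> 0) F"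
  proof (rule Lim_null_comparison)
    have "((\<lambda>w. exp L * ((\<Sum>j=1..N w. (m w j - 2 / d)\<^sup>2) / real (N w))) \<longlongrightarrow> exp L * 0) F"
      unfolding m_def by (intro tendsto_intros mirror_weight_average[OF F N\<delta>])
    then show "((\<lambda>w. exp L * ((\<Sum>j=1..N w. (m w j - 2 / d)\<^sup>2) / real (N w))) \<longlongrightarrow> 0) F" by simp
    show "\<forall>\<^sub>F w in F. norm ((\<Sum>j=1..N w. (Y w j L)\<^sup>2) / real (N w)) \<le> exp L * ((\<Sum>j=1..N w. (m w j - 2 / d)\<^sup>2) / real (N w))"
      using w0 N3
    proof eventually_elim
      case (elim w)
      have "chain_solution (N w) (coupling w) (Y w)"
        unfolding Y_def[abs_def] using X[OF elim] by (rule chain_solution_sum)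
      then have "(\<Sum>j=1..N w. (Y w j L)\<^sup>2) \<le> exp L * (\<Sum>j=1..N w. (Y w j 0)\<^sup>2)"
        by (rule chain_stability) (use elim L in \<open>auto simp: G0 coupling_nonneg\<close>)
      also have "(\<Sum>j=1..N w. (Y w j 0)\<^sup>2) = (\<Sum>j=1..N w. (m w j - 2 / d)\<^sup>2)"
      proof (rule sum.cong[OF refl])
        fix j assume j: "j \<in> {1..N w}"
        have "Y w j 0 = (\<Sum>l=1..N w. if l = j then m w l - 2 / d else 0)"
          unfolding Y_def using X0[OF elim _ j] by (intro sum.cong) auto
        then show "(Y w j 0)\<^sup>2 = (m w j - 2 / d)\<^sup>2" using j by simp
      qed
      finally have "(\<Sum>j=1..N w. (Y w j L)\<^sup>2) / real (N w) \<le> exp L * (\<Sum>j=1..N w. (m w j - 2 / d)\<^sup>2) / real (N w)"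
        by (rule divide_right_mono) simp
      moreover have "0 \<le> (\<Sum>j=1..N w. (Y w j L)\<^sup>2) / real (N w)" by (intro divide_nonneg_nonneg sum_nonneg) auto
      ultimately show ?case by (simp only: real_norm_def abs_of_nonneg times_divide_eq_right)
    qed
  qed

  have xd: "\<forall>\<^sub>F w in F. x w < d"
  proof -
    have "((\<lambda>w. x0 + 2 * pi * d * xt / B w) \<longlongrightarrow> x0 + 0) F" by (intro tendsto_add tendsto_const inverse_B_tendsto[OF W])
    then have "\<forall>\<^sub>F w in F. x0 + 2 * pi * d * xt / B w < d" by (rule order_tendstoD(2)) (use x0 in simp)
    then show ?thesis
      using w0
    proof eventually_elim
      case (elim w)
      have "ocean_wavelength n1 c w / \<theta> * xt = 2 * pi * d * xt / B w"
        using theta elim speed_pos index_gt_1 depth_pos by (simp add: ocean_wavelength_def B_eq mult_ac)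
      then show ?case using elim by (simp only: x_def)
    qed
  qed
  define R where "R w = (\<Sum>l=1..N w. g w l * (Y w l L + 2 / d * (S w l L - t w l))) / real (N w)" for w
  have E3: "(R \<longlongrightarrow> 0) F"
  proof (rule Lim_null_comparison)
    have "((\<lambda>w. 2 / d * sqrt (2 * ((\<Sum>j=1..N w. (Y w j L)\<^sup>2) / real (N w)) + 2 * (2 / d)\<^sup>2 * ((\<Sum>j=1..N w. (S w j L - t w j)\<^sup>2) / real (N w))))
        \<longlongrightarrow> 2 / d * sqrt (2 * 0 + 2 * (2 / d)\<^sup>2 * 0)) F"
      by (intro tendsto_intros E1 E2)
    then show "((\<lambda>w. 2 / d * sqrt (2 * ((\<Sum>j=1..N w. (Y w j L)\<^sup>2) / real (N w)) + 2 * (2 / d)\<^sup>2 * ((\<Sum>j=1..N w. (S w j L - t w j)\<^sup>2) / real (N w))))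
        \<longlongrightarrow> 0) F" by simp
    show "\<forall>\<^sub>F w in F. norm (R w) \<le> 2 / d * sqrt (2 * ((\<Sum>j=1..N w. (Y w j L)\<^sup>2) / real (N w)) + 2 * (2 / d)\<^sup>2 * ((\<Sum>j=1..N w. (S w j L - t w j)\<^sup>2) / real (N w)))"
      using w0 N3 xd
    proof eventually_elim
      case (elim w)
      define n where "n = real (N w)"
      define q where "q l = Y w l L + 2 / d * (S w l L - t w l)" for l
      have n: "0 < n" using elim by (simp add: n_def)
      have gb: "\<bar>g w l\<bar> \<le> 2 / d" if l: "l \<in> {1..N w}" for l
      proof -
        have "g w l = (amp w l)\<^sup>2 * (sin (\<sigma> w l * x0 / d) * sin (\<sigma> w l * x w / d))"
          using x0 elim(3) by (simp add: g_def mode_phi_def power2_eq_square)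
        then have "\<bar>g w l\<bar> = (amp w l)\<^sup>2 * (\<bar>sin (\<sigma> w l * x0 / d)\<bar> * \<bar>sin (\<sigma> w l * x w / d)\<bar>)" by (simp add: abs_mult)
        also have "\<dots> \<le> 2 / d * (1 * 1)"
          using amp_square_bounds[OF elim(1) l] depth_pos by (intro mult_mono) auto
        finally show ?thesis by simp
      qed
      have "\<bar>\<Sum>l=1..N w. g w l * q l\<bar> \<le> (\<Sum>l=1..N w. 2 / d * \<bar>q l\<bar>)"
      proof (rule order_trans[OF sum_abs sum_mono])
        fix l assume "l \<in> {1..N w}"
        then show "\<bar>g w l * q l\<bar> \<le> 2 / d * \<bar>q l\<bar>" unfolding abs_mult using gb by (intro mult_right_mono) auto
      qed
      then have "\<bar>\<Sum>l=1..N w. g w l * q l\<bar> / n \<le> 2 / d * (\<Sum>l=1..N w. \<bar>q l\<bar>) / n"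
        using n unfolding sum_distrib_left[symmetric] by (intro divide_right_mono) auto
      moreover have "\<bar>R w\<bar> = \<bar>\<Sum>l=1..N w. g w l * q l\<bar> / n" using n by (simp add: R_def q_def n_def)
      ultimately have 1: "\<bar>R w\<bar> \<le> 2 / d * ((\<Sum>l=1..N w. \<bar>q l\<bar>) / n)" by (simp only: times_divide_eq_right)
      have "(\<Sum>l=1..N w. \<bar>q l\<bar>) / n \<le> sqrt ((\<Sum>l=1..N w. (q l)\<^sup>2) / n)"
      proof (rule real_le_rsqrt)
        have "(\<Sum>l=1..N w. \<bar>q l\<bar>)\<^sup>2 \<le> (\<Sum>l=1..N w. \<bar>q l\<bar>\<^sup>2) * n"
          using sum_squared_le_sum_of_squares[of "\<lambda>l. \<bar>q l\<bar>" "{1..N w}"] by (simp add: n_def)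
        then have "(\<Sum>l=1..N w. \<bar>q l\<bar>)\<^sup>2 / (n * n) \<le> ((\<Sum>l=1..N w. (q l)\<^sup>2) * n) / (n * n)"
          by (intro divide_right_mono) auto
        then show "((\<Sum>l=1..N w. \<bar>q l\<bar>) / n)\<^sup>2 \<le> (\<Sum>l=1..N w. (q l)\<^sup>2) / n"
          using n by (simp add: power_divide power2_eq_square[of n])
      qed
      also have "\<dots> \<le> sqrt (2 * ((\<Sum>j=1..N w. (Y w j L)\<^sup>2) / n) + 2 * (2 / d)\<^sup>2 * ((\<Sum>j=1..N w. (S w j L - t w j)\<^sup>2) / n))"
      proof (rule real_sqrt_le_mono)
        have "(\<Sum>l=1..N w. (q l)\<^sup>2) \<le> (\<Sum>l=1..N w. 2 * (Y w l L)\<^sup>2 + 2 * (2 / d)\<^sup>2 * (S w l L - t w l)\<^sup>2)"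
        proof (rule sum_mono)
          fix l
          show "(q l)\<^sup>2 \<le> 2 * (Y w l L)\<^sup>2 + 2 * (2 / d)\<^sup>2 * (S w l L - t w l)\<^sup>2"
            using square_sum_le[of "Y w l L" "2 / d * (S w l L - t w l)"] by (simp only: q_def power_mult_distrib mult.assoc)
        qed
        also have "\<dots> = 2 * (\<Sum>j=1..N w. (Y w j L)\<^sup>2) + 2 * (2 / d)\<^sup>2 * (\<Sum>j=1..N w. (S w j L - t w j)\<^sup>2)"
          by (simp only: sum.distrib sum_distrib_left)
        finally have "(\<Sum>l=1..N w. (q l)\<^sup>2) / n \<le> (2 * (\<Sum>j=1..N w. (Y w j L)\<^sup>2) + 2 * (2 / d)\<^sup>2 * (\<Sum>j=1..N w. (S w j L - t w j)\<^sup>2)) / n"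
          using n by (intro divide_right_mono) auto
        then show "(\<Sum>l=1..N w. (q l)\<^sup>2) / n \<le> 2 * ((\<Sum>j=1..N w. (Y w j L)\<^sup>2) / n) + 2 * (2 / d)\<^sup>2 * ((\<Sum>j=1..N w. (S w j L - t w j)\<^sup>2) / n)"
          by (simp only: add_divide_distrib times_divide_eq_right)
      qed
      finally have "2 / d * ((\<Sum>l=1..N w. \<bar>q l\<bar>) / n)
          \<le> 2 / d * sqrt (2 * ((\<Sum>j=1..N w. (Y w j L)\<^sup>2) / n) + 2 * (2 / d)\<^sup>2 * ((\<Sum>j=1..N w. (S w j L - t w j)\<^sup>2) / n))"
        using depth_pos by (intro mult_left_mono) auto
      then show ?case using 1 unfolding real_norm_def n_def[symmetric] by (rule order_trans[rotated])
    qed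
  qed

  have E4: "((\<lambda>w. (\<Sum>l=1..N w. t w l * g w l) / real (N w)) \<longlongrightarrow> 1 / d * limit_profile T1 xt L) F"
  proof -
    obtain Tu where
      dT: "\<And>u. u \<in> {0..1} \<Longrightarrow> (T1 L has_real_derivative Tu u) (at u within {0..1})" and cTu: "continuous_on {0..1} Tu"
    proof -
      obtain Tu where c: "continuous_on ({0<..} \<times> {0..1}) (\<lambda>(z, u). Tu z u)"
        and p: "\<And>u. u \<in> {0..1} \<Longrightarrow> (T1 L has_real_derivative Tu L u) (at u within {0..1})"
        using T1 L unfolding solves_diffusion_def by blast
      have "continuous_on {0..1} (\<lambda>u. (\<lambda>(z, u). Tu z u) (L, u))"
        by (rule continuous_on_compose2[OF c]) (use L in \<open>auto intro!: continuous_intros\<close>)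
      then show ?thesis using that[of "Tu L"] p by simp
    qed
    have cT: "continuous_on {0..1} (T1 L)" using dT by (meson DERIV_continuous continuous_on_eq_continuous_within)
    obtain C where C: "\<And>u. u \<in> {0..1} \<Longrightarrow> \<bar>T1 L u\<bar> \<le> C"
      using compact_imp_bounded[OF compact_continuous_image[OF cT compact_Icc]] unfolding bounded_iff by (auto simp del: atLeastAtMost_iff)
    obtain K where K: "\<And>u. u \<in> {0..1} \<Longrightarrow> \<bar>Tu u\<bar> \<le> K"
      using compact_imp_bounded[OF compact_continuous_image[OF cTu compact_Icc]] unfolding bounded_iff by (auto simp del: atLeastAtMost_iff)
    have K0: "0 \<le> K" using K[of 0] by auto
    have lip1: "\<bar>T1 L v - T1 L v'\<bar> \<le> K * \<bar>v - v'\<bar>" if le: "v' \<le> v" and v: "v \<in> {0..1}" "v' \<in> {0..1}" for v v'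
    proof -
      have sub: "{v'..v} \<subseteq> {0..1}" using v by auto
      obtain s where s: "s \<in> {v'..v}" "T1 L v - T1 L v' = (v - v') * Tu s"
        using mvt_within[OF le sub, of "T1 L" Tu] dT sub by blast
      have "\<bar>Tu s\<bar> \<le> K" using K s(1) sub by blast
      then have "\<bar>v - v'\<bar> * \<bar>Tu s\<bar> \<le> \<bar>v - v'\<bar> * K" by (rule mult_left_mono) simp
      then show ?thesis unfolding s(2) abs_mult by (simp only: mult.commute)
    qed
    have lip: "\<bar>T1 L v - T1 L v'\<bar> \<le> K * \<bar>v - v'\<bar>" if "v \<in> {0..1}" "v' \<in> {0..1}" for v v'
      using lip1[of v' v] lip1[of v v'] that by (cases "v' \<le> v") (auto simp: abs_minus_commute)
    show ?thesis
      unfolding t_def g_def x_def limit_profile_def by (rule source_sum_tendsto[OF F x0 cT C K0 lip])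
  qed

  have NB: "((\<lambda>w. real (N w) / B w) \<longlongrightarrow> 1 / pi) F"
  proof -
    have "((\<lambda>w. 1 / (B w / real (N w))) \<longlongrightarrow> 1 / pi) F" by (intro tendsto_intros B_over_N_tendsto[OF W]) auto
    then show ?thesis by simp
  qed
  have "((\<lambda>w. D * (pi * d / 2) * (real (N w) / B w) * (R w + 2 / d * ((\<Sum>l=1..N w. t w l * g w l) / real (N w))))
      \<longlongrightarrow> D * (pi * d / 2) * (1 / pi) * (0 + 2 / d * (1 / d * limit_profile T1 xt L))) F"
    by (intro tendsto_intros NB E3 E4)
  also have "D * (pi * d / 2) * (1 / pi) * (0 + 2 / d * (1 / d * limit_profile T1 xt L)) = (d2' + d1') / d * limit_profile T1 xt L"
    using depth_pos by (simp add: D_def add.commute)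
  finally have lim: "((\<lambda>w. D * (pi * d / 2) * (real (N w) / B w) * (R w + 2 / d * ((\<Sum>l=1..N w. t w l * g w l) / real (N w))))
      \<longlongrightarrow> (d2' + d1') / d * limit_profile T1 xt L) F" .
  have "\<forall>\<^sub>F w in F. D * (pi * d / 2) * (real (N w) / B w) * (R w + 2 / d * ((\<Sum>l=1..N w. t w l * g w l) / real (N w)))
      = lam w powr (1 - \<alpha>) / \<theta> * refocused_profile d n1 c T \<alpha> dM d1' d2' x0 w (x w) L"
    using w0 N3
  proof eventually_elim
    case (elim w)
    have n: "0 < real (N w)" using elim by simp
    have b: "0 < B w" by (rule B_pos[OF elim(1)])
    \<comment> \<open>The prefactor \<open>\<lambda> / (4 \<theta>)\<close> is \<open>\<pi> d / (2 B)\<close>; with \<open>B \<approx> \<pi> N\<close> it turns the sum over modes into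
      \<open>d / 2\<close> times an average.\<close>
    have lamw: "lam w = 2 * pi * d * \<theta> / B w" "0 < lam w"
      using theta elim speed_pos index_gt_1 depth_pos by (simp_all add: lam_def ocean_wavelength_def B_eq)
    have width: "mirror_bottom n1 c \<alpha> dM d2' w - mirror_top n1 c \<alpha> dM d1' w = lam w powr \<alpha> * D"
      by (simp add: mirror_bottom_def mirror_top_def lam_def D_def algebra_simps)
    have coeff: "mirror_coeff d n1 c (mirror_top n1 c \<alpha> dM d1' w) (mirror_bottom n1 c \<alpha> dM d2' w) w j = lam w powr \<alpha> * D * m w j" for j
      unfolding mirror_coeff_def width m_def mirror_weight_def y_def \<delta>_def by (simp only: mult.assoc times_divide_eq_right)
    have sym: "X w l j L = X w j l L" if "j \<in> {1..N w}" "l \<in> {1..N w}" for j l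
      by (rule chain_symmetry[OF X[OF elim] G0 X0[OF elim]]) (use that L in auto)
    have TX: "T w l j L = X w l j L" if "j \<in> {1..N w}" for j l using that by (simp add: X_def chain_def)
    have inner: "(\<Sum>j=1..N w. m w j * T w l j L) = Y w l L + 2 / d * S w l L" if l: "l \<in> {1..N w}" for l
    proof -
      have "(\<Sum>j=1..N w. m w j * T w l j L) = (\<Sum>j=1..N w. (m w j - 2 / d) * X w j l L + 2 / d * (1 * X w j l L))"
        using l by (intro sum.cong refl) (simp add: TX sym algebra_simps)
      then show ?thesis by (simp only: Y_def S_def sum.distrib sum_distrib_left)
    qed
    define Z where "Z = (\<Sum>l=1..N w. g w l * (Y w l L + 2 / d * S w l L))"
    have "(\<Sum>j=1..N w. \<Sum>l=1..N w. lam w powr \<alpha> * D * m w j * T w l j L * mode_phi d n1 c w l x0 * mode_phi d n1 c w l (x w))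
        = (\<Sum>l=1..N w. \<Sum>j=1..N w. lam w powr \<alpha> * D * m w j * T w l j L * mode_phi d n1 c w l x0 * mode_phi d n1 c w l (x w))"
      by (rule sum.swap)
    also have "\<dots> = (\<Sum>l=1..N w. lam w powr \<alpha> * D * (g w l * (\<Sum>j=1..N w. m w j * T w l j L)))"
      by (simp add: sum_distrib_left g_def mult_ac)
    also have "\<dots> = (\<Sum>l=1..N w. lam w powr \<alpha> * D * (g w l * (Y w l L + 2 / d * S w l L)))"
      by (intro sum.cong refl) (simp only: inner)
    also have "\<dots> = lam w powr \<alpha> * D * Z" by (simp only: Z_def sum_distrib_left)
    finally have rp: "refocused_profile d n1 c T \<alpha> dM d1' d2' x0 w (x w) L = 1 / 4 * (lam w powr \<alpha> * D * Z)"
      unfolding refocused_profile_def coeff by (simp only:)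
    have "lam w powr (1 - \<alpha>) / \<theta> * refocused_profile d n1 c T \<alpha> dM d1' d2' x0 w (x w) L
        = (lam w powr (1 - \<alpha>) * lam w powr \<alpha>) / (4 * \<theta>) * (D * Z)" unfolding rp by simp
    also have "lam w powr (1 - \<alpha>) * lam w powr \<alpha> = lam w" using lamw(2) by (simp add: powr_add[symmetric])
    also have "lam w / (4 * \<theta>) * (D * Z) = D * (pi * d / 2) * (real (N w) / B w) * (Z / real (N w))"
      using theta n unfolding lamw(1) by simp
    also have "Z / real (N w) = R w + 2 / d * ((\<Sum>l=1..N w. t w l * g w l) / real (N w))"
    proof -
      have "Z = (\<Sum>l=1..N w. g w l * (Y w l L + 2 / d * (S w l L - t w l))) + 2 / d * (\<Sum>l=1..N w. t w l * g w l)"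
        unfolding Z_def sum_distrib_left sum.distrib[symmetric] by (intro sum.cong refl) (simp add: algebra_simps diff_divide_distrib)
      then show ?thesis unfolding R_def by (simp only: add_divide_distrib times_divide_eq_right)
    qed
    finally show ?case by simp
  qed
  with lim have "((\<lambda>w. lam w powr (1 - \<alpha>) / \<theta> * refocused_profile d n1 c T \<alpha> dM d1' d2' x0 w (x w) L)
      \<longlongrightarrow> (d2' + d1') / d * limit_profile T1 xt L) F" by (rule Lim_transform_eventually)
  then show ?thesis unfolding lam_def x_def F_def .
qed

end

theorem theorem3p7:
  fixes M :: "'a measure" and V :: "real \<Rightarrow> real \<Rightarrow> 'a \<Rightarrow> real"
    and \<gamma>\<^sub>0 :: "real \<Rightarrow> real \<Rightarrow> real"
    and d n1 c x0 a \<alpha>M dM d1' d2' L xt :: real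
    and T :: "real \<Rightarrow> nat \<Rightarrow> nat \<Rightarrow> real \<Rightarrow> real"
    and T1 :: "real \<Rightarrow> real \<Rightarrow> real"
  assumes "0 < d" and "1 < n1" and "0 < c" and "x0 \<in> {0<..<d}" and "0 < a"
    and "random_medium M V d a \<gamma>\<^sub>0"
    and "\<forall>w>0. 2 \<le> num_modes d n1 c w \<longrightarrow> solves_coupled_power M V d n1 c w (T w)"
    and "\<alpha>M \<in> {0..<1}" and "dM \<in> {0<..<d}" and "0 < d1'" and "0 < d2'"
    and "\<forall>\<^sub>F w in at_top. 0 \<le> mirror_top n1 c \<alpha>M dM d1' w \<and> mirror_bottom n1 c \<alpha>M dM d2' w \<le> d"
    and "0 < L"
    and "solves_diffusion (a_infty d n1 a \<gamma>\<^sub>0) T1"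
  shows "((\<lambda>w. (ocean_wavelength n1 c w) powr (1 - \<alpha>M) / index_theta n1 *
             refocused_profile d n1 c T \<alpha>M dM d1' d2' x0 w
               (x0 + ocean_wavelength n1 c w / index_theta n1 * xt) L)
          \<longlongrightarrow> (d2' + d1') / d * limit_profile T1 xt L) (continuum_limit d n1 c)"
proof -
  interpret ocean d n1 c a M V \<gamma>\<^sub>0
    by unfold_locales (use assms in auto)
  show ?thesis
    using assms by (intro refocused_profile_tendsto) auto
qed

end
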